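(* Let us fix $0<r<4/3$. For an integer $N\geqslant 1$ and real $T$ with $N^2<T$, we have $$\frac1T\int_0^T\Bigg|\sum_{n\leqslant N}n^{it}\Bigg|^r\,dt\gg\frac{N^{r/2}}{\mathcal{E}(N)^{1-r/2}},$$ with an implied constant depending at most on $r$. In particular, $$\lim_{T\to+\infty}\frac1T\int_0^T\Bigg|\sum_{n\leqslant N}n^{it}\Bigg|\,dt\gg\frac{\sqrt N}{\mathcal{E}(N)^{1/2}}\gg\frac{\sqrt N}{(\log N)^{\delta/2+o(1)}},$$ where $\delta:=1-\frac{1+\log\log 2}{\log 2}$, so that $\delta/2\approx 0.043$, and in the last bound $o(1)\to 0$ as $N\to+\infty$.
   Context: For an integer $N\geqslant 1$ and a nonzero tuple of non-negative weights $w=(w(1),\dots,w(N))$, put $\|w\|_1=\sum_{m\leqslant N}w(m)$ and $$\mathcal{E}(N,w):=\sum_{\substack{m_1,m_2,n_1,n_2\leqslant N\\ m_1m_2=n_1n_2}}w(m_1)w(m_2)w(n_1)w(n_2),$$ the variables being positive integers. Define $\mathcal{E}(N):=\inf_{w}\frac{N^2\,\mathcal{E}(N,w)}{\|w\|_1^4}$, the infimum being over all such nonzero $w$. *)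

theory Defs
  imports "HOL-Analysis.Analysis"
begin

(* A weight is a function on nat, of which only the values on {1..N} are ever used. *)

definition weight_sum :: "nat \<Rightarrow> (nat \<Rightarrow> real) \<Rightarrow> real" where
  "weight_sum N w = (\<Sum>m = 1..N. w m)"

definition mult_energy :: "nat \<Rightarrow> (nat \<Rightarrow> real) \<Rightarrow> real" where
  "mult_energy N w =
     (\<Sum>(m1, m2, n1, n2) \<in> {(m1, m2, n1, n2). m1 \<in> {1..N} \<and> m2 \<in> {1..N} \<and>
          n1 \<in> {1..N} \<and> n2 \<in> {1..N} \<and> m1 * m2 = n1 * n2}. w m1 * w m2 * w n1 * w n2)"

definition admissible_weights :: "nat \<Rightarrow> (nat \<Rightarrow> real) set" where
  "admissible_weights N = {w. (\<forall>m\<in>{1..N}. 0 \<le> w m) \<and> (\<exists>m\<in>{1..N}. w m \<noteq> 0)}"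

(* For N \<ge> 1 the infimum is over a nonempty set of nonnegative reals,
   so the conditionally complete Inf on real is the true infimum. *)
definition min_energy :: "nat \<Rightarrow> real" where
  "min_energy N =
     (INF w\<in>admissible_weights N. (real N)\<^sup>2 * mult_energy N w / weight_sum N w ^ 4)"

definition zeta_sum :: "nat \<Rightarrow> real \<Rightarrow> complex" where
  "zeta_sum N t = (\<Sum>n = 1..N. of_nat n powr (\<i> * of_real t))"

definition delta :: real where
  "delta = 1 - (1 + ln (ln 2)) / ln 2"

end

theory Submission
  imports Defs "HOL-Number_Theory.Number_Theory" "HOL-Combinatorics.Combinatorics"
    "HOL-Real_Asymp.Real_Asymp"
begin

text \<open>
  For the moments, let \<open>Z\<close> be the zeta sum and \<open>M t = (\<Sum>m\<le>N. w m * m powr (i * t))\<close>. Averaging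
  \<open>Z * cnj M\<close> against the weight \<open>1 - t / T\<close>, whose cosine transform is nonnegative, bounds the mean of
  \<open>norm Z * norm M\<close> below by half the weight sum. Hoelder's inequality with the three factors
  \<open>norm Z powr r\<close>, \<open>(norm Z)\<^sup>2\<close> and \<open>norm M ^ 4\<close> (here \<open>r < 4 / 3\<close> is needed), the bound \<open>O(N)\<close> for the
  mean square of \<open>Z\<close> and the bound \<open>O(mult_energy N w)\<close> for the fourth moment of \<open>M\<close> give the
  claim for every \<open>w\<close>, hence for the infimum.

  For the upper bound on the minimal energy, let \<open>w m\<close> count the representations of \<open>m\<close> as a product of
  \<open>k\<close> primes from each of the scales between \<open>exp (4 ^ (k * s))\<close> and \<open>exp (4 ^ (k * (s + 1)))\<close>, \<open>s < n\<close>, and one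
  large prime that puts \<open>m\<close> within a constant factor of \<open>N\<close>. In a solution of \<open>m1 * m2 = n1 * n2\<close> the large
  primes agree up to order and the remaining tuples differ by a permutation of the indices that
  respects the scales. If scale \<open>s\<close> is the largest at which this permutation moves a prime from one side
  to the other, then there are \<open>binomial (2 * k) k \<le> 4 ^ k\<close> times more permutations for each scale
  up to \<open>s\<close>, while one prime at scale \<open>s\<close> is confined to a short interval, which saves a factor
  \<open>4 ^ (k * s)\<close>. The two effects cancel, so the energy is nearly as small as its diagonal part; letting
  \<open>k\<close> tend to infinity yields the exponent \<open>delta\<close>.
\<close>

section \<open>Prime number estimates\<close>

text \<open>The base 4 of the scales comes from a balance. With \<open>c\<close> primes per unit of
  \<open>ln (ln N)\<close>, letting one more unit mix freely between the two sides multiplies the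
  permutations by about \<open>4 powr c\<close>, while a prime pinned one unit higher saves a factor
  \<open>exp 1\<close>. The two agree at \<open>c = 1 / ln 4\<close>, that is, for \<open>k\<close>
  primes on a scale of length \<open>k * ln 4\<close>. A product of two such integers has about
  \<open>ln (ln N) / ln 2\<close> prime factors, the number that governs Erdos' multiplication table
  problem; hence the same \<open>delta\<close>. Prescribing only the total number of primes would
  admit tuples crowded with small primes, whose permutations outweigh the saving; a fixed number on
  every scale prevents this. The error \<open>C0\<close> in Mertens' theorem and the factor
  \<open>exp 1 * k\<close> in Stirling's bound are paid on every scale, so the scales themselves
  must be long: taking \<open>n\<close> large alone would leave a fixed loss in the exponent. The
  condition \<open>N\<^sup>2 < T\<close> ensures that the square of \<open>M\<close>, a Dirichlet
  polynomial of length \<open>N\<^sup>2\<close>, obeys the diagonal mean-square bound.\<close>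

abbreviation primes_upto :: "real \<Rightarrow> nat set" where
  "primes_upto x \<equiv> {p. prime p \<and> real p \<le> x}"

lemma finite_nat_le_real [simp]: "finite {p::nat. P p \<and> real p \<le> x}"
  by (rule finite_subset[of _ "{..nat \<lfloor>x\<rfloor>}"]) (auto simp: le_nat_floor)

section \<open>Chebyshev's upper bound for the number of primes\<close>

lemma prod_primes_dvd:
  fixes n :: nat
  assumes "finite A" "\<And>p. p \<in> A \<Longrightarrow> prime p \<and> p dvd n"
  shows "\<Prod>A dvd n"
  using assms
proof (induction rule: finite_induct)
  case (insert p A)
  have "coprime p (\<Prod>A)"
    by (rule prod_coprime_right) (metis insert insertI1 insertI2 primes_coprime)
  then show ?case
    using insert by (simp add: divides_mult)
qed simp

text \<open>Such a prime divides \<open>fact (m + k)\<close> but neither \<open>fact m\<close> nor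
  \<open>fact k\<close>.\<close>

lemma primes_dvd_binomial:
  assumes "prime p" "m < p" "k < p" "p \<le> m + k"
  shows "p dvd (m + k) choose m"
proof -
  have "p dvd fact (m + k)"
    using assms by (simp add: prime_dvd_fact_iff)
  moreover have "fact (m + k) = fact m * fact k * ((m + k) choose m)"
    by (metis add_diff_cancel_left' binomial_fact_lemma le_add1)
  ultimately show ?thesis
    using assms by (simp add: prime_dvd_mult_iff prime_dvd_fact_iff)
qed

text \<open>The two inequalities between \<open>k\<close> and \<open>m\<close> leave
  \<open>k = m\<close> and \<open>k = Suc m\<close>, the even and the odd step of
  \<open>theta_bound\<close>. Each of the primes divides the binomial coefficient, hence so does
  their product.\<close>

lemma sum_ln_primes_binomial:
  fixes m k :: nat
  assumes "k \<le> Suc m" "m \<le> k"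
  shows "(\<Sum>p | prime p \<and> k < p \<and> p \<le> m + k. ln (real p)) \<le> ln (real ((m + k) choose m))"
proof -
  let ?A = "{p. prime p \<and> k < p \<and> p \<le> m + k}"
  have fin: "finite ?A"
    by simp
  have "\<Prod>?A dvd (m + k) choose m"
    by (rule prod_primes_dvd) (use assms in \<open>auto intro: primes_dvd_binomial\<close>)
  then have "\<Prod>?A \<le> (m + k) choose m"
    by (rule dvd_imp_le) simp
  moreover have "0 < \<Prod>?A"
    by (auto intro!: prod_pos prime_gt_0_nat)
  ultimately have "ln (real (\<Prod>?A)) \<le> ln (real ((m + k) choose m))"
    by (subst ln_le_cancel_iff) (simp_all only: of_nat_0_less_iff of_nat_le_iff zero_less_binomial_iff le_add1)
  moreover have "ln (real (\<Prod>?A)) = (\<Sum>p\<in>?A. ln (real p))"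
    by (subst of_nat_prod, rule ln_prod) (auto simp: prime_gt_0_nat)
  ultimately show ?thesis
    by simp
qed

lemma binomial_even_le: "(2 * m) choose m \<le> 4 ^ m"
  using binomial_le_pow2[of "2 * m" m] by (simp add: power_mult)

text \<open>The row has two equal middle entries, whose sum is at most
  \<open>2 ^ (2 * m + 1)\<close>. The factor 2 gained in this way closes the odd step of
  \<open>theta_bound\<close>.\<close>

lemma binomial_odd_le: "(2 * m + 1) choose m \<le> 4 ^ m"
proof -
  have "(2 * m + 1) choose m = (2 * m + 1) choose (m + 1)"
    by (subst binomial_symmetric) auto
  then have "2 * ((2 * m + 1) choose m) = (\<Sum>i\<in>{m, m + 1}. (2 * m + 1) choose i)"
    by simp
  also have "\<dots> \<le> (\<Sum>i\<le>2 * m + 1. (2 * m + 1) choose i)"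
    by (rule sum_mono2) auto
  also have "\<dots> = 2 * 4 ^ m"
    by (simp only: choose_row_sum) (simp add: power_mult)
  finally show ?thesis
    by simp
qed

text \<open>For \<open>n = m + k\<close> with nearly equal parts, the primes up to \<open>k\<close>
  fall to the induction hypothesis, and those above \<open>k\<close> divide
  \<open>(m + k) choose m\<close>, which is at most \<open>4 ^ m\<close>.\<close>

lemma theta_bound: "(\<Sum>p | prime p \<and> p \<le> n. ln (real p)) \<le> real n * ln 4"
proof (induction n rule: less_induct)
  case (less n)
  consider "n \<le> 1" | "n = 2" | "n > 2"
    by linarith
  then show ?case
  proof cases
    case 1
    then have "{p::nat. prime p \<and> p \<le> n} = {}"
      by (auto simp: prime_nat_iff)
    then show ?thesis
      by (simp only: sum.empty) simp
  next
    case 2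
    then have "{p::nat. prime p \<and> p \<le> n} = {2}"
      using prime_ge_2_nat by (auto intro: antisym)
    then have "(\<Sum>p | prime p \<and> p \<le> n. ln (real p)) = ln 2"
      by (simp only: sum.insert sum.empty finite.emptyI empty_iff not_False_eq_True of_nat_numeral add_0_right)
    also have "ln (2::real) \<le> 2 * ln 4"
      using ln_mono[of 2 "4::real"] ln_ge_zero[of "4::real"] by linarith
    also have "2 * ln 4 = real n * ln 4"
      unfolding 2 by (simp only: of_nat_numeral)
    finally show ?thesis .
  next
    case 3
    have step: "(\<Sum>p | prime p \<and> p \<le> m + k. ln (real p)) \<le> real (m + k) * ln 4"
      if "k \<le> Suc m" "m \<le> k" "k < m + k" "n = m + k" "(m + k) choose m \<le> 4 ^ m" for m k
    proof -
      have "{p::nat. prime p \<and> p \<le> m + k} = {p. prime p \<and> p \<le> k} \<union> {p. prime p \<and> k < p \<and> p \<le> m + k}"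
        by auto
      then have "(\<Sum>p | prime p \<and> p \<le> m + k. ln (real p)) =
          (\<Sum>p | prime p \<and> p \<le> k. ln (real p)) + (\<Sum>p | prime p \<and> k < p \<and> p \<le> m + k. ln (real p))"
        by (simp only:) (rule sum.union_disjoint, auto)
      also have "(\<Sum>p | prime p \<and> p \<le> k. ln (real p)) \<le> real k * ln 4"
        using less that by simp
      also have "(\<Sum>p | prime p \<and> k < p \<and> p \<le> m + k. ln (real p)) \<le> ln (real ((m + k) choose m))"
        using that by (intro sum_ln_primes_binomial)
      also have "ln (real ((m + k) choose m)) \<le> ln (real (4 ^ m))"
        using that by (subst ln_le_cancel_iff) (auto simp del: of_nat_power)
      also have "\<dots> = real m * ln 4"
        by (simp add: ln_realpow)
      finally show ?thesis
        by (simp add: algebra_simps)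
    qed
    show ?thesis
    proof (cases "even n")
      case True
      then obtain m where m: "n = 2 * m" by blast
      then have nm: "n = m + m" "m < m + m"
        using 3 by auto
      have "(m + m) choose m \<le> 4 ^ m"
        using binomial_even_le[of m] by (simp only: mult_2)
      from step[OF le_SucI[OF order_refl] order_refl nm(2,1) this] show ?thesis
        unfolding nm(1) .
    next
      case False
      then obtain m where m: "n = 2 * m + 1" by (rule oddE)
      then have nm: "n = m + Suc m" "Suc m < m + Suc m"
        using 3 by auto
      have "(m + Suc m) choose m \<le> 4 ^ m"
        using binomial_odd_le[of m] by (simp only: mult_2 add_Suc_right One_nat_def add_0_right)
      from step[OF order_refl le_SucI[OF order_refl] nm(2,1) this] show ?thesis
        unfolding nm(1) .
    qed
  qed
qed

lemma theta_bound_real: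
  assumes "0 \<le> x"
  shows "(\<Sum>p\<in>primes_upto x. ln (real p)) \<le> x * ln 4"
proof -
  have "primes_upto x = {p. prime p \<and> p \<le> nat \<lfloor>x\<rfloor>}"
    using assms by (auto simp: le_nat_floor) linarith
  then have "(\<Sum>p\<in>primes_upto x. ln (real p)) \<le> real (nat \<lfloor>x\<rfloor>) * ln 4"
    using theta_bound by simp
  also have "\<dots> \<le> x * ln 4"
    using assms by (intro mult_right_mono) auto
  finally show ?thesis .
qed

lemma ln_le_2_sqrt:
  assumes "0 < x"
  shows "ln x \<le> 2 * sqrt x"
proof -
  have "ln (sqrt x) \<le> sqrt x"
    using assms by (simp add: ln_bound)
  then show ?thesis
    using assms by (simp add: ln_sqrt)
qed

text \<open>Above \<open>sqrt x\<close> each prime contributes at least \<open>ln x / 2\<close> to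
  the sum in \<open>theta_bound_real\<close>; up to \<open>sqrt x\<close> all integers are counted.
  The constant is \<open>5 = 2 + 3\<close>, with 2 from \<open>ln_le_2_sqrt\<close> and 3 bounding
  \<open>2 * ln 4\<close>.\<close>

lemma chebyshev_upper:
  assumes "1 < x"
  shows "real (card (primes_upto x)) \<le> 5 * (x / ln x)"
proof -
  let ?A = "primes_upto (sqrt x)" and ?B = "{p. prime p \<and> sqrt x < real p \<and> real p \<le> x}"
  have finB: "finite ?B"
    by (rule finite_subset[of _ "primes_upto x"]) auto
  have lx: "0 < ln x"
    using assms by simp
  have "primes_upto x \<subseteq> ?A \<union> ?B"
    by auto
  then have "card (primes_upto x) \<le> card (?A \<union> ?B)"
    using finB by (intro card_mono) auto
  also have "\<dots> \<le> card ?A + card ?B"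
    by (rule card_Un_le)
  finally have split: "real (card (primes_upto x)) \<le> real (card ?A) + real (card ?B)"
    by linarith
  have "card ?A \<le> card {1..nat \<lfloor>sqrt x\<rfloor>}"
    by (intro card_mono) (auto simp: le_nat_floor Suc_le_eq prime_gt_0_nat)
  then have "real (card ?A) \<le> real (nat \<lfloor>sqrt x\<rfloor>)"
    by simp
  also have "\<dots> \<le> sqrt x"
    using assms by auto
  also have "sqrt x \<le> 2 * (x / ln x)"
  proof -
    have "sqrt x * ln x \<le> sqrt x * (2 * sqrt x)"
      using assms by (intro mult_left_mono ln_le_2_sqrt) auto
    also have "\<dots> = 2 * x"
      using assms by simp
    finally show ?thesis
      using lx assms by (simp add: field_simps)
  qed
  finally have A: "real (card ?A) \<le> 2 * (x / ln x)" .
  have "real (card ?B) * (ln x / 2) = (\<Sum>p\<in>?B. ln x / 2)"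
    by simp
  also have "\<dots> \<le> (\<Sum>p\<in>?B. ln (real p))"
  proof (rule sum_mono)
    fix p assume "p \<in> ?B"
    then have "ln (sqrt x) \<le> ln (real p)"
      using assms by (subst ln_le_cancel_iff) (auto simp: prime_gt_0_nat)
    then show "ln x / 2 \<le> ln (real p)"
      using assms by (simp add: ln_sqrt)
  qed
  also have "\<dots> \<le> (\<Sum>p\<in>primes_upto x. ln (real p))"
    by (rule sum_mono2) (auto dest: prime_ge_Suc_0_nat)
  also have "\<dots> \<le> x * ln 4"
    using assms by (intro theta_bound_real) simp
  finally have "real (card ?B) \<le> 2 * ln 4 * (x / ln x)"
    using lx by (simp add: field_simps)
  moreover have "2 * ln 4 \<le> (3::real)"
  proof -
    have "ln (4::real) = 2 * ln 2"
      using ln_realpow[of 2 2] by simp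
    then show ?thesis
      using ln2_le_25_over_36 by simp
  qed
  then have "2 * ln 4 * (x / ln x) \<le> 3 * (x / ln x)"
    using lx assms by (intro mult_right_mono) auto
  ultimately show ?thesis
    using split A by linarith
qed

section \<open>Mertens' first theorem\<close>

lemma ln_fact_mangoldt:
  "ln (fact n) = (\<Sum>d = 1..n. mangoldt d * real (n div d))"
proof -
  have "ln (fact n :: real) = (\<Sum>m = 1..n. ln (real m))"
    by (induction n) (auto simp: ln_mult)
  also have "\<dots> = (\<Sum>m = 1..n. \<Sum>d | d dvd m. mangoldt d)"
  proof (rule sum.cong[OF refl])
    fix m assume "m \<in> {1..n}"
    then show "ln (real m) = (\<Sum>d | d dvd m. mangoldt d)"
      using mangoldt_sum[of m, where ?'a = real] by simp
  qed
  also have "\<dots> = (\<Sum>m = 1..n. \<Sum>d = 1..n. if d dvd m then mangoldt d else 0)"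
  proof (rule sum.cong[OF refl])
    fix m assume m: "m \<in> {1..n}"
    have "(\<Sum>d = 1..n. if d dvd m then mangoldt d else (0::real)) = (\<Sum>d | d \<in> {1..n} \<and> d dvd m. mangoldt d)"
      by (subst sum.inter_filter[symmetric]) auto
    also have "{d. d \<in> {1..n} \<and> d dvd m} = {d. d dvd m}"
      using m by (auto dest: dvd_imp_le intro: Nat.gr0I)
    finally show "(\<Sum>d | d dvd m. mangoldt d) = (\<Sum>d = 1..n. if d dvd m then mangoldt d else (0::real))"
      by simp
  qed
  also have "\<dots> = (\<Sum>d = 1..n. \<Sum>m = 1..n. if d dvd m then mangoldt d else 0)"
    by (rule sum.swap)
  also have "\<dots> = (\<Sum>d = 1..n. mangoldt d * real (n div d))"
  proof (rule sum.cong[OF refl])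
    fix d assume d: "d \<in> {1..n}"
    have "(\<Sum>m = 1..n. if d dvd m then mangoldt d else (0::real)) = (\<Sum>m | m \<in> {1..n} \<and> d dvd m. mangoldt d)"
      by (subst sum.inter_filter[symmetric]) auto
    also have "\<dots> = real (card {m. m \<in> {1..n} \<and> d dvd m}) * mangoldt d"
      by simp
    also have "{m. m \<in> {1..n} \<and> d dvd m} = (\<lambda>i. d * i) ` {1..n div d}"
    proof (intro equalityI subsetI)
      fix m assume "m \<in> {m. m \<in> {1..n} \<and> d dvd m}"
      then obtain i where "m = d * i" "1 \<le> m" "m \<le> n" by auto
      then show "m \<in> (\<lambda>i. d * i) ` {1..n div d}"
        using d by (auto intro!: imageI simp: less_eq_div_iff_mult_less_eq mult.commute Suc_le_eq)
    next
      fix m assume "m \<in> (\<lambda>i. d * i) ` {1..n div d}"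
      then show "m \<in> {m. m \<in> {1..n} \<and> d dvd m}"
        using d by (auto simp: less_eq_div_iff_mult_less_eq mult.commute Suc_le_eq)
    qed
    also have "card \<dots> = n div d"
      using d by (subst card_image) (auto simp: inj_on_def)
    finally show "(\<Sum>m = 1..n. if d dvd m then mangoldt d else (0::real)) = mangoldt d * real (n div d)"
      by simp
  qed
  finally show ?thesis .
qed

lemma ln_fact_ge: "real n * ln (real n) - real n \<le> ln (fact n)"
proof (induction n)
  case (Suc n)
  show ?case
  proof (cases "n = 0")
    case False
    have "real n * (ln (real (Suc n)) - ln (real n)) \<le> 1"
    proof -
      have "ln (real (Suc n)) - ln (real n) = ln (1 + 1 / real n)"
        using False by (subst ln_divide_pos[symmetric]) (auto simp: add_divide_distrib add.commute)
      also have "\<dots> \<le> 1 / real n"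
        by (rule ln_add_one_self_le_self) simp
      finally show ?thesis
        using False by (simp add: field_simps)
    qed
    moreover have "ln (fact (Suc n) :: real) = ln (real (Suc n)) + ln (fact n)"
      by (simp add: ln_mult del: of_nat_Suc)
    ultimately show ?thesis
      using Suc by (simp add: algebra_simps)
  qed simp
qed simp

text \<open>In \<open>ln_fact_mangoldt\<close> only the prime \<open>d\<close> are kept. Replacing
  \<open>n div p\<close> by \<open>n / p\<close> costs at most the sum of \<open>ln p\<close>, which
  \<open>theta_bound\<close> controls; this is the term \<open>ln 4\<close>.\<close>

lemma mertens_upper:
  assumes "0 < n"
  shows "(\<Sum>p | prime p \<and> p \<le> n. ln (real p) / real p) \<le> ln (real n) + ln 4"
proof -
  let ?P = "{p. prime p \<and> p \<le> n}"
  have "real n * (\<Sum>p\<in>?P. ln (real p) / real p) = (\<Sum>p\<in>?P. ln (real p) * (real n / real p))"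
    by (simp add: sum_distrib_left mult.commute)
  also have "\<dots> \<le> (\<Sum>p\<in>?P. ln (real p) * (real (n div p) + 1))"
  proof (intro sum_mono mult_left_mono)
    fix p assume p: "p \<in> ?P"
    then show "0 \<le> ln (real p)"
      using prime_gt_0_nat[of p] by (simp add: Suc_le_eq)
    show "real n / real p \<le> real (n div p) + 1"
      by (metis add.commute floor_divide_of_nat_eq linear of_int_of_nat_eq real_of_int_floor_add_one_ge)
  qed
  also have "\<dots> = (\<Sum>p\<in>?P. mangoldt p * real (n div p)) + (\<Sum>p\<in>?P. ln (real p))"
    by (simp add: algebra_simps sum.distrib mangoldt_def)
  also have "(\<Sum>p\<in>?P. mangoldt p * real (n div p)) \<le> (\<Sum>d = 1..n. mangoldt d * real (n div d))"
    by (rule sum_mono2) (auto simp: prime_ge_Suc_0_nat mangoldt_def aprimedivisor_gt_0_nat primepow_gt_Suc_0 Suc_leI)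
  also have "\<dots> = ln (fact n)"
    by (simp add: ln_fact_mangoldt)
  also have "ln (fact n :: real) \<le> ln (real n ^ n)"
  proof (subst ln_le_cancel_iff)
    have "(fact n :: real) \<le> of_nat (n ^ n)"
      by (rule fact_le_power)
    then show "(fact n :: real) \<le> real n ^ n"
      by (simp only: of_nat_power)
  qed (use assms in auto)
  also have "\<dots> = real n * ln (real n)"
    using assms by (simp add: ln_realpow)
  also have "(\<Sum>p\<in>?P. ln (real p)) \<le> real n * ln 4"
    by (rule theta_bound)
  finally have "real n * (\<Sum>p\<in>?P. ln (real p) / real p) \<le> real n * (ln (real n) + ln 4)"
    by (simp add: distrib_left)
  then show ?thesis
    using assms by simp
qed


lemma sum_proper_prime_powers_le:
  "(\<Sum>d | d \<in> {1..n} \<and> \<not> prime d. mangoldt d / real d) \<le> (\<Sum>p | prime p \<and> p \<le> n. ln (real p) / (real p * (real p - 1)))"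
proof -
  let ?P = "{p. prime p \<and> p \<le> n}" and ?f = "\<lambda>(p::nat, i::nat). p ^ i"
  have "(\<Sum>d | d \<in> {1..n} \<and> \<not> prime d. mangoldt d / real d) =
      (\<Sum>d | d \<in> {1..n} \<and> \<not> prime d \<and> primepow d. mangoldt d / real d)"
    by (rule sum.mono_neutral_right) (auto simp: mangoldt_def)
  also have "\<dots> \<le> (\<Sum>d\<in>?f ` (?P \<times> {2..n}). mangoldt d / real d)"
  proof (rule sum_mono2)
    show "finite (?f ` (?P \<times> {2..n}))"
      by simp
    show "{d. d \<in> {1..n} \<and> \<not> prime d \<and> primepow d} \<subseteq> ?f ` (?P \<times> {2..n})"
    proof
      fix d assume d: "d \<in> {d. d \<in> {1..n} \<and> \<not> prime d \<and> primepow d}"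
      then obtain p i where pi: "prime p" "i > 0" "d = p ^ i"
        using primepow_def[of d] by auto
      have "i \<noteq> 1"
        using d pi by auto
      moreover have "p \<le> n" "i \<le> n"
      proof -
        have "p ^ 1 \<le> p ^ i"
          using pi by (intro power_increasing) (auto simp: prime_ge_Suc_0_nat)
        then show "p \<le> n"
          using d pi by auto
        have "i < 2 ^ i"
          by (rule less_exp)
        also have "2 ^ i \<le> p ^ i"
          using pi by (intro power_mono) (auto simp: prime_ge_2_nat)
        finally show "i \<le> n"
          using d pi by auto
      qed
      ultimately show "d \<in> ?f ` (?P \<times> {2..n})"
        using pi by (intro image_eqI[of _ _ "(p, i)"]) auto
    qed
    show "0 \<le> mangoldt d / real d" for d
      by (auto simp: mangoldt_def aprimedivisor_gt_0_nat primepow_gt_Suc_0 Suc_leI)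
  qed
  also have "\<dots> \<le> (\<Sum>x\<in>?P \<times> {2..n}. ((\<lambda>d. mangoldt d / real d) \<circ> ?f) x)"
    by (rule sum_image_le) (auto simp: mangoldt_def aprimedivisor_gt_0_nat primepow_gt_Suc_0 Suc_leI)
  also have "\<dots> = (\<Sum>p\<in>?P. \<Sum>i = 2..n. ln (real p) / real p ^ i)"
    by (subst sum.cartesian_product) (auto intro!: sum.cong simp: mangoldt_def aprimedivisor_prime_power)
  also have "\<dots> \<le> (\<Sum>p\<in>?P. ln (real p) / (real p * (real p - 1)))"
  proof (rule sum_mono)
    fix p assume "p \<in> ?P"
    then have p: "2 \<le> real p" "0 \<le> ln (real p)"
      using prime_ge_2_nat[of p] by auto
    \<comment> \<open>The geometric series from \<open>i = 1\<close>, minus its first term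
      \<open>1 / p\<close>; for \<open>m = 0\<close> that term is not present, hence the case
      distinction.\<close>
    have geo: "(\<Sum>i = 2..m. 1 / real p ^ i) \<le> (1 - 1 / real p ^ m) / (real p - 1) - (if m = 0 then 0 else 1 / real p)" for m
    proof (induction m)
      case (Suc m)
      show ?case
      proof (cases "m = 0")
        case True
        then show ?thesis using p by (simp add: field_simps)
      next
        case False
        have "(\<Sum>i = 2..Suc m. 1 / real p ^ i) = (\<Sum>i = 2..m. 1 / real p ^ i) + 1 / real p ^ Suc m"
          using False by simp
        also have "\<dots> \<le> (1 - 1 / real p ^ m) / (real p - 1) - 1 / real p + 1 / real p ^ Suc m"
          using Suc False by simp
        also have "\<dots> = (1 - 1 / real p ^ Suc m) / (real p - 1) - 1 / real p"
          using p by (simp add: field_simps)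
        finally show ?thesis by simp
      qed
    qed simp
    have "(\<Sum>i = 2..n. 1 / real p ^ i) \<le> 1 / (real p * (real p - 1))"
    proof (cases "n = 0")
      case False
      have "(\<Sum>i = 2..n. 1 / real p ^ i) \<le> (1 - 1 / real p ^ n) / (real p - 1) - 1 / real p"
        using geo[of n] False by simp
      also have "\<dots> \<le> 1 / (real p - 1) - 1 / real p"
        using p by (intro diff_right_mono divide_right_mono) auto
      also have "\<dots> = 1 / (real p * (real p - 1))"
        using p by (simp add: field_simps)
      finally show ?thesis .
    qed (use p in simp)
    then have "ln (real p) * (\<Sum>i = 2..n. 1 / real p ^ i) \<le> ln (real p) * (1 / (real p * (real p - 1)))"
      using p by (intro mult_left_mono)
    then show "(\<Sum>i = 2..n. ln (real p) / real p ^ i) \<le> ln (real p) / (real p * (real p - 1))"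
      by (simp add: sum_distrib_left)
  qed
  finally show ?thesis .
qed

text \<open>Now \<open>n div d\<close> is bounded above by \<open>n / d\<close> in
  \<open>ln_fact_mangoldt\<close>, and the proper prime powers contribute only a bounded
  amount.\<close>

lemma mertens_lower:
  "\<exists>C. \<forall>n>0. ln (real n) - C \<le> (\<Sum>p | prime p \<and> p \<le> n. ln (real p) / real p)"
proof -
  \<comment> \<open>A summable majorant of \<open>ln p / (p * (p - 1))\<close>, from
    \<open>ln p \<le> 2 * sqrt p\<close> and \<open>p - 1 \<ge> p / 2\<close>.\<close>
  define g where "g = (\<lambda>m::nat. 4 * real m powr (-(3/2)))"
  have summ: "summable g"
    unfolding g_def by (intro summable_mult) (simp add: summable_real_powr_iff)
  have "ln (real n) - (1 + suminf g) \<le> (\<Sum>p | prime p \<and> p \<le> n. ln (real p) / real p)" if n: "0 < n" for n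
  proof -
    let ?P = "{p. prime p \<and> p \<le> n}"
    have "(\<Sum>p\<in>?P. ln (real p) / (real p * (real p - 1))) \<le> (\<Sum>p\<in>?P. g p)"
    proof (rule sum_mono)
      fix p assume "p \<in> ?P"
      then have p: "2 \<le> real p"
        using prime_ge_2_nat[of p] by auto
      have "ln (real p) / (real p * (real p - 1)) \<le> (2 * sqrt (real p)) / (real p * (real p / 2))"
        using p by (intro frac_le mult_left_mono ln_le_2_sqrt) auto
      also have "\<dots> = 4 * (real p powr (1/2) / real p powr 2)"
        using p by (simp add: powr_half_sqrt power2_eq_square)
      also have "\<dots> = g p"
        unfolding g_def powr_diff[symmetric] by simp
      finally show "ln (real p) / (real p * (real p - 1)) \<le> g p" .
    qed
    also have "\<dots> \<le> suminf g"
      using summ by (rule sum_le_suminf) (auto simp: g_def)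
    finally have pp: "(\<Sum>p\<in>?P. ln (real p) / (real p * (real p - 1))) \<le> suminf g" .
    have "real n * ln (real n) - real n \<le> (\<Sum>d = 1..n. mangoldt d * real (n div d))"
      using ln_fact_ge[of n] ln_fact_mangoldt[of n] by simp
    also have "\<dots> \<le> (\<Sum>d = 1..n. mangoldt d * (real n / real d))"
      by (intro sum_mono mult_left_mono mangoldt_nonneg)
        (metis floor_divide_of_nat_eq of_int_floor_le of_int_of_nat_eq)
    also have "\<dots> = real n * (\<Sum>d = 1..n. mangoldt d / real d)"
      by (simp add: sum_distrib_left mult_ac)
    also have "(\<Sum>d = 1..n. mangoldt d / real d) =
        (\<Sum>d\<in>?P \<union> {d. d \<in> {1..n} \<and> \<not> prime d}. mangoldt d / real d)"
      by (rule sum.cong) (auto simp: prime_ge_Suc_0_nat Suc_le_eq prime_gt_0_nat)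
    also have "\<dots> = (\<Sum>d\<in>?P. mangoldt d / real d) + (\<Sum>d | d \<in> {1..n} \<and> \<not> prime d. mangoldt d / real d)"
      by (rule sum.union_disjoint) auto
    also have "(\<Sum>d\<in>?P. mangoldt d / real d) = (\<Sum>p\<in>?P. ln (real p) / real p)"
      by (rule sum.cong) (auto simp: mangoldt_def)
    also have "real n * ((\<Sum>p\<in>?P. ln (real p) / real p) + (\<Sum>d | d \<in> {1..n} \<and> \<not> prime d. mangoldt d / real d))
        \<le> real n * ((\<Sum>p\<in>?P. ln (real p) / real p) + suminf g)"
      using sum_proper_prime_powers_le[of n] pp by (intro mult_left_mono add_left_mono) auto
    finally have "real n * (ln (real n) - 1) \<le> real n * ((\<Sum>p\<in>?P. ln (real p) / real p) + suminf g)"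
      by (simp add: algebra_simps)
    then show ?thesis
      using n by simp
  qed
  then show ?thesis
    by blast
qed

lemma mertens_first:
  obtains C where "C \<ge> 1"
    "\<And>n. 0 < n \<Longrightarrow> \<bar>(\<Sum>p | prime p \<and> p \<le> n. ln (real p) / real p) - ln (real n)\<bar> \<le> C"
proof -
  obtain C where C: "\<And>n. 0 < n \<Longrightarrow> ln (real n) - C \<le> (\<Sum>p | prime p \<and> p \<le> n. ln (real p) / real p)"
    using mertens_lower by blast
  show thesis
  proof (rule that[of "max 1 (max C (ln 4))"])
    fix n :: nat assume "0 < n"
    with C[of n] mertens_upper[of n]
    show "\<bar>(\<Sum>p | prime p \<and> p \<le> n. ln (real p) / real p) - ln (real n)\<bar> \<le> max 1 (max C (ln 4))"
      by linarith
  qed simp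
qed


section \<open>Sums of reciprocals of primes over long and short intervals\<close>

lemma sum_inverse_primes_nat:
  obtains C where "C \<ge> 1"
    "\<And>a b. 2 \<le> a \<Longrightarrow> a \<le> b \<Longrightarrow>
      ln (ln (real b + 1)) - ln (ln (real a + 1)) - C \<le> (\<Sum>p | prime p \<and> a < p \<and> p \<le> b. 1 / real p)"
proof -
  define B where "B = (\<lambda>n. \<Sum>p | prime p \<and> p \<le> n. ln (real p) / real p)"
  define E where "E = (\<lambda>n. B n - ln (real n))"
  define g where "g = (\<lambda>n::nat. 1 / ln (real n))"
  obtain C where C: "C \<ge> 1" "\<And>n. 0 < n \<Longrightarrow> \<bar>E n\<bar> \<le> C"
    unfolding E_def B_def using mertens_first by blast
  have BSuc: "B (Suc n) - B n = (if prime (Suc n) then ln (real (Suc n)) / real (Suc n) else 0)" for n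
  proof -
    have "{p. prime p \<and> p \<le> Suc n} = (if prime (Suc n) then insert (Suc n) {p. prime p \<and> p \<le> n} else {p. prime p \<and> p \<le> n})"
      by (auto simp: le_Suc_eq)
    then show ?thesis
      by (simp add: B_def)
  qed
  \<comment> \<open>The shift by one in the arguments makes this a clean inequality: by concavity of
    \<open>ln\<close>, used twice, the increment of \<open>ln (ln (n + 1))\<close> is at most
    \<open>(ln (n + 1) - ln n) / ln (n + 1)\<close>, which is the smooth part of the prime
    sum.\<close>
  have incr: "ln (ln (real n + 2)) - ln (ln (real n + 1)) + (E (Suc n) - E n) * g (Suc n)
      \<le> (if prime (Suc n) then 1 / real (Suc n) else 0)" if "2 \<le> n" for n
  proof -
    define u where "u = ln (real n + 1)"
    define v where "v = ln (real n + 2)"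
    define t where "t = ln (real n)"
    have u: "0 < u" "u < v"
      using that by (auto simp: u_def v_def)
    have "v - u = ln (1 + 1 / (real n + 1))" "u - t = ln (1 + 1 / real n)"
      using that unfolding u_def v_def t_def
      by (subst ln_divide_pos[symmetric]; auto simp: field_simps)+
    then have gap: "v - u \<le> u - t"
      using that by (simp add: field_simps)
    have "ln v - ln u = ln (1 + (v - u) / u)"
      using u by (subst ln_divide_pos[symmetric]) (auto simp: field_simps)
    also have "\<dots> \<le> (v - u) / u"
      using u by (intro ln_add_one_self_le_self) simp
    also have "\<dots> \<le> (u - t) / u"
      using u gap by (intro divide_right_mono) auto
    finally have "ln v - ln u \<le> (u - t) * g (Suc n)"
      by (simp add: g_def u_def add.commute)
    moreover have "E (Suc n) - E n = (if prime (Suc n) then ln (real (Suc n)) / real (Suc n) else 0) - (u - t)"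
      using BSuc[of n] by (simp add: E_def u_def t_def add.commute)
    moreover have "ln (real (Suc n)) * g (Suc n) = 1"
      using u by (simp add: g_def u_def add.commute)
    ultimately have "(E (Suc n) - E n) * g (Suc n) =
        (if prime (Suc n) then 1 / real (Suc n) else 0) - (u - t) * g (Suc n)"
      by (simp add: left_diff_distrib)
    with \<open>ln v - ln u \<le> (u - t) * g (Suc n)\<close> show ?thesis
      by (simp add: u_def v_def)
  qed
  have gpos: "0 < g n" if "2 \<le> n" for n
    using that by (simp add: g_def)
  have gdec: "g (Suc n) \<le> g n" if "2 \<le> n" for n
    using that by (auto simp: g_def intro!: divide_left_mono)
  \<comment> \<open>Abel summation: the error term \<open>E\<close> is bounded and \<open>g\<close> is decreasing.\<close>
  have main: "ln (ln (real b + 1)) - ln (ln (real a + 1)) + E b * g b - 2 * C * g (Suc a) + C * g b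
      \<le> (\<Sum>p | prime p \<and> a < p \<and> p \<le> b. 1 / real p)" if "2 \<le> a" "Suc a \<le> b" for a b
    using that(2)
  proof (induction b rule: dec_induct)
    case base
    have "{p. prime p \<and> a < p \<and> p \<le> Suc a} = (if prime (Suc a) then {Suc a} else {})"
      by (auto simp: le_Suc_eq)
    then have "(\<Sum>p | prime p \<and> a < p \<and> p \<le> Suc a. 1 / real p) = (if prime (Suc a) then 1 / real (Suc a) else 0)"
      by simp
    moreover have "- C * g (Suc a) \<le> - E a * g (Suc a)"
      using C(2)[of a] gpos[of "Suc a"] that(1) by (intro mult_right_mono) auto
    ultimately show ?case
      using incr[OF that(1)] by (simp add: algebra_simps)
  next
    case (step b)
    have "{p. prime p \<and> a < p \<and> p \<le> Suc b} =
        (if prime (Suc b) then insert (Suc b) {p. prime p \<and> a < p \<and> p \<le> b} else {p. prime p \<and> a < p \<and> p \<le> b})"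
      using step by (auto simp: le_Suc_eq)
    then have eq: "(\<Sum>p | prime p \<and> a < p \<and> p \<le> Suc b. 1 / real p) =
        (\<Sum>p | prime p \<and> a < p \<and> p \<le> b. 1 / real p) + (if prime (Suc b) then 1 / real (Suc b) else 0)"
      by simp
    have b: "2 \<le> b"
      using step that by simp
    have "- C * (g b - g (Suc b)) \<le> E b * (g b - g (Suc b))"
      using C(2)[of b] gdec[OF b] b by (intro mult_right_mono) auto
    then show ?case
      using incr[OF b] step.IH eq by (simp add: algebra_simps)
  qed
  show thesis
  proof (rule that[of "2 * C"])
    fix a b :: nat assume ab: "2 \<le> a" "a \<le> b"
    show "ln (ln (real b + 1)) - ln (ln (real a + 1)) - 2 * C \<le> (\<Sum>p | prime p \<and> a < p \<and> p \<le> b. 1 / real p)"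
    proof (cases "a = b")
      case True
      then have empty: "{p. prime p \<and> a < p \<and> p \<le> b} = {}"
        by auto
      show ?thesis
        unfolding empty using C(1) True by simp
    next
      case False
      then have "Suc a \<le> b"
        using ab by simp
      have "- C * g b \<le> E b * g b"
        using C(2)[of b] gpos[of b] ab by (intro mult_right_mono) auto
      moreover have "exp 1 \<le> real (Suc a)"
        using exp_le ab by linarith
      then have "1 \<le> ln (real (Suc a))"
        by (subst ln_ge_iff) auto
      then have "1 / ln (real (Suc a)) \<le> 1 / 1"
        by (intro divide_left_mono) linarith+
      then have "g (Suc a) \<le> 1"
        by (simp add: g_def)
      then have "C * g (Suc a) \<le> C * 1"
        using C(1) by (intro mult_left_mono) linarith+
      ultimately show ?thesis
        using main[OF ab(1) \<open>Suc a \<le> b\<close>] by linarith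
    qed
  qed (use C in auto)
qed

text \<open>Rounding \<open>x\<close> to an integer and adding 1 changes its logarithm by at most a
  factor \<open>exp 1\<close>, so the constant grows by 1.\<close>

lemma sum_inverse_primes_lower:
  obtains C where "C \<ge> 1"
    "\<And>x y. exp 1 \<le> x \<Longrightarrow> x \<le> y \<Longrightarrow>
      ln (ln y / ln x) - C \<le> (\<Sum>p | prime p \<and> x < real p \<and> real p \<le> y. 1 / real p)"
proof -
  obtain C where C: "C \<ge> 1"
    "\<And>a b. 2 \<le> a \<Longrightarrow> a \<le> b \<Longrightarrow>
      ln (ln (real b + 1)) - ln (ln (real a + 1)) - C \<le> (\<Sum>p | prime p \<and> a < p \<and> p \<le> b. 1 / real p)"
    using sum_inverse_primes_nat by blast
  show thesis
  proof (rule that[of "C + 1"])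
    fix x y :: real assume xy: "exp 1 \<le> x" "x \<le> y"
    define a b where "a = nat \<lfloor>x\<rfloor>" and "b = nat \<lfloor>y\<rfloor>"
    have x2: "2 \<le> x"
      using xy exp_ge_add_one_self[of 1] by linarith
    have ab: "2 \<le> a" "a \<le> b"
      using x2 xy by (auto simp: a_def b_def le_nat_floor nat_mono floor_mono)
    have lx: "1 \<le> ln x"
      using xy x2 by (subst ln_ge_iff) auto
    have "real a \<le> x" "y \<le> real b + 1"
      using x2 xy by (auto simp: a_def b_def)
    have "{p. prime p \<and> a < p \<and> p \<le> b} = {p. prime p \<and> x < real p \<and> real p \<le> y}"
      using x2 xy by (auto simp: a_def b_def le_nat_floor nat_less_iff floor_less_iff le_floor_iff nat_le_iff) linarith+
    moreover have "ln (ln y) \<le> ln (ln (real b + 1))"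
      using \<open>y \<le> real b + 1\<close> x2 xy lx by (subst ln_le_cancel_iff; (subst ln_le_cancel_iff)?) auto
    moreover have "ln (ln (real a + 1)) \<le> ln (ln x) + 1"
    proof -
      have "ln (real a + 1) \<le> ln (exp 1 * x)"
      proof (subst ln_le_cancel_iff)
        have "real a + 1 \<le> 2 * x"
          using \<open>real a \<le> x\<close> x2 by linarith
        also have "\<dots> \<le> exp 1 * x"
          using x2 exp_ge_add_one_self[of 1] by (intro mult_right_mono) auto
        finally show "real a + 1 \<le> exp 1 * x" .
      qed (use x2 in auto)
      also have "\<dots> = 1 + ln x"
        using x2 by (simp add: ln_mult)
      also have "\<dots> \<le> exp 1 * ln x"
      proof -
        have "2 * ln x \<le> exp 1 * ln x"
          using lx exp_ge_add_one_self[of 1] by (intro mult_right_mono) auto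
        then show ?thesis using lx by linarith
      qed
      finally have "ln (ln (real a + 1)) \<le> ln (exp 1 * ln x)"
        using ab lx by (subst ln_le_cancel_iff) auto
      then show ?thesis
        using lx by (simp add: ln_mult)
    qed
    moreover have "ln (ln y / ln x) = ln (ln y) - ln (ln x)"
      using lx xy x2 by (intro ln_divide_pos) auto
    ultimately show "ln (ln y / ln x) - (C + 1) \<le> (\<Sum>p | prime p \<and> x < real p \<and> real p \<le> y. 1 / real p)"
      using C(2)[OF ab] by simp
  qed (use C in auto)
qed

text \<open>Mertens' first theorem at both ends of a sufficiently long interval leaves a sum of
  \<open>ln p / p\<close> that is at least 1, and each of its terms is at most
  \<open>C * ln x / x\<close>.\<close>

lemma primes_in_interval_lower:
  obtains C where "C > 1"
    "\<And>x. C \<le> x \<Longrightarrow> x / (C * ln x) \<le> real (card {p. prime p \<and> x / C < real p \<and> real p \<le> x})"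
proof -
  obtain D where D: "D \<ge> 1"
    "\<And>n. 0 < n \<Longrightarrow> \<bar>(\<Sum>p | prime p \<and> p \<le> n. ln (real p) / real p) - ln (real n)\<bar> \<le> D"
    using mertens_first by blast
  \<comment> \<open>Of the exponent, \<open>2 * D\<close> pays for the errors of Mertens' theorem at
    the two ends and 1 for rounding \<open>x\<close> down; the last 1 is the surplus that is
    kept.\<close>
  define C where "C = exp (2 * D + 2)"
  have C1: "C > 1"
    using D(1) by (simp add: C_def)
  show thesis
  proof (rule that[OF C1])
    fix x assume x: "C \<le> x"
    define a b where "a = nat \<lfloor>x / C\<rfloor>" and "b = nat \<lfloor>x\<rfloor>"
    let ?P = "{p. prime p \<and> x / C < real p \<and> real p \<le> x}"
    have xC: "1 \<le> x / C"
      using x C1 by (simp add: field_simps)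
    have "x / C \<le> x"
      using x C1 by (simp add: field_simps)
    then have ab: "1 \<le> a" "a \<le> b"
      using xC by (auto simp: a_def b_def le_nat_floor nat_mono floor_mono)
    have lx: "0 < ln x"
      using x C1 by simp
    have fin: "finite ?P"
      by (rule finite_subset[of _ "primes_upto x"]) auto
    have "{p. prime p \<and> p \<le> b} = {p. prime p \<and> p \<le> a} \<union> ?P"
      using xC \<open>x / C \<le> x\<close> by (auto simp: a_def b_def le_nat_floor nat_less_iff floor_less_iff le_floor_iff nat_le_iff) linarith+
    moreover have "{p. prime p \<and> p \<le> a} \<inter> ?P = {}"
      using xC by (auto simp: a_def le_nat_floor nat_le_iff) linarith
    ultimately have "(\<Sum>p | prime p \<and> p \<le> b. ln (real p) / real p) =
        (\<Sum>p | prime p \<and> p \<le> a. ln (real p) / real p) + (\<Sum>p\<in>?P. ln (real p) / real p)"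
      using fin by (simp only:) (rule sum.union_disjoint, auto)
    then have *: "ln (real b) - ln (real a) - 2 * D \<le> (\<Sum>p\<in>?P. ln (real p) / real p)"
      using D(2)[of a] D(2)[of b] ab by linarith
    have "ln (real a) \<le> ln (x / C)"
      using ab xC by (subst ln_le_cancel_iff) (auto simp: a_def)
    also have "\<dots> = ln x - (2 * D + 2)"
      using x C1 by (subst ln_divide_pos) (auto simp: C_def intro: less_le_trans[OF exp_gt_zero])
    finally have la: "ln (real a) \<le> ln x - (2 * D + 2)" .
    have "x \<le> 2 * real b"
      using ab by (simp add: b_def) linarith
    then have "ln x \<le> ln (2 * real b)"
      using x C1 ab by (subst ln_le_cancel_iff) auto
    also have "\<dots> \<le> 1 + ln (real b)"
      using ab ln_2_less_1 by (subst ln_mult) auto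
    finally have "1 \<le> (\<Sum>p\<in>?P. ln (real p) / real p)"
      using * la by linarith
    also have "\<dots> \<le> (\<Sum>p\<in>?P. ln x / (x / C))"
    proof (rule sum_mono)
      fix p assume p: "p \<in> ?P"
      then have "0 < real p"
        by (simp add: prime_gt_0_nat)
      then show "ln (real p) / real p \<le> ln x / (x / C)"
        using p xC lx by (intro frac_le) auto
    qed
    also have "\<dots> = real (card ?P) * (ln x / (x / C))"
      by simp
    finally show "x / (C * ln x) \<le> real (card ?P)"
      using x C1 lx by (simp add: field_simps)
  qed
qed

text \<open>With \<open>z\<close> the larger of \<open>t\<close> and \<open>Y / C\<close>, all the
  primes lie between \<open>z\<close> and \<open>C\<^sup>2 * z\<close>; Chebyshev's bound counts
  them and each contributes at most \<open>1 / z\<close>. The logarithm is at least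
  \<open>ln t\<close> wherever \<open>Y\<close> lies.\<close>

lemma sum_inverse_primes_short:
  assumes "1 < t" "1 < C" "0 < Y"
  shows "(\<Sum>p | prime p \<and> t < real p \<and> Y / C < real p \<and> real p < C * Y. 1 / real p) \<le> 5 * C\<^sup>2 / ln t"
proof -
  define z where "z = max t (Y / C)"
  let ?P = "{p. prime p \<and> t < real p \<and> Y / C < real p \<and> real p < C * Y}"
  have z: "1 < z" "t \<le> z" "Y / C \<le> z"
    using assms by (auto simp: z_def)
  have C2: "1 \<le> C\<^sup>2"
    using assms by simp
  have CY: "C * Y \<le> C\<^sup>2 * z"
    using z(3) assms by (simp add: field_simps power2_eq_square)
  have sub: "?P \<subseteq> primes_upto (C\<^sup>2 * z)"
    using CY by auto
  have zC: "z \<le> C\<^sup>2 * z"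
    using C2 z by simp
  then have z1: "1 < C\<^sup>2 * z"
    using z by linarith
  have "(\<Sum>p\<in>?P. 1 / real p) \<le> (\<Sum>p\<in>?P. 1 / z)"
    using z by (intro sum_mono divide_left_mono) (auto simp: z_def)
  also have "\<dots> = real (card ?P) / z"
    by simp
  also have "\<dots> \<le> real (card (primes_upto (C\<^sup>2 * z))) / z"
    using z sub by (intro divide_right_mono) (auto intro!: card_mono)
  also have "\<dots> \<le> (5 * (C\<^sup>2 * z / ln (C\<^sup>2 * z))) / z"
    using z z1 by (intro divide_right_mono chebyshev_upper) auto
  also have "\<dots> = 5 * C\<^sup>2 / ln (C\<^sup>2 * z)"
    using z by simp
  also have "\<dots> \<le> 5 * C\<^sup>2 / ln t"
  proof (intro divide_left_mono mult_pos_pos)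
    show "ln t \<le> ln (C\<^sup>2 * z)"
      using z z1 zC assms by (subst ln_le_cancel_iff) linarith+
    show "0 < ln t"
      by (rule ln_gt_zero[OF assms(1)])
    show "0 < ln (C\<^sup>2 * z)"
      by (rule ln_gt_zero[OF z1])
  qed simp
  finally show ?thesis .
qed

section \<open>Products of tuples of primes\<close>

text \<open>Such a permutation maps every fibre of \<open>l\<close> to itself and is determined by
  its restrictions to the fibres. In \<Phi> these are extended by the identity, so that they are
  permutations in the sense of \<open>permutes\<close>.\<close>

lemma card_label_preserving_permutations:
  assumes "finite D" "finite L" "l ` D \<subseteq> L"
  shows "card {\<sigma>. \<sigma> permutes D \<and> (\<forall>x\<in>D. l (\<sigma> x) = l x)} \<le> (\<Prod>c\<in>L. fact (card {x \<in> D. l x = c}))"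
proof -
  let ?A = "{\<sigma>. \<sigma> permutes D \<and> (\<forall>x\<in>D. l (\<sigma> x) = l x)}"
  let ?F = "\<lambda>c. {x \<in> D. l x = c}"
  let ?B = "Pi\<^sub>E L (\<lambda>c. {\<tau>. \<tau> permutes ?F c})"
  define \<Phi> where "\<Phi> = (\<lambda>\<sigma>. \<lambda>c\<in>L. \<lambda>x. if x \<in> ?F c then \<sigma> x else x)"
  have "inj_on \<Phi> ?A"
  proof (rule inj_onI)
    fix \<sigma> \<tau> assume st: "\<sigma> \<in> ?A" "\<tau> \<in> ?A" "\<Phi> \<sigma> = \<Phi> \<tau>"
    show "\<sigma> = \<tau>"
    proof
      fix x
      show "\<sigma> x = \<tau> x"
      proof (cases "x \<in> D")
        case True
        then have "l x \<in> L"
          using assms by auto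
        moreover have "\<Phi> \<sigma> (l x) x = \<Phi> \<tau> (l x) x"
          using st by simp
        ultimately show ?thesis
          using True by (simp add: \<Phi>_def)
      next
        case False
        then show ?thesis
          using st by (auto simp: permutes_not_in)
      qed
    qed
  qed
  moreover have "\<Phi> ` ?A \<subseteq> ?B"
  proof (intro image_subsetI PiE_I)
    fix \<sigma> c assume s: "\<sigma> \<in> ?A" and c: "c \<in> L"
    let ?\<tau> = "\<lambda>x. if x \<in> ?F c then \<sigma> x else x"
    have "bij_betw ?\<tau> (?F c) (?F c)"
    proof (rule endo_inj_surj[THEN bij_betw_imageI[rotated]])
      show "finite (?F c)"
        using assms by simp
      show "?\<tau> ` ?F c \<subseteq> ?F c"
        using s by (auto simp: permutes_in_image)
      show "inj_on ?\<tau> (?F c)" "inj_on ?\<tau> (?F c)"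
        using s by (auto intro!: inj_onI dest: permutes_inj[THEN injD])
    qed
    then have "?\<tau> permutes ?F c"
      by (rule bij_imp_permutes) auto
    then show "\<Phi> \<sigma> c \<in> {\<tau>. \<tau> permutes ?F c}"
      using c by (simp add: \<Phi>_def)
  qed (auto simp: \<Phi>_def)
  moreover have "finite ?B"
    using assms by (intro finite_PiE) (auto intro: finite_permutations)
  ultimately have "card ?A \<le> card ?B"
    by (rule card_inj_on_le)
  also have "\<dots> = (\<Prod>c\<in>L. card {\<tau>. \<tau> permutes ?F c})"
    using assms by (simp add: card_PiE)
  also have "\<dots> = (\<Prod>c\<in>L. fact (card (?F c)))"
    using assms by (intro prod.cong) (auto intro!: card_permutations)
  finally show ?thesis .
qed

text \<open>The index \<open>e\<close> enters only one of the two products. Once the other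
  coordinates are fixed, with \<open>Y\<close> the quotient of what remains, closeness confines
  \<open>P e\<close> to the interval from \<open>Y / C\<close> to \<open>C * Y\<close>; summing over
  the other coordinates gives a full product.\<close>

lemma sum_PiE_pinned:
  fixes A :: "'i \<Rightarrow> nat set" and C B :: real
  assumes "finite D" "\<And>x. x \<in> D \<Longrightarrow> finite (A x)" "\<And>x p. x \<in> D \<Longrightarrow> p \<in> A x \<Longrightarrow> 0 < p"
    and UV: "U \<subseteq> D" "V \<subseteq> D" "e \<in> U" "e \<notin> V" and C: "1 < C"
    and B: "\<And>Y. 0 < Y \<Longrightarrow> (\<Sum>p | p \<in> A e \<and> Y / C < real p \<and> real p < C * Y. 1 / real p) \<le> B"
  shows "(\<Sum>P \<in> {P \<in> Pi\<^sub>E D A. real (prod P U) < C * real (prod P V) \<and> real (prod P V) < C * real (prod P U)}.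
      \<Prod>x\<in>D. 1 / real (P x)) \<le> B * (\<Prod>x\<in>D - {e}. \<Sum>p\<in>A x. 1 / real p)"
proof -
  let ?c = "\<lambda>P. real (prod P U) < C * real (prod P V) \<and> real (prod P V) < C * real (prod P U)"
  define D' where "D' = D - {e}"
  have D: "D = insert e D'" "e \<notin> D'" "finite D'"
    using UV assms by (auto simp: D'_def)
  have finG: "finite (Pi\<^sub>E D' A)"
    using D assms by (intro finite_PiE) auto
  have finP: "finite (Pi\<^sub>E D A)"
    using assms by (intro finite_PiE) auto
  have "(\<Sum>P \<in> {P \<in> Pi\<^sub>E D A. ?c P}. \<Prod>x\<in>D. 1 / real (P x)) =
      (\<Sum>P \<in> Pi\<^sub>E D A. if ?c P then \<Prod>x\<in>D. 1 / real (P x) else 0)"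
    using finP by (subst sum.inter_filter) auto
  also have "\<dots> = (\<Sum>(y, g) \<in> A e \<times> Pi\<^sub>E D' A. if ?c (g(e := y)) then \<Prod>x\<in>D. 1 / real ((g(e := y)) x) else 0)"
    unfolding D(1) PiE_insert_eq
    by (subst sum.reindex[OF inj_combinator[OF D(2)]]) (auto simp: case_prod_unfold intro!: sum.cong)
  also have "\<dots> = (\<Sum>y\<in>A e. \<Sum>g\<in>Pi\<^sub>E D' A. if ?c (g(e := y)) then \<Prod>x\<in>D. 1 / real ((g(e := y)) x) else 0)"
    by (rule sum.cartesian_product[symmetric])
  also have "\<dots> = (\<Sum>g\<in>Pi\<^sub>E D' A. \<Sum>y\<in>A e. if ?c (g(e := y)) then \<Prod>x\<in>D. 1 / real ((g(e := y)) x) else 0)"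
    by (rule sum.swap)
  also have "\<dots> \<le> (\<Sum>g\<in>Pi\<^sub>E D' A. B * (\<Prod>x\<in>D'. 1 / real (g x)))"
  proof (rule sum_mono)
    fix g assume g: "g \<in> Pi\<^sub>E D' A"
    have gpos: "0 < g x" if "x \<in> D'" for x
      using that g assms(3)[of x "g x"] D(1) by auto
    have finU: "finite U" "finite V"
      using UV assms finite_subset by blast+
    define u v where "u = prod g (U - {e})" and "v = prod g V"
    have pos: "0 < u" "0 < v"
      unfolding u_def v_def using gpos UV D(1) by (intro prod_pos; blast)+
    have U: "prod (g(e := y)) U = y * u" for y
      unfolding u_def using UV finU by (subst prod.remove[of _ e]) (auto intro!: prod.cong)
    have V: "prod (g(e := y)) V = v" for y
      unfolding v_def using UV by (intro prod.cong) auto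
    have DD: "(\<Prod>x\<in>D. 1 / real ((g(e := y)) x)) = (1 / real y) * (\<Prod>x\<in>D'. 1 / real (g x))" for y
      unfolding D(1) using D by (subst prod.insert) (auto intro!: prod.cong)
    define Y where "Y = real v / real u"
    have Y: "0 < Y"
      using pos by (simp add: Y_def)
    have "(\<Sum>y\<in>A e. if ?c (g(e := y)) then \<Prod>x\<in>D. 1 / real ((g(e := y)) x) else 0) \<le>
        (\<Sum>y\<in>A e. if Y / C < real y \<and> real y < C * Y then (1 / real y) * (\<Prod>x\<in>D'. 1 / real (g x)) else 0)"
    proof (rule sum_mono)
      fix y assume "y \<in> A e"
      have "Y / C < real y \<and> real y < C * Y" if "?c (g(e := y))"
        using that pos C unfolding U V Y_def by (simp add: field_simps)
      moreover have "0 \<le> (1 / real y) * (\<Prod>x\<in>D'. 1 / real (g x))"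
        by (intro mult_nonneg_nonneg prod_nonneg) auto
      ultimately show "(if ?c (g(e := y)) then \<Prod>x\<in>D. 1 / real ((g(e := y)) x) else 0) \<le>
          (if Y / C < real y \<and> real y < C * Y then (1 / real y) * (\<Prod>x\<in>D'. 1 / real (g x)) else 0)"
        unfolding DD by auto
    qed
    also have "\<dots> = (\<Sum>y | y \<in> A e \<and> Y / C < real y \<and> real y < C * Y. (1 / real y) * (\<Prod>x\<in>D'. 1 / real (g x)))"
      using assms(2)[of e] UV by (subst sum.inter_filter[symmetric]) auto
    also have "\<dots> = (\<Sum>y | y \<in> A e \<and> Y / C < real y \<and> real y < C * Y. 1 / real y) * (\<Prod>x\<in>D'. 1 / real (g x))"
      by (simp add: sum_distrib_right)
    also have "\<dots> \<le> B * (\<Prod>x\<in>D'. 1 / real (g x))"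
      using B[OF Y] by (intro mult_right_mono prod_nonneg) auto
    finally show "(\<Sum>y\<in>A e. if ?c (g(e := y)) then \<Prod>x\<in>D. 1 / real ((g(e := y)) x) else 0) \<le>
        B * (\<Prod>x\<in>D'. 1 / real (g x))" .
  qed
  also have "\<dots> = B * (\<Sum>g\<in>Pi\<^sub>E D' A. \<Prod>x\<in>D'. 1 / real (g x))"
    by (simp add: sum_distrib_left)
  also have "(\<Sum>g\<in>Pi\<^sub>E D' A. \<Prod>x\<in>D'. 1 / real (g x)) = (\<Prod>x\<in>D'. \<Sum>p\<in>A x. 1 / real p)"
    using D assms by (subst prod_sum_PiE) auto
  finally show ?thesis
    by (simp add: D'_def)
qed

text \<open>By unique factorisation the two tuples have the same multiset of values. The permutation
  respects the labels because a prime never belongs to sets with different labels.\<close>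

lemma prod_primes_eq_imp_permutation:
  fixes A :: "'i \<Rightarrow> nat set"
  assumes "finite D" "P \<in> Pi\<^sub>E D A" "Q \<in> Pi\<^sub>E D A"
    and pr: "\<And>x p. x \<in> D \<Longrightarrow> p \<in> A x \<Longrightarrow> prime p"
    and disj: "\<And>x y. x \<in> D \<Longrightarrow> y \<in> D \<Longrightarrow> A x \<inter> A y \<noteq> {} \<Longrightarrow> l x = l y"
    and eq: "prod P D = prod Q D"
  obtains \<sigma> where "\<sigma> permutes D" "\<And>x. x \<in> D \<Longrightarrow> Q x = P (\<sigma> x)" "\<And>x. x \<in> D \<Longrightarrow> l (\<sigma> x) = l x"
proof -
  have fac: "prime_factorization (prod R D) = image_mset R (mset_set D)" if "R \<in> Pi\<^sub>E D A" for R
  proof -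
    have "prod R D = prod_mset (image_mset R (mset_set D))"
      by (simp add: prod_unfold_prod_mset)
    also have "prime_factorization \<dots> = image_mset R (mset_set D)"
      by (rule prime_factorization_prod_mset_primes) (use that assms(1) pr in auto)
    finally show ?thesis .
  qed
  have "image_mset Q (mset_set D) = image_mset P (mset_set D)"
    using fac[OF assms(2)] fac[OF assms(3)] eq by simp
  then obtain \<sigma> where s: "\<sigma> permutes D" "\<forall>x\<in>D. Q x = P (\<sigma> x)"
    using image_mset_eq_implies_permutes[OF assms(1)] by blast
  show thesis
  proof (rule that[OF s(1)])
    fix x assume x: "x \<in> D"
    then have sx: "\<sigma> x \<in> D"
      using s(1) by (simp add: permutes_in_image)
    show "Q x = P (\<sigma> x)"
      using s x by blast
    then have "Q x \<in> A x \<inter> A (\<sigma> x)"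
      using assms(2,3) x sx by (metis IntI PiE_mem)
    then show "l (\<sigma> x) = l x"
      using disj[OF x sx] by (metis empty_iff)
  qed
qed

lemma weight_sum_card:
  assumes "finite X" "\<phi> ` X \<subseteq> {1..N}"
  shows "weight_sum N (\<lambda>m. real (card {x \<in> X. \<phi> x = m})) = real (card X)"
proof -
  have "weight_sum N (\<lambda>m. real (card {x \<in> X. \<phi> x = m})) = (\<Sum>m\<in>{1..N}. \<Sum>x\<in>{x \<in> X. \<phi> x = m}. 1)"
    by (simp add: weight_sum_def)
  also have "\<dots> = (\<Sum>x\<in>X. 1)"
    using assms by (intro sum.group) auto
  finally show ?thesis
    by simp
qed

lemma mult_energy_card:
  assumes "finite X" "\<phi> ` X \<subseteq> {1..N}"
  shows "mult_energy N (\<lambda>m. real (card {x \<in> X. \<phi> x = m})) =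
    real (card {(x1, x2, y1, y2). x1 \<in> X \<and> x2 \<in> X \<and> y1 \<in> X \<and> y2 \<in> X \<and> \<phi> x1 * \<phi> x2 = \<phi> y1 * \<phi> y2})"
proof -
  let ?S = "{(m1, m2, n1, n2). m1 \<in> {1..N} \<and> m2 \<in> {1..N} \<and> n1 \<in> {1..N} \<and> n2 \<in> {1..N} \<and> m1 * m2 = n1 * n2}"
  let ?F = "\<lambda>m. {x \<in> X. \<phi> x = m}"
  let ?G = "\<lambda>(m1, m2, n1, n2). ?F m1 \<times> ?F m2 \<times> ?F n1 \<times> ?F n2"
  have finS: "finite ?S"
    by (rule finite_subset[of _ "{1..N} \<times> {1..N} \<times> {1..N} \<times> {1..N}"]) auto
  have "mult_energy N (\<lambda>m. real (card (?F m))) = (\<Sum>q\<in>?S. real (card (?G q)))"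
    unfolding mult_energy_def by (intro sum.cong) (auto simp: card_cartesian_product)
  also have "\<dots> = real (card (\<Union>q\<in>?S. ?G q))"
    using assms(1) finS by (subst card_UN_disjoint) (auto simp del: mem_Times_iff)
  also have "(\<Union>q\<in>?S. ?G q) =
      {(x1, x2, y1, y2). x1 \<in> X \<and> x2 \<in> X \<and> y1 \<in> X \<and> y2 \<in> X \<and> \<phi> x1 * \<phi> x2 = \<phi> y1 * \<phi> y2}"
    using assms(2) by fastforce
  finally show ?thesis .
qed

text \<open>The price of mixing two classes of \<open>k\<close> indices into one class of
  \<open>2 * k\<close>. The 4 here is the one that fixes the base of the scales.\<close>

lemma fact_double_le: "fact (2 * k) \<le> (4 ^ k * (fact k)\<^sup>2 :: nat)"
proof -
  have "fact (2 * k) = fact k * fact k * ((2 * k) choose k)"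
  proof -
    have "k \<le> 2 * k" "2 * k - k = k"
      by simp_all
    then show ?thesis
      using binomial_fact_lemma[of k "2 * k"] by (simp only:)
  qed
  also have "\<dots> \<le> fact k * fact k * 4 ^ k"
    using binomial_even_le by (intro mult_left_mono) auto
  finally show ?thesis
    by (simp add: power2_eq_square mult_ac)
qed

lemma sum_mono_covered:
  fixes g :: "'a \<Rightarrow> real"
  assumes "finite J" "\<And>j. j \<in> J \<Longrightarrow> finite (F j)" "A \<subseteq> (\<Union>j\<in>J. F j)" "\<And>x. 0 \<le> g x"
  shows "sum g A \<le> (\<Sum>j\<in>J. sum g (F j))"
proof -
  have "sum g A \<le> sum g (snd ` Sigma J F)"
  proof (rule sum_mono2)
    show "A \<subseteq> snd ` Sigma J F"
      using assms(3) by force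
  qed (use assms in auto)
  also have "\<dots> \<le> sum (g \<circ> snd) (Sigma J F)"
    using assms by (intro sum_image_le) auto
  also have "\<dots> = (\<Sum>j\<in>J. sum g (F j))"
    using assms by (subst sum.Sigma) (auto simp: case_prod_unfold)
  finally show ?thesis .
qed

text \<open>The saving at scale \<open>s\<close> is carried by \<open>short_sum\<close>: by
  Chebyshev, an interval of bounded ratio has a reciprocal sum of order \<open>1 / ln t\<close>,
  where \<open>t\<close> is the bottom of the scale and \<open>ln t\<close> is to be
  \<open>4 ^ (k * s)\<close>. That each full sum is at least 1 allows a pinned index to be given its
  factor back.\<close>

locale prime_scales =
  fixes n k :: nat and Sc :: "nat \<Rightarrow> nat set" and C B :: real
  assumes finite_Sc: "s < n \<Longrightarrow> finite (Sc s)"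
    and prime_Sc: "s < n \<Longrightarrow> p \<in> Sc s \<Longrightarrow> prime p"
    and disjoint_Sc: "s < n \<Longrightarrow> s' < n \<Longrightarrow> Sc s \<inter> Sc s' \<noteq> {} \<Longrightarrow> s = s'"
    and C_gt_1: "1 < C"
    and inverse_sum_ge_1: "s < n \<Longrightarrow> 1 \<le> (\<Sum>p\<in>Sc s. 1 / real p)"
    and short_sum: "s < n \<Longrightarrow> 0 < Y \<Longrightarrow>
      (\<Sum>p | p \<in> Sc s \<and> Y / C < real p \<and> real p < C * Y. 1 / real p) \<le> B / 4 ^ (k * s)"
begin

definition S :: "nat \<Rightarrow> real" where "S s = (\<Sum>p\<in>Sc s. 1 / real p)"

definition I :: "(nat \<times> nat) set" where "I = {..<n} \<times> {..<k}"

text \<open>Two tuples of primes are encoded as one tuple, whose index set carries an additional Boolean.\<close>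

definition D :: "((nat \<times> nat) \<times> bool) set" where "D = I \<times> UNIV"

definition A :: "(nat \<times> nat) \<times> bool \<Rightarrow> nat set" where "A x = Sc (fst (fst x))"

definition U :: "((nat \<times> nat) \<times> bool) set" where "U = I \<times> {False}"

text \<open>The relation that a common large prime forces on two products, see
  \<open>card_R_inter\<close>.\<close>

definition close :: "nat \<Rightarrow> nat \<Rightarrow> bool" where
  "close a b \<longleftrightarrow> real a < C * real b \<and> real b < C * real a"

lemma fin [simp]: "finite I" "finite D" "finite U" "x \<in> D \<Longrightarrow> finite (A x)" "finite (Pi\<^sub>E D A)"
  by (auto simp: I_def D_def A_def U_def finite_Sc intro!: finite_PiE)

lemma S_ge_1: "s < n \<Longrightarrow> 1 \<le> S s"
  using inverse_sum_ge_1 by (simp add: S_def)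

lemma B_nonneg: "0 < n \<Longrightarrow> 0 \<le> B"
proof -
  assume n: "0 < n"
  have "0 \<le> (\<Sum>p | p \<in> Sc 0 \<and> 1 / C < real p \<and> real p < C * 1. 1 / real p)"
    by (intro sum_nonneg) simp
  also have "\<dots> \<le> B / 4 ^ (k * 0)"
    using n by (rule short_sum) simp
  finally show ?thesis
    by simp
qed

text \<open>Below scale \<open>m\<close> the label forgets the side, so that a label-preserving
  permutation may mix the two tuples there; from scale \<open>m\<close> on it keeps every prime on
  its side.\<close>

definition level :: "nat \<Rightarrow> (nat \<times> nat) \<times> bool \<Rightarrow> nat \<times> bool" where
  "level m x = (fst (fst x), if fst (fst x) < m then False else snd x)"

text \<open>Permutations are classified by the largest scale \<open>m - 1\<close> at which they move a prime between the two
  tuples: closeness of the products then pins down one prime of that scale.\<close>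

definition perms :: "nat \<Rightarrow> ((nat \<times> nat) \<times> bool \<Rightarrow> (nat \<times> nat) \<times> bool) set" where
  "perms m = {\<sigma>. \<sigma> permutes D \<and> (\<forall>x\<in>D. level m (\<sigma> x) = level m x) \<and>
     (m > 0 \<longrightarrow> (\<exists>x\<in>D. fst (fst x) = m - 1 \<and> snd (\<sigma> x) \<noteq> snd x))}"

lemma finite_perms [simp]: "finite (perms m)"
  by (rule finite_subset[OF _ finite_permutations[of D]]) (auto simp: perms_def)

text \<open>Each of the \<open>m\<close> lowest scales forms a single class of \<open>2 * k\<close>
  indices, which costs \<open>4 ^ k\<close> more than two classes of size \<open>k\<close>; the
  higher scales keep two classes.\<close>

lemma card_perms:
  assumes "m \<le> n"
  shows "real (card (perms m)) \<le> 4 ^ (k * m) * (\<Prod>s<n. (fact k)\<^sup>2)"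
proof -
  have "card (perms m) \<le> card {\<sigma>. \<sigma> permutes D \<and> (\<forall>x\<in>D. level m (\<sigma> x) = level m x)}"
    by (intro card_mono finite_subset[OF _ finite_permutations[of D]]) (auto simp: perms_def)
  also have "\<dots> \<le> (\<Prod>c\<in>{..<n} \<times> UNIV. fact (card {x \<in> D. level m x = c}))"
    by (rule card_label_preserving_permutations) (auto simp: level_def D_def I_def)
  also have "\<dots> = (\<Prod>s<n. \<Prod>b\<in>UNIV. fact (card {x \<in> D. level m x = (s, b)}))"
    by (simp add: prod.cartesian_product)
  also have "\<dots> \<le> (\<Prod>s<n. (if s < m then 4 ^ k else 1) * (fact k)\<^sup>2)"
  proof (intro prod_mono conjI)
    fix s assume s: "s \<in> {..<n}"
    show "(\<Prod>b\<in>UNIV. fact (card {x \<in> D. level m x = (s, b)}) :: nat) \<le> (if s < m then 4 ^ k else 1) * (fact k)\<^sup>2"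
    proof (cases "s < m")
      case True
      have e: "{x \<in> D. level m x = (s, True)} = {}"
        using True by (auto simp: level_def)
      have "{x \<in> D. level m x = (s, False)} = ({s} \<times> {..<k}) \<times> UNIV"
        using True s by (auto simp: level_def D_def I_def)
      then have "card {x \<in> D. level m x = (s, False)} = 2 * k"
        by (simp add: card_cartesian_product)
      then show ?thesis
        unfolding UNIV_bool using True fact_double_le[of k] by (simp add: e)
    next
      case False
      have "{x \<in> D. level m x = (s, b)} = ({s} \<times> {..<k}) \<times> {b}" for b
        using False s by (auto simp: level_def D_def I_def)
      then show ?thesis
        using False by (simp add: UNIV_bool card_cartesian_product power2_eq_square)
    qed
  qed simp
  also have "\<dots> = (\<Prod>s<n. if s < m then 4 ^ k else 1) * (\<Prod>s<n. (fact k)\<^sup>2)"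
    by (rule prod.distrib)
  also have "(\<Prod>s<n. if s < m then 4 ^ k else 1) = (\<Prod>s\<in>{s \<in> {..<n}. s < m}. (4::nat) ^ k)"
    by (subst prod.inter_filter) auto
  also have "{s \<in> {..<n}. s < m} = {..<m}"
    using assms by auto
  also have "(\<Prod>s\<in>{..<m}. (4::nat) ^ k) = 4 ^ (k * m)"
    by (simp add: power_mult)
  finally have "real (card (perms m)) \<le> real (4 ^ (k * m) * (\<Prod>s<n. (fact k)\<^sup>2))"
    by (rule of_nat_mono)
  then show ?thesis
    by simp
qed

lemma prod_S: "(\<Prod>x\<in>D. S (fst (fst x))) = (\<Prod>s<n. (S s ^ k)\<^sup>2)"
proof -
  have "(\<Prod>x\<in>D. S (fst (fst x))) = (\<Prod>i\<in>I. \<Prod>b\<in>(UNIV::bool set). S (fst i))"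
    unfolding D_def by (subst prod.cartesian_product) (simp add: case_prod_unfold)
  also have "\<dots> = (\<Prod>s<n. \<Prod>t<k. \<Prod>b\<in>(UNIV::bool set). S s)"
    unfolding I_def by (subst prod.cartesian_product) (simp add: case_prod_unfold)
  finally show ?thesis
    by (simp add: UNIV_bool power_mult_distrib power2_eq_square)
qed

text \<open>For \<open>m = 0\<close> no prime changes sides and closeness is no restriction.
  Otherwise some \<open>x\<close> of scale \<open>m - 1\<close> is moved across, so
  \<open>e\<close>, its image under \<sigma>, lies in exactly one of \<open>U\<close> and the image
  of \<open>U\<close>, and \<open>sum_PiE_pinned\<close> applies in one order or the other. The
  missing factor at \<open>e\<close> is restored because it is at least 1.\<close>

lemma sum_close_perm:
  assumes "m \<le> n" "\<sigma> \<in> perms m"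
  shows "(\<Sum>P | P \<in> Pi\<^sub>E D A \<and> close (prod P U) (prod P (\<sigma> ` U)). \<Prod>x\<in>D. 1 / real (P x))
    \<le> (if m = 0 then 1 else B / 4 ^ (k * (m - 1))) * (\<Prod>s<n. (S s ^ k)\<^sup>2)"
proof (cases "m = 0")
  case True
  have "(\<Sum>P | P \<in> Pi\<^sub>E D A \<and> close (prod P U) (prod P (\<sigma> ` U)). \<Prod>x\<in>D. 1 / real (P x))
      \<le> (\<Sum>P\<in>Pi\<^sub>E D A. \<Prod>x\<in>D. 1 / real (P x))"
    by (rule sum_mono2) (auto intro!: prod_nonneg)
  also have "\<dots> = (\<Prod>x\<in>D. \<Sum>p\<in>A x. 1 / real p)"
    by (subst prod_sum_PiE) auto
  also have "\<dots> = (\<Prod>s<n. (S s ^ k)\<^sup>2)"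
    unfolding prod_S[symmetric] by (simp only: S_def A_def)
  finally show ?thesis
    using True by simp
next
  case False
  have n0: "0 < n"
    using False assms by simp
  obtain x where x: "x \<in> D" "fst (fst x) = m - 1" "snd (\<sigma> x) \<noteq> snd x"
    using assms False by (auto simp: perms_def)
  have perm: "\<sigma> permutes D"
    using assms by (simp add: perms_def)
  define e where "e = \<sigma> x"
  have e: "e \<in> D" "fst (fst e) = m - 1"
    using x assms perm by (auto simp: e_def permutes_in_image perms_def level_def)
  have m1: "m - 1 < n"
    using False assms by simp
  have Usub: "U \<subseteq> D" "\<sigma> ` U \<subseteq> D"
    using permutes_image[OF perm] by (auto simp: U_def D_def)
  have inU: "y \<in> U \<longleftrightarrow> \<not> snd y" if "y \<in> D" for y
    using that by (cases y) (auto simp: U_def D_def)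
  have ex: "e \<in> \<sigma> ` U \<longleftrightarrow> x \<in> U"
    unfolding e_def using inj_image_mem_iff[OF permutes_inj[OF perm]] .
  have pos: "0 < p" if "y \<in> D" "p \<in> A y" for y p
    using that prime_Sc[of "fst (fst y)" p] by (auto simp: D_def I_def A_def prime_gt_0_nat)
  have short: "(\<Sum>p | p \<in> A e \<and> Y / C < real p \<and> real p < C * Y. 1 / real p) \<le> B / 4 ^ (k * (m - 1))"
    if "0 < Y" for Y
    using short_sum[OF m1 that] e by (simp add: A_def)
  have pinned: "(\<Sum>P | P \<in> Pi\<^sub>E D A \<and> close (prod P V) (prod P W). \<Prod>x\<in>D. 1 / real (P x))
      \<le> B / 4 ^ (k * (m - 1)) * (\<Prod>y\<in>D - {e}. \<Sum>p\<in>A y. 1 / real p)"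
    if VW: "V \<subseteq> D" "W \<subseteq> D" "e \<in> V" "e \<notin> W" for V W
    unfolding close_def
  proof (rule sum_PiE_pinned[OF fin(2) _ _ VW C_gt_1])
    show "0 < p" if "y \<in> D" "p \<in> A y" for y p
      using that by (rule pos)
    show "(\<Sum>p | p \<in> A e \<and> Y / C < real p \<and> real p < C * Y. 1 / real p) \<le> B / 4 ^ (k * (m - 1))"
      if "0 < Y" for Y
      using that by (rule short)
  qed simp
  have close_commute: "close (prod P U) (prod P (\<sigma> ` U)) \<longleftrightarrow> close (prod P (\<sigma> ` U)) (prod P U)" for P
    by (auto simp: close_def)
  have "(\<Sum>P | P \<in> Pi\<^sub>E D A \<and> close (prod P U) (prod P (\<sigma> ` U)). \<Prod>x\<in>D. 1 / real (P x))
      \<le> B / 4 ^ (k * (m - 1)) * (\<Prod>y\<in>D - {e}. \<Sum>p\<in>A y. 1 / real p)"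
  proof (cases "e \<in> U")
    case True
    then have "e \<notin> \<sigma> ` U"
      unfolding ex using x inU[OF x(1)] inU[OF e(1)] by (simp add: e_def)
    then show ?thesis
      using pinned[OF Usub True] by blast
  next
    case False
    then have "e \<in> \<sigma> ` U"
      unfolding ex using x inU[OF x(1)] inU[OF e(1)] by (simp add: e_def)
    then show ?thesis
      using pinned[OF Usub(2,1) _ False] unfolding close_commute by blast
  qed
  also have "\<dots> \<le> B / 4 ^ (k * (m - 1)) * (\<Prod>y\<in>D. \<Sum>p\<in>A y. 1 / real p)"
  proof (intro mult_left_mono)
    have ge: "1 \<le> (\<Sum>p\<in>A y. 1 / real p)" if "y \<in> D" for y
      using that inverse_sum_ge_1 by (auto simp: A_def D_def I_def)
    have "1 * (\<Prod>y\<in>D - {e}. \<Sum>p\<in>A y. 1 / real p) \<le> (\<Sum>p\<in>A e. 1 / real p) * (\<Prod>y\<in>D - {e}. \<Sum>p\<in>A y. 1 / real p)"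
      using ge[OF e(1)] by (intro mult_right_mono prod_nonneg sum_nonneg) auto
    then show "(\<Prod>y\<in>D - {e}. \<Sum>p\<in>A y. 1 / real p) \<le> (\<Prod>y\<in>D. \<Sum>p\<in>A y. 1 / real p)"
      using prod.remove[OF fin(2) e(1), of "\<lambda>y. \<Sum>p\<in>A y. 1 / real p"] by simp
  qed (use B_nonneg[OF n0] in auto)
  also have "(\<Prod>y\<in>D. \<Sum>p\<in>A y. 1 / real p) = (\<Prod>s<n. (S s ^ k)\<^sup>2)"
    unfolding prod_S[symmetric] by (simp only: S_def A_def)
  finally show ?thesis
    using False by simp
qed

lemma perms_cover:
  assumes "\<sigma> permutes D" "\<And>x. x \<in> D \<Longrightarrow> fst (fst (\<sigma> x)) = fst (fst x)"
  shows "\<sigma> \<in> (\<Union>m\<le>n. perms m)"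
proof -
  define M where "M = {fst (fst x) |x. x \<in> D \<and> snd (\<sigma> x) \<noteq> snd x}"
  have M: "finite M" "M \<subseteq> {..<n}"
    by (auto simp: M_def D_def I_def intro: finite_subset[of _ "{..<n}"])
  define m where "m = (if M = {} then 0 else Suc (Max M))"
  have "\<sigma> \<in> perms m"
    unfolding perms_def
  proof (intro CollectI conjI ballI impI)
    fix x assume x: "x \<in> D"
    have "snd (\<sigma> x) = snd x" if "m \<le> fst (fst x)"
    proof (rule ccontr)
      assume "snd (\<sigma> x) \<noteq> snd x"
      then have "fst (fst x) \<in> M"
        unfolding M_def using x by blast
      from Max_ge[OF M(1) this] this that show False
        by (auto simp: m_def split: if_splits)
    qed
    then show "level m (\<sigma> x) = level m x"
      using assms(2)[OF x] by (auto simp: level_def)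
  next
    assume "0 < m"
    then have "M \<noteq> {}" "m - 1 = Max M"
      by (auto simp: m_def split: if_splits)
    then have "m - 1 \<in> M"
      using M(1) by simp
    then obtain x where "x \<in> D" "snd (\<sigma> x) \<noteq> snd x" "m - 1 = fst (fst x)"
      unfolding M_def by blast
    then show "\<exists>x\<in>D. fst (fst x) = m - 1 \<and> snd (\<sigma> x) \<noteq> snd x"
      by metis
  qed (fact assms(1))
  moreover have "Max M < n" if "M \<noteq> {}"
    using M(2) Max_in[OF M(1) that] by blast
  then have "m \<le> n"
    by (auto simp: m_def Suc_le_eq)
  ultimately show ?thesis
    by blast
qed

text \<open>The factor \<open>4 ^ (k * m)\<close> from \<open>card_perms\<close> meets the saving
  \<open>4 ^ (k * (m - 1))\<close> from \<open>sum_close_perm\<close>. What remains,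
  \<open>4 ^ k * B\<close>, is the same for all \<open>m > 0\<close>, so the sum over
  \<open>m\<close> costs only a factor linear in \<open>n\<close>.\<close>

lemma tuple_energy_le:
  "(\<Sum>(P, Q) | P \<in> Pi\<^sub>E D A \<and> Q \<in> Pi\<^sub>E D A \<and> prod P D = prod Q D \<and> close (prod P U) (prod Q U).
      \<Prod>x\<in>D. 1 / real (P x)) \<le> (1 + real n * 4 ^ k * B) * (\<Prod>s<n. (fact k * S s ^ k)\<^sup>2)"
proof -
  define perm where "perm = {\<sigma>. \<sigma> permutes D \<and> (\<forall>x\<in>D. fst (fst (\<sigma> x)) = fst (fst x))}"
  define V where "V = (\<lambda>\<sigma>. {P. P \<in> Pi\<^sub>E D A \<and> close (prod P U) (prod P (\<sigma> ` U))})"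
  define f where "f = (\<lambda>P::(nat \<times> nat) \<times> bool \<Rightarrow> nat. \<Prod>x\<in>D. 1 / real (P x))"
  define K where "K = (\<Prod>s<n. (fact k)\<^sup>2 :: real) * (\<Prod>s<n. (S s ^ k)\<^sup>2)"
  have f0: "0 \<le> f P" for P
    unfolding f_def by (intro prod_nonneg) auto
  have finperm: "finite perm"
    by (rule finite_subset[OF _ finite_permutations[of D]]) (auto simp: perm_def)
  have finV: "finite (V \<sigma>)" for \<sigma>
    unfolding V_def by simp
  let ?W = "{(P, Q). P \<in> Pi\<^sub>E D A \<and> Q \<in> Pi\<^sub>E D A \<and> prod P D = prod Q D \<and> close (prod P U) (prod Q U)}"
  \<comment> \<open>The second tuple is the first one rearranged; \<open>restrict\<close> makes it
    extensional. A pair may arise from several permutations, which is harmless for an upper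
    bound.\<close>
  let ?h = "\<lambda>(\<sigma>, P). (P, restrict (P \<circ> \<sigma>) D)"
  have "?W \<subseteq> ?h ` Sigma perm V"
  proof
    fix z assume "z \<in> ?W"
    then obtain P Q where z: "z = (P, Q)" and PQ: "P \<in> Pi\<^sub>E D A" "Q \<in> Pi\<^sub>E D A" "prod P D = prod Q D"
      "close (prod P U) (prod Q U)"
      by auto
    obtain \<sigma> where s: "\<sigma> permutes D" "\<And>x. x \<in> D \<Longrightarrow> Q x = P (\<sigma> x)" "\<And>x. x \<in> D \<Longrightarrow> fst (fst (\<sigma> x)) = fst (fst x)"
    proof (rule prod_primes_eq_imp_permutation[OF fin(2) PQ(1,2) _ _ PQ(3), of "\<lambda>x. fst (fst x)"])
      show "prime p" if "x \<in> D" "p \<in> A x" for x p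
        using that prime_Sc by (auto simp: D_def I_def A_def)
      show "fst (fst x) = fst (fst y)" if "x \<in> D" "y \<in> D" "A x \<inter> A y \<noteq> {}" for x y
        using that disjoint_Sc[of "fst (fst x)" "fst (fst y)"] by (auto simp: D_def I_def A_def)
    qed (rule that)
    have "prod Q U = prod P (\<sigma> ` U)"
      using s(1,2) by (subst prod.reindex) (auto simp: U_def D_def intro!: prod.cong inj_on_subset[OF permutes_inj])
    moreover have "Q = restrict (P \<circ> \<sigma>) D"
      using PQ(2) s(2) by (intro ext) (auto simp: PiE_def extensional_def restrict_def)
    ultimately show "z \<in> ?h ` Sigma perm V"
      using PQ s by (intro image_eqI[of _ _ "(\<sigma>, P)"]) (auto simp: perm_def V_def z)
  qed
  then have "(\<Sum>(P, Q)\<in>?W. f P) \<le> (\<Sum>(P, Q)\<in>?h ` Sigma perm V. f P)"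
    using finperm finV f0 by (intro sum_mono2) auto
  also have "\<dots> \<le> (\<Sum>x\<in>Sigma perm V. ((\<lambda>(P, Q). f P) \<circ> ?h) x)"
    using finperm finV f0 by (intro sum_image_le) auto
  also have "\<dots> = (\<Sum>\<sigma>\<in>perm. sum f (V \<sigma>))"
    using finperm finV by (subst sum.Sigma) (auto simp: case_prod_unfold)
  also have "\<dots> \<le> (\<Sum>m\<le>n. \<Sum>\<sigma>\<in>perms m. sum f (V \<sigma>))"
    using perms_cover f0 by (intro sum_mono_covered) (auto simp: perm_def intro!: sum_nonneg)
  also have "\<dots> \<le> (\<Sum>m\<le>n. (if m = 0 then 1 else 4 ^ k * B) * K)"
  proof (rule sum_mono)
    fix m assume m: "m \<in> {..n}"
    define b where "b = (if m = 0 then 1 else B / 4 ^ (k * (m - 1)))"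
    have b0: "0 \<le> b"
      using m B_nonneg by (auto simp: b_def)
    have S0: "0 \<le> (\<Prod>s<n. (S s ^ k)\<^sup>2)"
      by (intro prod_nonneg) auto
    have "(\<Sum>\<sigma>\<in>perms m. sum f (V \<sigma>)) \<le> (\<Sum>\<sigma>\<in>perms m. b * (\<Prod>s<n. (S s ^ k)\<^sup>2))"
      using m unfolding f_def V_def b_def by (intro sum_mono sum_close_perm) auto
    also have "\<dots> = real (card (perms m)) * (b * (\<Prod>s<n. (S s ^ k)\<^sup>2))"
      by simp
    also have "\<dots> \<le> (4 ^ (k * m) * (\<Prod>s<n. (fact k)\<^sup>2)) * (b * (\<Prod>s<n. (S s ^ k)\<^sup>2))"
      using m b0 S0 by (intro mult_right_mono card_perms mult_nonneg_nonneg) auto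
    also have "\<dots> = (4 ^ (k * m) * b) * K"
      by (simp add: K_def)
    also have "4 ^ (k * m) * b = (if m = 0 then 1 else 4 ^ k * B)"
    proof (cases m)
      case (Suc j)
      then show ?thesis
        by (simp add: b_def power_add)
    qed (simp add: b_def)
    finally show "(\<Sum>\<sigma>\<in>perms m. sum f (V \<sigma>)) \<le> (if m = 0 then 1 else 4 ^ k * B) * K" .
  qed
  also have "\<dots> = (1 + real n * 4 ^ k * B) * K"
    by (subst sum.atMost_shift) (simp add: algebra_simps)
  also have "K = (\<Prod>s<n. (fact k * S s ^ k)\<^sup>2)"
    unfolding K_def prod.distrib[symmetric] by (simp add: power_mult_distrib)
  finally show ?thesis
    unfolding f_def .
qed

end

section \<open>Weights of small energy\<close>

lemma min_energy_le:
  assumes "w \<in> admissible_weights N"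
  shows "min_energy N \<le> (real N)\<^sup>2 * mult_energy N w / weight_sum N w ^ 4"
  unfolding min_energy_def
proof (rule cINF_lower[OF _ assms])
  show "bdd_below ((\<lambda>w. (real N)\<^sup>2 * mult_energy N w / weight_sum N w ^ 4) ` admissible_weights N)"
  proof (rule bdd_belowI2[of _ 0])
    fix w assume "w \<in> admissible_weights N"
    then have "\<And>m. m \<in> {1..N} \<Longrightarrow> 0 \<le> w m"
      by (simp add: admissible_weights_def)
    then have "0 \<le> mult_energy N w"
      unfolding mult_energy_def by (intro sum_nonneg) auto
    then show "0 \<le> (real N)\<^sup>2 * mult_energy N w / weight_sum N w ^ 4"
      by simp
  qed
qed

text \<open>By \<open>size\<close> the product of all \<open>n * k\<close> scale primes is at most
  \<open>N powr (1 / 4)\<close>, and \<open>ln_C\<close> gives the same bound for \<open>C\<close>;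
  this leaves ample room for the large prime. The same \<open>C\<close> is the ratio in
  \<open>close\<close> and the ratio of the interval that contains the large prime, and
  \<open>interval\<close> ensures that this interval has enough primes.\<close>

locale energy_weights = prime_scales n k Sc C B for n k Sc C B +
  fixes N :: nat
  assumes n_pos: "0 < n" and k_pos: "0 < k"
    and Sc_le: "s < n \<Longrightarrow> p \<in> Sc s \<Longrightarrow> real p \<le> exp (4 ^ (k * n))"
    and size: "4 * (real (n * k) * 4 ^ (k * n)) \<le> ln (real N)"
    and ln_C: "4 * ln C \<le> ln (real N)"
    and interval: "C \<le> x \<Longrightarrow> x / (C * ln x) \<le> real (card {p. prime p \<and> x / C < real p \<and> real p \<le> x})"
begin

definition G :: "(nat \<times> nat \<Rightarrow> nat) set" where "G = Pi\<^sub>E I (\<lambda>i. Sc (fst i))"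

definition R :: "nat \<Rightarrow> nat set" where
  "R a = {p. prime p \<and> (real N / real a) / C < real p \<and> real p \<le> real N / real a}"

definition X :: "((nat \<times> nat \<Rightarrow> nat) \<times> nat) set" where "X = Sigma G (\<lambda>P. R (prod P I))"

definition val :: "(nat \<times> nat \<Rightarrow> nat) \<times> nat \<Rightarrow> nat" where "val x = prod (fst x) I * snd x"

definition w :: "nat \<Rightarrow> real" where "w m = real (card {x \<in> X. val x = m})"

lemma ln_N_pos: "0 < ln (real N)"
proof -
  have "0 < 4 * (real (n * k) * 4 ^ (k * n))"
    using n_pos k_pos by simp
  then show ?thesis
    using size by linarith
qed

lemma N_gt_1: "1 < real N"
proof (rule ccontr)
  assume "\<not> 1 < real N"
  then have "N = 0 \<or> N = 1"
    by auto
  then show False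
    using ln_N_pos by auto
qed

lemma exp_ln_N: "exp (ln (real N)) = real N"
  using N_gt_1 by simp

lemma top_le: "4 ^ (k * n) \<le> ln (real N) / 4"
proof -
  have "1 \<le> n * k"
    using n_pos k_pos by (simp add: Suc_le_eq)
  then have "1 \<le> real (n * k)"
    by linarith
  then have "1 * 4 ^ (k * n) \<le> real (n * k) * (4::real) ^ (k * n)"
    by (intro mult_right_mono) auto
  then show ?thesis
    using size by linarith
qed

lemma finite_G [simp]: "finite G"
  unfolding G_def by (rule finite_PiE) (auto simp: I_def finite_Sc)

lemma G_prime:
  assumes "P \<in> G" "i \<in> I"
  shows "prime (P i)" "real (P i) \<le> exp (4 ^ (k * n))"
proof -
  have "P i \<in> Sc (fst i)"
    using PiE_mem[OF assms(1)[unfolded G_def] assms(2)] .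
  moreover have "fst i < n"
    using assms(2) by (auto simp: I_def)
  ultimately show "prime (P i)" "real (P i) \<le> exp (4 ^ (k * n))"
    using prime_Sc Sc_le by auto
qed

lemma prod_G:
  assumes "P \<in> G"
  shows "0 < prod P I" "real (prod P I) \<le> exp (ln (real N) / 4)"
proof -
  show "0 < prod P I"
    using G_prime(1)[OF assms] by (intro prod_pos) (auto simp: prime_gt_0_nat)
  have "real (prod P I) = (\<Prod>i\<in>I. real (P i))"
    by simp
  also have "\<dots> \<le> (\<Prod>i\<in>I. exp (4 ^ (k * n)))"
    using G_prime(2)[OF assms] by (intro prod_mono) auto
  also have "\<dots> = exp (real (n * k) * 4 ^ (k * n))"
    by (simp add: I_def card_cartesian_product exp_of_nat_mult[symmetric])
  also have "\<dots> \<le> exp (ln (real N) / 4)"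
    using size by (subst exp_le_cancel_iff) linarith
  finally show "real (prod P I) \<le> exp (ln (real N) / 4)" .
qed

lemma quotient_ge:
  assumes "P \<in> G"
  shows "exp (3 / 4 * ln (real N)) \<le> real N / real (prod P I)"
proof -
  have "exp (3 / 4 * ln (real N)) * real (prod P I) \<le> exp (3 / 4 * ln (real N)) * exp (ln (real N) / 4)"
    using prod_G[OF assms] by (intro mult_left_mono) auto
  also have "\<dots> = real N"
    using exp_ln_N by (simp add: exp_add[symmetric])
  finally show ?thesis
    using prod_G(1)[OF assms] by (subst le_divide_eq) (auto simp del: of_nat_prod)
qed

lemma C_le: "C \<le> exp (ln (real N) / 4)"
proof -
  have "C = exp (ln C)"
    using C_gt_1 by simp
  also have "\<dots> \<le> exp (ln (real N) / 4)"
    using ln_C by (subst exp_le_cancel_iff) linarith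
  finally show ?thesis .
qed

text \<open>The range of the large primes begins at or above \<open>N powr (3 / 4) / C\<close>,
  whereas both \<open>C\<close> and the top of the scales are at most \<open>N powr (1 / 4)\<close>.
  Large primes can therefore be recognised in a factorisation.\<close>

lemma R_gt:
  assumes "P \<in> G" "p \<in> R (prod P I)"
  shows "exp (4 ^ (k * n)) < real p"
proof -
  have "exp (4 ^ (k * n)) * C \<le> exp (ln (real N) / 4) * exp (ln (real N) / 4)"
    using C_le C_gt_1 top_le by (intro mult_mono) auto
  also have "\<dots> \<le> exp (3 / 4 * ln (real N))"
    unfolding exp_add[symmetric] using ln_N_pos by (subst exp_le_cancel_iff) linarith
  also have "\<dots> \<le> real N / real (prod P I)"
    by (rule quotient_ge[OF assms(1)])
  finally have "exp (4 ^ (k * n)) \<le> real N / real (prod P I) / C"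
    using C_gt_1 by (subst le_divide_eq) auto
  also have "\<dots> < real p"
    using assms(2) by (simp add: R_def)
  finally show ?thesis .
qed

lemma R_not_dvd:
  assumes "P \<in> G" "p \<in> R (prod P I)" "Q \<in> G"
  shows "prime p" "\<not> p dvd prod Q I"
proof -
  show p: "prime p"
    using assms by (simp add: R_def)
  show "\<not> p dvd prod Q I"
  proof
    assume "p dvd prod Q I"
    then obtain i where i: "i \<in> I" "p dvd Q i"
      using prime_dvd_prod_iff[OF fin(1) p] by blast
    then have "p = Q i"
      using p G_prime(1)[OF assms(3) i(1)] primes_dvd_imp_eq by blast
    then show False
      using R_gt[OF assms(1,2)] G_prime(2)[OF assms(3) i(1)] by simp
  qed
qed

lemma finite_R [simp]: "finite (R a)"
  by (rule finite_subset[of _ "primes_upto (real N / real a)"]) (auto simp: R_def)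

lemma finite_X [simp]: "finite X"
  by (simp add: X_def)

lemma val_X: "val ` X \<subseteq> {1..N}"
proof
  fix m assume "m \<in> val ` X"
  then obtain P p where m: "m = prod P I * p" and P: "P \<in> G" "p \<in> R (prod P I)"
    by (auto simp: X_def val_def)
  have "0 < p"
    using P(2) by (simp add: R_def prime_gt_0_nat)
  moreover have "real p \<le> real N / real (prod P I)"
    using P(2) by (simp add: R_def)
  then have "real (prod P I * p) \<le> real N"
    using prod_G(1)[OF P(1)] by (simp add: le_divide_eq mult.commute del: of_nat_prod)
  ultimately show "m \<in> {1..N}"
    using prod_G(1)[OF P(1)] unfolding m of_nat_le_iff by (simp add: Suc_le_eq)
qed

text \<open>Together with \<open>card_R_ge\<close>, this shows that the choice of the large prime
  acts, up to constants, as the weight \<open>1 / prod P I\<close>; sums over tuples thereby become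
  products of reciprocal sums. The 10 is Chebyshev's 5 doubled, as the range reaches beyond
  \<open>sqrt N\<close>.\<close>

lemma card_R_le:
  assumes "P \<in> G"
  shows "real (card (R (prod P I))) \<le> 10 * (real N / ln (real N)) / real (prod P I)"
proof -
  define x where "x = real N / real (prod P I)"
  have "exp (ln (real N) / 2) \<le> exp (3 / 4 * ln (real N))"
    using ln_N_pos by (subst exp_le_cancel_iff) linarith
  then have x: "exp (ln (real N) / 2) \<le> x"
    unfolding x_def using quotient_ge[OF assms] by linarith
  have "1 < exp (ln (real N) / 2)"
    using ln_N_pos by simp
  then have x1: "1 < x"
    using x by linarith
  have lx: "ln (real N) / 2 \<le> ln x"
    using x x1 by (subst ln_ge_iff) auto
  have "real (card (R (prod P I))) \<le> real (card (primes_upto x))"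
    by (intro of_nat_mono card_mono) (auto simp: R_def x_def)
  also have "\<dots> \<le> 5 * (x / ln x)"
    by (rule chebyshev_upper[OF x1])
  also have "\<dots> \<le> 5 * (x / (ln (real N) / 2))"
    using lx x1 ln_N_pos by (intro mult_left_mono divide_left_mono) auto
  also have "\<dots> = 10 * (real N / ln (real N)) / real (prod P I)"
    by (simp add: x_def)
  finally show ?thesis .
qed

lemma card_R_ge:
  assumes "P \<in> G"
  shows "real N / (C * ln (real N)) / real (prod P I) \<le> real (card (R (prod P I)))"
proof -
  define x where "x = real N / real (prod P I)"
  have "C \<le> exp (ln (real N) / 4)"
    by (rule C_le)
  also have "\<dots> \<le> exp (3 / 4 * ln (real N))"
    using ln_N_pos by (subst exp_le_cancel_iff) linarith
  also have "\<dots> \<le> x"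
    unfolding x_def by (rule quotient_ge[OF assms])
  finally have x: "C \<le> x" .
  have "1 \<le> real (prod P I)"
    using prod_G(1)[OF assms] by linarith
  then have xN: "x \<le> real N"
    unfolding x_def using N_gt_1 by (simp add: divide_le_eq mult_left_le del: of_nat_prod)
  have lx: "0 < ln x" "ln x \<le> ln (real N)"
    using x C_gt_1 xN by auto
  have "real N / (C * ln (real N)) / real (prod P I) = x / (C * ln (real N))"
    by (simp add: x_def)
  also have "\<dots> \<le> x / (C * ln x)"
    using lx x C_gt_1 ln_N_pos by (intro divide_left_mono mult_left_mono mult_pos_pos) auto
  also have "\<dots> \<le> real (card (R (prod P I)))"
    using interval[OF x] unfolding R_def x_def .
  finally show ?thesis .
qed

lemma weight_sum_ge: "real N / (C * ln (real N)) * (\<Prod>s<n. S s ^ k) \<le> weight_sum N w"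
proof -
  have "(\<Prod>s<n. S s ^ k) = (\<Prod>s<n. \<Prod>t<k. S s)"
    by simp
  also have "\<dots> = (\<Prod>i\<in>I. S (fst i))"
    unfolding I_def by (subst prod.cartesian_product) (simp add: case_prod_unfold)
  also have "\<dots> = (\<Sum>P\<in>G. \<Prod>i\<in>I. 1 / real (P i))"
    unfolding S_def G_def by (rule prod_sum_PiE) (auto simp: I_def finite_Sc)
  finally have "real N / (C * ln (real N)) * (\<Prod>s<n. S s ^ k) = (\<Sum>P\<in>G. real N / (C * ln (real N)) / real (prod P I))"
    by (simp add: sum_distrib_left prod_dividef)
  also have "\<dots> \<le> (\<Sum>P\<in>G. real (card (R (prod P I))))"
    by (intro sum_mono card_R_ge)
  also have "\<dots> = real (card X)"
    by (simp add: X_def)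
  also have "\<dots> = weight_sum N w"
    unfolding w_def by (rule weight_sum_card[OF finite_X val_X, symmetric])
  finally show ?thesis .
qed

definition H :: "((nat \<times> nat \<Rightarrow> nat) \<times> (nat \<times> nat \<Rightarrow> nat) \<times> (nat \<times> nat \<Rightarrow> nat) \<times> (nat \<times> nat \<Rightarrow> nat)) set" where
  "H = {(P1, P2, Q1, Q2). P1 \<in> G \<and> P2 \<in> G \<and> Q1 \<in> G \<and> Q2 \<in> G \<and> prod P1 I * prod P2 I = prod Q1 I * prod Q2 I}"

lemma finite_H [simp]: "finite H"
  by (rule finite_subset[of _ "G \<times> G \<times> G \<times> G"]) (auto simp: H_def)

text \<open>The large primes must agree up to order, as they exceed all the primes in the scales.\<close>

lemma mult_energy_le_card:
  "mult_energy N w \<le> 2 * (\<Sum>(P1, P2, Q1, Q2)\<in>H.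
     real (card (R (prod P1 I) \<inter> R (prod Q1 I))) * real (card (R (prod P2 I) \<inter> R (prod Q2 I))))"
proof -
  define \<Omega> where "\<Omega> = {(x1, x2, y1, y2). x1 \<in> X \<and> x2 \<in> X \<and> y1 \<in> X \<and> y2 \<in> X \<and> val x1 * val x2 = val y1 * val y2}"
  define E1 where "E1 = {(x1, x2, y1, y2) \<in> \<Omega>. snd x1 = snd y1}"
  define E2 where "E2 = {(x1, x2, y1, y2) \<in> \<Omega>. snd x1 = snd y2}"
  have fin\<Omega>: "finite \<Omega>"
    by (rule finite_subset[of _ "X \<times> X \<times> X \<times> X"]) (auto simp: \<Omega>_def)
  then have finE: "finite E1" "finite E2"
    by (auto simp: E1_def E2_def intro: finite_subset[of _ \<Omega>])
  have dvd: "p = q"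
    if "(P, p) \<in> X" "(Q, q) \<in> X" "(Q', q') \<in> X" "p dvd prod Q I * prod Q' I * q" for P p Q q Q' q'
  proof -
    have p: "prime p" "\<not> p dvd prod Q I" "\<not> p dvd prod Q' I"
      using that R_not_dvd[of P p] by (auto simp: X_def)
    then have "p dvd q"
      using that(4) by (simp add: prime_dvd_mult_iff)
    then show ?thesis
      using p(1) that(2) primes_dvd_imp_eq by (auto simp: X_def R_def)
  qed
  have "\<Omega> \<subseteq> E1 \<union> E2"
  proof
    fix z assume z: "z \<in> \<Omega>"
    obtain P1 p1 P2 p2 Q1 q1 Q2 q2 where zz: "z = ((P1, p1), (P2, p2), (Q1, q1), (Q2, q2))"
      by (metis prod.exhaust)
    have X: "(P1, p1) \<in> X" "(P2, p2) \<in> X" "(Q1, q1) \<in> X" "(Q2, q2) \<in> X"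
      and eq: "prod P1 I * p1 * (prod P2 I * p2) = prod Q1 I * q1 * (prod Q2 I * q2)"
      using z by (auto simp: zz \<Omega>_def val_def)
    have "p1 dvd prod Q1 I * q1 * (prod Q2 I * q2)"
      unfolding eq[symmetric] by simp
    then have "p1 dvd prod Q1 I * q1 \<or> p1 dvd prod Q2 I * q2"
      using X(1) by (auto simp: X_def R_def prime_dvd_mult_iff)
    then have "p1 = q1 \<or> p1 = q2"
      using dvd[OF X(1,3,4)] dvd[OF X(1,4,3)] by (metis dvd_mult2 mult.assoc mult.commute)
    then show "z \<in> E1 \<union> E2"
      using z by (auto simp: zz E1_def E2_def)
  qed
  then have "card \<Omega> \<le> card (E1 \<union> E2)"
    using finE by (intro card_mono) auto
  also have "\<dots> \<le> card E1 + card E2"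
    by (rule card_Un_le)
  \<comment> \<open>Exchanging \<open>y1\<close> and \<open>y2\<close> carries one case into the
    other, hence the factor 2.\<close>
  also have "card E2 \<le> card E1"
  proof (rule card_inj_on_le)
    show "inj_on (\<lambda>(x1, x2, y1, y2). (x1, x2, y2, y1)) E2"
      by (auto simp: inj_on_def)
    show "(\<lambda>(x1, x2, y1, y2). (x1, x2, y2, y1)) ` E2 \<subseteq> E1"
      by (auto simp: E1_def E2_def \<Omega>_def mult.commute)
  qed (fact finE)
  finally have card\<Omega>: "card \<Omega> \<le> 2 * card E1"
    by simp
  let ?R = "\<lambda>(P1, P2, Q1, Q2). (R (prod P1 I) \<inter> R (prod Q1 I)) \<times> (R (prod P2 I) \<inter> R (prod Q2 I))"
  let ?f = "\<lambda>((P1, P2, Q1, Q2), (p1, p2)). ((P1, p1), (P2, p2), (Q1, p1), (Q2, p2))"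
  have "E1 \<subseteq> ?f ` Sigma H ?R"
  proof
    fix z assume z: "z \<in> E1"
    obtain P1 p1 P2 p2 Q1 q1 Q2 q2 where zz: "z = ((P1, p1), (P2, p2), (Q1, q1), (Q2, q2))"
      by (metis prod.exhaust)
    have X: "(P1, p1) \<in> X" "(P2, p2) \<in> X" "(Q1, q1) \<in> X" "(Q2, q2) \<in> X" and pq: "q1 = p1"
      and eq: "prod P1 I * p1 * (prod P2 I * p2) = prod Q1 I * q1 * (prod Q2 I * q2)"
      using z by (auto simp: zz E1_def \<Omega>_def val_def)
    have "0 < p1"
      using X(1) by (auto simp: X_def R_def prime_gt_0_nat)
    then have eq2: "prod P1 I * prod P2 I * p2 = prod Q1 I * prod Q2 I * q2"
      using eq by (simp add: pq mult_ac)
    have "p2 dvd prod Q1 I * prod Q2 I * q2"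
      unfolding eq2[symmetric] by simp
    then have "p2 = q2"
      using dvd[OF X(2,4,3)] by (simp add: mult_ac)
    moreover have "0 < p2"
      using X(2) by (auto simp: X_def R_def prime_gt_0_nat)
    ultimately have "prod P1 I * prod P2 I = prod Q1 I * prod Q2 I"
      using eq2 by simp
    then show "z \<in> ?f ` Sigma H ?R"
      using X pq \<open>p2 = q2\<close>
      by (intro image_eqI[of _ _ "((P1, P2, Q1, Q2), (p1, p2))"]) (auto simp: zz H_def X_def)
  qed
  then have "card E1 \<le> card (?f ` Sigma H ?R)"
    by (intro card_mono finite_imageI finite_SigmaI) auto
  also have "\<dots> \<le> card (Sigma H ?R)"
    by (intro card_image_le finite_SigmaI) auto
  also have "\<dots> = (\<Sum>h\<in>H. card (?R h))"
    by (subst card_SigmaI) auto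
  finally have "real (card E1) \<le> real (\<Sum>h\<in>H. card (?R h))"
    by (rule of_nat_mono)
  also have "\<dots> = (\<Sum>(P1, P2, Q1, Q2)\<in>H.
     real (card (R (prod P1 I) \<inter> R (prod Q1 I))) * real (card (R (prod P2 I) \<inter> R (prod Q2 I))))"
    unfolding of_nat_sum by (intro sum.cong) (auto simp: card_cartesian_product)
  finally have "real (card E1) \<le> \<dots>" .
  moreover have "mult_energy N w = real (card \<Omega>)"
    unfolding w_def \<Omega>_def by (rule mult_energy_card[OF finite_X val_X])
  ultimately show ?thesis
    using card\<Omega> by linarith
qed

text \<open>A prime common to both ranges satisfies \<open>N / a / C < p \<le> N / b\<close> and the
  same with \<open>a\<close> and \<open>b\<close> exchanged, so the two products differ by a factor
  less than \<open>C\<close>.\<close>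

lemma card_R_inter:
  assumes "P \<in> G" "Q \<in> G"
  shows "real (card (R (prod P I) \<inter> R (prod Q I))) \<le>
    (if close (prod P I) (prod Q I) then 10 * (real N / ln (real N)) / real (prod P I) else 0)"
proof (cases "R (prod P I) \<inter> R (prod Q I) = {}")
  case True
  have "0 \<le> 10 * (real N / ln (real N)) / real (prod P I)"
    using ln_N_pos by (intro divide_nonneg_nonneg mult_nonneg_nonneg of_nat_0_le_iff) auto
  then show ?thesis
    unfolding True by auto
next
  case False
  then obtain p where p: "p \<in> R (prod P I)" "p \<in> R (prod Q I)"
    by blast
  have N0: "0 < real N"
    using N_gt_1 by simp
  have less: "real b < C * real a"
    if "p \<in> R a" "p \<in> R b" "0 < a" "0 < b" for a b
  proof -
    have "(real N / real a) / C < real N / real b"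
      using that by (auto simp: R_def)
    then show ?thesis
      using that(3,4) N0 C_gt_1 by (simp add: field_simps)
  qed
  have "close (prod P I) (prod Q I)"
    unfolding close_def using less p prod_G(1) assms by blast
  moreover have "card (R (prod P I) \<inter> R (prod Q I)) \<le> card (R (prod P I))"
    by (intro card_mono) auto
  ultimately show ?thesis
    using card_R_le[OF assms(1)] by simp
qed

definition join :: "(nat \<times> nat \<Rightarrow> nat) \<Rightarrow> (nat \<times> nat \<Rightarrow> nat) \<Rightarrow> ((nat \<times> nat) \<times> bool \<Rightarrow> nat)" where
  "join P Q = (\<lambda>x\<in>D. if snd x then Q (fst x) else P (fst x))"

lemma join_PiE: "P \<in> G \<Longrightarrow> Q \<in> G \<Longrightarrow> join P Q \<in> Pi\<^sub>E D A"
  by (auto simp: join_def G_def D_def A_def PiE_iff)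

lemma prod_join_D: "prod (\<lambda>x. f (join P Q x)) D = prod (\<lambda>i. f (P i)) I * prod (\<lambda>i. f (Q i)) I"
  for f :: "nat \<Rightarrow> 'b::comm_monoid_mult"
proof -
  have "prod (\<lambda>x. f (join P Q x)) D = (\<Prod>i\<in>I. \<Prod>b\<in>UNIV. f (join P Q (i, b)))"
    unfolding D_def by (subst prod.cartesian_product) (simp add: case_prod_unfold)
  also have "\<dots> = (\<Prod>i\<in>I. f (P i) * f (Q i))"
    by (intro prod.cong) (auto simp: join_def D_def UNIV_bool)
  finally show ?thesis
    by (simp add: prod.distrib)
qed

lemma prod_join_U: "prod (join P Q) U = prod P I"
proof -
  have "prod (join P Q) U = (\<Prod>i\<in>I. \<Prod>b\<in>{False}. join P Q (i, b))"
    unfolding U_def by (subst prod.cartesian_product) (simp add: case_prod_unfold)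
  then show ?thesis
    by (simp add: join_def D_def cong: prod.cong)
qed

lemma join_inj:
  assumes "P \<in> G" "Q \<in> G" "P' \<in> G" "Q' \<in> G" "join P Q = join P' Q'"
  shows "P = P'" "Q = Q'"
proof -
  have eq: "P i = P' i" "Q i = Q' i" if "i \<in> I" for i
    using fun_cong[OF assms(5), of "(i, False)"] fun_cong[OF assms(5), of "(i, True)"] that
    by (auto simp: join_def D_def)
  show "P = P'"
    by (rule PiE_ext[OF assms(1,3)[unfolded G_def] eq(1)])
  show "Q = Q'"
    by (rule PiE_ext[OF assms(2,4)[unfolded G_def] eq(2)])
qed

text \<open>Since the product of \<open>P1\<close> and \<open>P2\<close> equals that of
  \<open>Q1\<close> and \<open>Q2\<close>, the pair \<open>P1\<close>, \<open>Q1\<close> is close if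
  and only if \<open>P2\<close>, \<open>Q2\<close> is; recording one of the two conditions loses
  nothing. Joining \<open>P1\<close> with \<open>P2\<close> and \<open>Q1\<close> with
  \<open>Q2\<close> is injective and leads to \<open>tuple_energy_le\<close>.\<close>

lemma mult_energy_le:
  "mult_energy N w \<le> 2 * (10 * (real N / ln (real N)))\<^sup>2 * ((1 + real n * 4 ^ k * B) * (\<Prod>s<n. (fact k * S s ^ k)\<^sup>2))"
proof -
  define M where "M = 10 * (real N / ln (real N))"
  have M0: "0 \<le> M"
    using ln_N_pos by (simp add: M_def)
  let ?J = "\<lambda>(P1, P2, Q1, Q2). (join P1 P2, join Q1 Q2)"
  let ?f = "\<lambda>P. \<Prod>x\<in>D. 1 / real (P x)"
  let ?c = "\<lambda>h. close (prod (fst h) I) (prod (fst (snd (snd h))) I)"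
  let ?H = "{h \<in> H. ?c h}"
  let ?W = "{(P, Q). P \<in> Pi\<^sub>E D A \<and> Q \<in> Pi\<^sub>E D A \<and> prod P D = prod Q D \<and> close (prod P U) (prod Q U)}"
  have f0: "0 \<le> ?f P" for P
    by (intro prod_nonneg) auto
  have "(\<Sum>(P1, P2, Q1, Q2)\<in>H.
     real (card (R (prod P1 I) \<inter> R (prod Q1 I))) * real (card (R (prod P2 I) \<inter> R (prod Q2 I))))
     \<le> (\<Sum>(P1, P2, Q1, Q2)\<in>H. if close (prod P1 I) (prod Q1 I) then M\<^sup>2 * ?f (join P1 P2) else 0)"
  proof (rule sum_mono)
    fix h assume h: "h \<in> H"
    obtain P1 P2 Q1 Q2 where hh: "h = (P1, P2, Q1, Q2)"
      by (metis prod.exhaust)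
    have G: "P1 \<in> G" "P2 \<in> G" "Q1 \<in> G" "Q2 \<in> G"
      using h by (auto simp: H_def hh)
    let ?c = "real (card (R (prod P1 I) \<inter> R (prod Q1 I))) * real (card (R (prod P2 I) \<inter> R (prod Q2 I)))"
    have "?c \<le> (if close (prod P1 I) (prod Q1 I) then M\<^sup>2 * ?f (join P1 P2) else 0)"
    proof (cases "close (prod P1 I) (prod Q1 I)")
      case True
      then have le1: "real (card (R (prod P1 I) \<inter> R (prod Q1 I))) \<le> M / real (prod P1 I)"
        using card_R_inter[OF G(1,3)] unfolding M_def[symmetric] by simp
      have M2: "0 \<le> M / real (prod P2 I)"
        using M0 by (intro divide_nonneg_nonneg of_nat_0_le_iff)
      then have le2: "real (card (R (prod P2 I) \<inter> R (prod Q2 I))) \<le> M / real (prod P2 I)"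
        using card_R_inter[OF G(2,4)] unfolding M_def[symmetric] by (simp only: split: if_splits)
      have "?c \<le> (M / real (prod P1 I)) * (M / real (prod P2 I))"
        using M0 le1 le2 by (intro mult_mono divide_nonneg_nonneg of_nat_0_le_iff)
      also have "\<dots> = M\<^sup>2 * ?f (join P1 P2)"
        using prod_join_D[of "\<lambda>p. 1 / real p" P1 P2] by (simp add: prod_dividef power2_eq_square)
      finally show ?thesis
        using True by simp
    next
      case False
      then show ?thesis
        using card_R_inter[OF G(1,3)] by simp
    qed
    then show "(case h of (P1, P2, Q1, Q2) \<Rightarrow>
        real (card (R (prod P1 I) \<inter> R (prod Q1 I))) * real (card (R (prod P2 I) \<inter> R (prod Q2 I)))) \<le>
        (case h of (P1, P2, Q1, Q2) \<Rightarrow> if close (prod P1 I) (prod Q1 I) then M\<^sup>2 * ?f (join P1 P2) else 0)"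
      unfolding hh by (simp only: prod.case)
  qed
  also have "\<dots> = (\<Sum>h\<in>H. if ?c h then M\<^sup>2 * ((\<lambda>(P, Q). ?f P) \<circ> ?J) h else 0)"
    by (intro sum.cong) auto
  also have "\<dots> = (\<Sum>h\<in>?H. M\<^sup>2 * ((\<lambda>(P, Q). ?f P) \<circ> ?J) h)"
    by (rule sum.inter_filter[symmetric]) simp
  also have "\<dots> = M\<^sup>2 * (\<Sum>h\<in>?H. ((\<lambda>(P, Q). ?f P) \<circ> ?J) h)"
    by (rule sum_distrib_left[symmetric])
  also have "(\<Sum>h\<in>?H. ((\<lambda>(P, Q). ?f P) \<circ> ?J) h) = (\<Sum>(P, Q)\<in>?J ` ?H. ?f P)"
  proof (rule sum.reindex[symmetric], rule inj_onI)
    fix h h' assume hh: "h \<in> ?H" "h' \<in> ?H" "?J h = ?J h'"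
    obtain P1 P2 Q1 Q2 where h: "h = (P1, P2, Q1, Q2)"
      by (metis prod.exhaust)
    obtain P1' P2' Q1' Q2' where h': "h' = (P1', P2', Q1', Q2')"
      by (metis prod.exhaust)
    have G: "P1 \<in> G" "P2 \<in> G" "Q1 \<in> G" "Q2 \<in> G" "P1' \<in> G" "P2' \<in> G" "Q1' \<in> G" "Q2' \<in> G"
      using hh(1,2) by (simp_all add: h h' H_def)
    have "join P1 P2 = join P1' P2'" "join Q1 Q2 = join Q1' Q2'"
      using hh(3) by (simp_all add: h h')
    then show "h = h'"
      using join_inj[OF G(1,2,5,6)] join_inj[OF G(3,4,7,8)] by (simp add: h h')
  qed
  also have "M\<^sup>2 * \<dots> \<le> M\<^sup>2 * (\<Sum>(P, Q)\<in>?W. ?f P)"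
  proof (intro mult_left_mono sum_mono2)
    show "finite ?W"
      by (rule finite_subset[of _ "Pi\<^sub>E D A \<times> Pi\<^sub>E D A"]) auto
    show "?J ` ?H \<subseteq> ?W"
    proof (rule image_subsetI)
      fix h assume hh: "h \<in> ?H"
      obtain P1 P2 Q1 Q2 where h: "h = (P1, P2, Q1, Q2)"
        by (metis prod.exhaust)
      show "?J h \<in> ?W"
        using hh prod_join_D[of "\<lambda>x. x"] by (simp add: h H_def prod_join_U join_PiE)
    qed
    show "0 \<le> (case z of (P, Q) \<Rightarrow> ?f P)" for z
      using f0 by (cases z) (simp only: prod.case)
  qed simp
  also have "\<dots> \<le> M\<^sup>2 * ((1 + real n * 4 ^ k * B) * (\<Prod>s<n. (fact k * S s ^ k)\<^sup>2))"
    by (intro mult_left_mono tuple_energy_le) simp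
  finally have "2 * (\<Sum>(P1, P2, Q1, Q2)\<in>H.
     real (card (R (prod P1 I) \<inter> R (prod Q1 I))) * real (card (R (prod P2 I) \<inter> R (prod Q2 I))))
     \<le> 2 * (M\<^sup>2 * ((1 + real n * 4 ^ k * B) * (\<Prod>s<n. (fact k * S s ^ k)\<^sup>2)))"
    by (rule mult_left_mono) simp
  then have "mult_energy N w \<le> 2 * (M\<^sup>2 * ((1 + real n * 4 ^ k * B) * (\<Prod>s<n. (fact k * S s ^ k)\<^sup>2)))"
    by (rule order.trans[OF mult_energy_le_card])
  then show ?thesis
    unfolding M_def by (simp only: mult.assoc)
qed

text \<open>The density \<open>N / ln N\<close> of large primes enters the energy squared and the
  weight sum to the fourth power, which leaves \<open>(ln N)\<^sup>2\<close>. Each scale contributes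
  \<open>(fact k * S s ^ k)\<^sup>2\<close> against \<open>S s ^ (4 * k)\<close>. The 200 is
  \<open>2 * 10\<^sup>2\<close>.\<close>

lemma min_energy_upper:
  "min_energy N \<le> 200 * C ^ 4 * (ln (real N))\<^sup>2 * (1 + real n * 4 ^ k * B) * (\<Prod>s<n. (fact k / S s ^ k)\<^sup>2)"
proof -
  define Z where "Z = (\<Prod>s<n. S s ^ k)"
  define L where "L = ln (real N)"
  have L: "0 < L"
    unfolding L_def by (rule ln_N_pos)
  have Spos: "0 < S s" if "s < n" for s
    using S_ge_1[OF that] by simp
  have Z: "0 < Z"
    unfolding Z_def using Spos by (intro prod_pos) auto
  define W0 where "W0 = real N / (C * L) * Z"
  have W0: "0 < W0"
    unfolding W0_def using Z L C_gt_1 N_gt_1 by simp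
  have W: "W0 \<le> weight_sum N w"
    unfolding W0_def Z_def L_def by (rule weight_sum_ge)
  have wnn: "0 \<le> w m" for m
    by (simp add: w_def)
  have adm: "w \<in> admissible_weights N"
    unfolding admissible_weights_def
  proof (intro CollectI conjI ballI wnn)
    show "\<exists>m\<in>{1..N}. w m \<noteq> 0"
    proof (rule ccontr)
      assume "\<not> (\<exists>m\<in>{1..N}. w m \<noteq> 0)"
      then have "weight_sum N w = 0"
        by (simp add: weight_sum_def)
      then show False
        using W W0 by linarith
    qed
  qed
  have E0: "0 \<le> mult_energy N w"
    unfolding mult_energy_def using wnn by (intro sum_nonneg) auto
  have "min_energy N \<le> (real N)\<^sup>2 * mult_energy N w / weight_sum N w ^ 4"
    by (rule min_energy_le[OF adm])
  also have "\<dots> \<le> (real N)\<^sup>2 * mult_energy N w / W0 ^ 4"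
    using W W0 E0 by (intro divide_left_mono power_mono mult_nonneg_nonneg mult_pos_pos zero_less_power) auto
  also have "\<dots> \<le> (real N)\<^sup>2 * (2 * (10 * (real N / L))\<^sup>2 * ((1 + real n * 4 ^ k * B) * (\<Prod>s<n. (fact k * S s ^ k)\<^sup>2))) / W0 ^ 4"
    unfolding L_def using W0 by (intro divide_right_mono mult_left_mono mult_energy_le) auto
  also have "(\<Prod>s<n. (fact k * S s ^ k)\<^sup>2) = (\<Prod>s<n. (fact k / S s ^ k)\<^sup>2) * Z ^ 4"
    unfolding Z_def prod_power_distrib prod.distrib[symmetric]
  proof (rule prod.cong[OF refl])
    fix s assume "s \<in> {..<n}"
    then have "S s ^ k \<noteq> 0"
      using Spos[of s] by simp
    then show "(fact k * S s ^ k)\<^sup>2 = (fact k / S s ^ k)\<^sup>2 * (S s ^ k) ^ 4"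
      by (simp add: power_divide power_mult_distrib power2_eq_square power4_eq_xxxx)
  qed
  also have "(real N)\<^sup>2 * (2 * (10 * (real N / L))\<^sup>2 * ((1 + real n * 4 ^ k * B) * ((\<Prod>s<n. (fact k / S s ^ k)\<^sup>2) * Z ^ 4))) / W0 ^ 4
      = 200 * C ^ 4 * L\<^sup>2 * (1 + real n * 4 ^ k * B) * (\<Prod>s<n. (fact k / S s ^ k)\<^sup>2)"
  proof -
    have alg: "x\<^sup>2 * (2 * (10 * (x / l))\<^sup>2 * (v * (q * z ^ 4))) / (x / (c * l) * z) ^ 4 = 200 * c ^ 4 * l\<^sup>2 * v * q"
      if "0 < x" "0 < l" "0 < c" "0 < z" for x l c v q z :: real
    proof -
      define y where "y = x / l"
      have y: "0 < y" "x = y * l"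
        using that by (simp_all add: y_def)
      have "(x / (c * l) * z) ^ 4 = y ^ 4 * z ^ 4 / c ^ 4"
        using that by (simp add: y_def power_divide power_mult_distrib)
      then have "x\<^sup>2 * (2 * (10 * (x / l))\<^sup>2 * (v * (q * z ^ 4))) / (x / (c * l) * z) ^ 4 =
          (200 * l\<^sup>2 * v * q) * (y ^ 4 * z ^ 4) / (y ^ 4 * z ^ 4 / c ^ 4)"
        unfolding y_def[symmetric] by (simp add: y(2) power_mult_distrib power2_eq_square power4_eq_xxxx mult_ac)
      also have "\<dots> = 200 * c ^ 4 * l\<^sup>2 * v * q"
        using y that by simp
      finally show ?thesis .
    qed
    show ?thesis
      unfolding W0_def using Z L C_gt_1 N_gt_1 by (intro alg) auto
  qed
  finally show ?thesis
    unfolding L_def .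
qed

end

section \<open>The exponent of the minimal energy\<close>

lemma min_energy_explicit:
  obtains K C0 :: real where "1 \<le> K" "1 \<le> C0"
    "\<And>k n N. 0 < n \<Longrightarrow> 0 < k \<Longrightarrow> 1 \<le> real k * ln 4 - C0 \<Longrightarrow>
      4 * (real (n * k) * 4 ^ (k * n)) \<le> ln (real N) \<Longrightarrow> K \<le> ln (real N) \<Longrightarrow>
      min_energy N \<le> K * (ln (real N))\<^sup>2 * (1 + real n * 4 ^ k * K) * ((fact k / (real k * ln 4 - C0) ^ k)\<^sup>2) ^ n"
proof -
  obtain C where C: "C > 1"
    "\<And>x. C \<le> x \<Longrightarrow> x / (C * ln x) \<le> real (card {p. prime p \<and> x / C < real p \<and> real p \<le> x})"
    using primes_in_interval_lower by blast
  obtain C0 where C0: "C0 \<ge> 1"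
    "\<And>x y. exp 1 \<le> x \<Longrightarrow> x \<le> y \<Longrightarrow>
      ln (ln y / ln x) - C0 \<le> (\<Sum>p | prime p \<and> x < real p \<and> real p \<le> y. 1 / real p)"
    using sum_inverse_primes_lower by blast
  \<comment> \<open>\<open>K\<close> dominates the constant of \<open>min_energy_upper\<close>, the
    bound \<open>B = 5 * C\<^sup>2\<close>, and \<open>4 * ln C\<close>, so that
    \<open>K \<le> ln N\<close> yields \<open>ln_C\<close>.\<close>
  define K where "K = max (max (200 * C ^ 4) (5 * C\<^sup>2)) (max (4 * ln C) 1)"
  have K: "200 * C ^ 4 \<le> K" "5 * C\<^sup>2 \<le> K" "4 * ln C \<le> K" "1 \<le> K"
    by (auto simp: K_def)
  show thesis
  proof (rule that[OF K(4) C0(1)])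
    fix k n N :: nat
    assume n: "0 < n" and k: "0 < k" and kC: "1 \<le> real k * ln 4 - C0"
      and size: "4 * (real (n * k) * 4 ^ (k * n)) \<le> ln (real N)" and KN: "K \<le> ln (real N)"
    \<comment> \<open>Thus \<open>ln (ln (t s)) = k * s * ln 4\<close>: each scale has length
      \<open>k * ln 4\<close> and, by Mertens, a reciprocal sum of at least
      \<open>k * ln 4 - C0\<close>.\<close>
    define t :: "nat \<Rightarrow> real" where "t = (\<lambda>s. exp (4 ^ (k * s)))"
    define Sc where "Sc = (\<lambda>s. {p. prime p \<and> t s < real p \<and> real p \<le> t (Suc s)})"
    have t_mono: "t a \<le> t b" if "a \<le> b" for a b
      unfolding t_def using that by (subst exp_le_cancel_iff) (intro power_increasing mult_left_mono, auto)
    have finSc: "finite (Sc s)" for s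
      by (rule finite_subset[of _ "primes_upto (t (Suc s))"]) (auto simp: Sc_def)
    have ln_t: "ln (t s) = 4 ^ (k * s)" for s
      by (simp add: t_def)
    have sumSc: "real k * ln 4 - C0 \<le> (\<Sum>p\<in>Sc s. 1 / real p)" for s
    proof -
      have "exp 1 \<le> t s"
        unfolding t_def by (subst exp_le_cancel_iff) simp
      then have "ln (ln (t (Suc s)) / ln (t s)) - C0 \<le> (\<Sum>p\<in>Sc s. 1 / real p)"
        unfolding Sc_def by (intro C0(2) t_mono) auto
      also have "ln (t (Suc s)) / ln (t s) = 4 ^ k"
        unfolding ln_t by (simp add: power_add)
      finally show ?thesis
        by (simp only: ln_realpow[of "4::real" k, simplified])
    qed
    interpret energy_weights n k Sc C "5 * C\<^sup>2" N
    proof unfold_locales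
      fix s s' assume "s < n" "s' < n" "Sc s \<inter> Sc s' \<noteq> {}"
      then obtain p where p: "t s < real p" "real p \<le> t (Suc s)" "t s' < real p" "real p \<le> t (Suc s')"
        by (auto simp: Sc_def)
      show "s = s'"
      proof (rule ccontr)
        assume "s \<noteq> s'"
        then consider "Suc s \<le> s'" | "Suc s' \<le> s"
          by linarith
        then show False
          using t_mono[of "Suc s" s'] t_mono[of "Suc s'" s] p by cases linarith+
      qed
    next
      fix s and Y :: real assume s: "s < n" and Y: "0 < Y"
      have t1: "1 < t s"
        by (simp add: t_def)
      have "(\<Sum>p | p \<in> Sc s \<and> Y / C < real p \<and> real p < C * Y. 1 / real p)
          \<le> (\<Sum>p | prime p \<and> t s < real p \<and> Y / C < real p \<and> real p < C * Y. 1 / real p)"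
        by (rule sum_mono2) (auto simp: Sc_def intro: finite_subset[of _ "primes_upto (C * Y)"])
      also have "\<dots> \<le> 5 * C\<^sup>2 / ln (t s)"
        by (rule sum_inverse_primes_short[OF t1 C(1) Y])
      finally show "(\<Sum>p | p \<in> Sc s \<and> Y / C < real p \<and> real p < C * Y. 1 / real p) \<le> 5 * C\<^sup>2 / 4 ^ (k * s)"
        by (simp only: ln_t)
    next
      fix s p assume "s < n" "p \<in> Sc s"
      then have "real p \<le> t (Suc s)" "Suc s \<le> n"
        by (auto simp: Sc_def)
      then have "real p \<le> t n"
        using t_mono[of "Suc s" n] by linarith
      then show "real p \<le> exp (4 ^ (k * n))"
        by (simp only: t_def)
    next
      fix s show "1 \<le> (\<Sum>p\<in>Sc s. 1 / real p)"
        using sumSc[of s] kC by linarith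
    next
      fix x assume "C \<le> x"
      then show "x / (C * ln x) \<le> real (card {p. prime p \<and> x / C < real p \<and> real p \<le> x})"
        by (rule C(2))
    next
      show "4 * ln C \<le> ln (real N)"
        using K KN by linarith
    qed (use n k size C finSc in \<open>auto simp: Sc_def\<close>)
    define \<sigma> where "\<sigma> = real k * ln 4 - C0"
    have \<sigma>: "1 \<le> \<sigma>" "\<sigma> \<le> S s" for s
      using kC sumSc[of s] by (auto simp: \<sigma>_def S_def)
    have "(\<Prod>s<n. (fact k / S s ^ k)\<^sup>2) \<le> (\<Prod>s<n. (fact k / \<sigma> ^ k)\<^sup>2)"
    proof (intro prod_mono conjI power_mono divide_left_mono mult_pos_pos zero_less_power)
      fix s
      show "0 < S s" "0 < \<sigma>" "\<sigma> \<le> S s" "0 \<le> \<sigma>" "0 \<le> fact k / S s ^ k"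
        using \<sigma>(1) \<sigma>(2)[of s] by auto
    qed auto
    then have P: "(\<Prod>s<n. (fact k / S s ^ k)\<^sup>2) \<le> ((fact k / \<sigma> ^ k)\<^sup>2) ^ n"
      by simp
    have "min_energy N \<le> 200 * C ^ 4 * (ln (real N))\<^sup>2 * (1 + real n * 4 ^ k * (5 * C\<^sup>2)) * (\<Prod>s<n. (fact k / S s ^ k)\<^sup>2)"
      by (rule min_energy_upper)
    also have "\<dots> \<le> K * (ln (real N))\<^sup>2 * (1 + real n * 4 ^ k * K) * ((fact k / \<sigma> ^ k)\<^sup>2) ^ n"
      using K P C(1) by (intro mult_mono add_mono order_refl prod_nonneg mult_nonneg_nonneg add_nonneg_nonneg) auto
    finally show "min_energy N \<le> K * (ln (real N))\<^sup>2 * (1 + real n * 4 ^ k * K) *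
        ((fact k / (real k * ln 4 - C0) ^ k)\<^sup>2) ^ n"
      unfolding \<sigma>_def .
  qed
qed

text \<open>Equality holds at \<open>k = 1\<close>. From \<open>k\<close> to \<open>Suc k\<close>
  the right-hand side grows by the factor \<open>Suc k * (1 + 1 / k) ^ Suc k / exp 1\<close>, and
  \<open>ln (1 + 1 / k) \<ge> 1 / (k + 1)\<close> shows that this is at least
  \<open>Suc k\<close>.\<close>

lemma fact_le_stirling: "0 < k \<Longrightarrow> fact k \<le> exp 1 * real k * (real k / exp 1) ^ k"
proof (induction k rule: nat_induct_non_zero)
  case 1
  then show ?case by simp
next
  case (Suc k)
  have "exp 1 \<le> (1 + 1 / real k) ^ Suc k"
  proof -
    have "1 / (real k + 1) \<le> ln (1 + 1 / real k)"
    proof -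
      have "ln (real k / (real k + 1)) \<le> real k / (real k + 1) - 1"
        using Suc by (intro ln_le_minus_one) simp
      also have "\<dots> = - (1 / (real k + 1))"
        using Suc by (simp add: field_simps)
      finally have "1 / (real k + 1) \<le> ln (real k + 1) - ln (real k)"
        using Suc by (simp add: ln_divide_pos)
      also have "\<dots> = ln (1 + 1 / real k)"
        using Suc by (subst ln_divide_pos[symmetric]) (auto simp: field_simps)
      finally show ?thesis .
    qed
    then have "exp (1 / (real k + 1)) ^ Suc k \<le> (1 + 1 / real k) ^ Suc k"
      using Suc by (intro power_mono) (auto simp: ln_ge_iff add_pos_nonneg)
    moreover have "exp (1 / (real k + 1)) ^ Suc k = exp 1"
      unfolding exp_of_nat_mult[symmetric] by (simp add: add.commute)
    ultimately show ?thesis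
      by simp
  qed
  also have "1 + 1 / real k = real (Suc k) / real k"
    using Suc by (simp add: field_simps)
  also have "(real (Suc k) / real k) ^ Suc k = real (Suc k) ^ Suc k / real k ^ Suc k"
    by (rule power_divide)
  finally have e: "exp 1 * real k ^ Suc k \<le> real (Suc k) ^ Suc k"
    using Suc by (subst (asm) le_divide_eq) (simp del: power_Suc of_nat_Suc)
  have "fact (Suc k) = real (Suc k) * fact k"
    by simp
  also have "\<dots> \<le> real (Suc k) * (exp 1 * real k * (real k / exp 1) ^ k)"
    using Suc by (intro mult_left_mono) auto
  also have "\<dots> = real (Suc k) * (exp 1 * real k ^ Suc k) / exp 1 ^ k"
    by (simp add: power_divide)
  also have "\<dots> \<le> real (Suc k) * (real (Suc k) ^ Suc k) / exp 1 ^ k"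
    using e by (intro divide_right_mono mult_left_mono) auto
  also have "\<dots> = exp 1 * real (Suc k) * (real (Suc k) / exp 1) ^ Suc k"
    by (simp add: power_divide)
  finally show ?case .
qed

section \<open>Numerical bounds for \<open>delta\<close>\<close>

lemma ln_4: "ln (4::real) = 2 * ln 2"
  using ln_realpow[of 2 2] by simp

lemma ln_2_bounds: "69314 / 100000 \<le> ln (2::real)" "ln (2::real) \<le> 69315 / 100000"
  using ln_approx_bounds[of 2 5] by (simp_all add: lessThan_nat_numeral lessThan_Suc power_divide)

text \<open>The numbers 1.44268 and 1.44272 lie just below and just above \<open>1 / ln 2\<close>;
  by inversion the logarithm is evaluated at an argument greater than 1.\<close>

lemma ln_ln_2_bounds: "- (36654 / 100000) \<le> ln (ln (2::real))" "ln (ln (2::real)) \<le> - (3664 / 10000)"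
proof -
  have "ln (144272 / 100000::real) \<le> 36654 / 100000"
    using ln_approx_bounds[of "144272 / 100000" 4] by (simp add: lessThan_nat_numeral lessThan_Suc power_divide)
  moreover have "ln (1 / (144272 / 100000) :: real) \<le> ln (ln 2)"
    using ln_2_bounds(1) by (intro ln_mono) auto
  moreover have "ln (1 / (144272 / 100000) :: real) = - ln (144272 / 100000)"
    by (subst ln_divide_pos) simp_all
  ultimately show "- (36654 / 100000) \<le> ln (ln (2::real))"
    by linarith
  have "3664 / 10000 \<le> ln (144268 / 100000::real)"
    using ln_approx_bounds[of "144268 / 100000" 4] by (simp add: lessThan_nat_numeral lessThan_Suc power_divide)
  moreover have "ln (ln 2) \<le> ln (1 / (144268 / 100000) :: real)"
    using ln_2_bounds(2) by (intro ln_mono) auto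
  moreover have "ln (1 / (144268 / 100000) :: real) = - ln (144268 / 100000)"
    by (subst ln_divide_pos) simp_all
  ultimately show "ln (ln (2::real)) \<le> - (3664 / 10000)"
    by linarith
qed

lemma delta_bounds: "855 / 10000 \<le> delta" "delta \<le> 865 / 10000"
proof -
  have l: "0 < ln (2::real)"
    by simp
  have "1 + ln (ln 2) \<le> 9145 / 10000 * ln (2::real)"
    using ln_2_bounds ln_ln_2_bounds by linarith
  then have "(1 + ln (ln 2)) / ln 2 \<le> (9145 / 10000::real)"
    by (simp only: pos_divide_le_eq[OF l])
  then show "855 / 10000 \<le> delta"
    unfolding delta_def by linarith
  have "9135 / 10000 * ln (2::real) \<le> 1 + ln (ln 2)"
    using ln_2_bounds ln_ln_2_bounds by linarith
  then have "(9135 / 10000::real) \<le> (1 + ln (ln 2)) / ln 2"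
    by (simp only: pos_le_divide_eq[OF l])
  then show "delta \<le> 865 / 10000"
    unfolding delta_def by linarith
qed

lemma delta_numeric: "\<bar>delta / 2 - 0.043\<bar> < 0.0005"
proof -
  have "\<bar>delta / 2 - 43 / 1000\<bar> < 1 / 2000"
    unfolding abs_less_iff using delta_bounds by linarith
  then show ?thesis
    by simp
qed

text \<open>Each scale has \<open>ln (ln N)\<close>-length \<open>k * ln 4\<close> and costs a factor \<open>(k! / S ^ k)\<^sup>2\<close>, where
  \<open>S \<ge> k * ln 4 - C0\<close>; the factor \<open>16 ^ k\<close> is the growth of \<open>(ln N)\<^sup>2\<close> per scale.\<close>

lemma scale_factor_le:
  assumes "0 < \<epsilon>"
  shows "\<exists>k>0. 1 \<le> real k * ln 4 - C0 \<and>
    16 ^ k * (fact k / (real k * ln 4 - C0) ^ k)\<^sup>2 \<le> exp (real k * ln 4 * (delta + \<epsilon>))"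
proof -
  have l4: "0 < ln (4::real)"
    by simp
  have lim1: "(\<lambda>k. 2 * (1 + ln (real k)) / real k) \<longlonglongrightarrow> 0"
    by real_asymp
  have lim2: "(\<lambda>k. ln 4 - C0 / real k) \<longlonglongrightarrow> ln 4 - 0"
    by (intro tendsto_diff tendsto_const lim_const_over_n)
  \<comment> \<open>Logarithms per unit of \<open>k\<close>: the first term comes from the square of
    the factor \<open>exp 1 * k\<close> in \<open>fact_le_stirling\<close>, the second from the
    lower bound for the reciprocal sum of a scale, divided by \<open>k\<close>.\<close>
  have "(\<lambda>k. 2 * (1 + ln (real k)) / real k - 2 * ln (ln 4 - C0 / real k)) \<longlonglongrightarrow> 0 - 2 * ln (ln 4 - 0)"
    using l4 by (intro tendsto_diff lim1 tendsto_mult tendsto_const tendsto_ln lim2) auto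
  moreover have "0 - 2 * ln (ln 4 - 0) < - 2 * ln (ln 4) + \<epsilon> * ln (4::real)"
    using assms l4 by simp
  ultimately have ev1: "\<forall>\<^sub>F k in sequentially.
      2 * (1 + ln (real k)) / real k - 2 * ln (ln 4 - C0 / real k) < - 2 * ln (ln 4) + \<epsilon> * ln 4"
    by (rule order_tendstoD(2))
  have "filterlim (\<lambda>k. real k * ln 4 - C0) at_top sequentially"
    by real_asymp
  then have ev2: "\<forall>\<^sub>F k in sequentially. 1 \<le> real k * ln 4 - C0"
    by (simp add: filterlim_at_top)
  have "\<forall>\<^sub>F k in sequentially. 0 < k \<and> 1 \<le> real k * ln 4 - C0 \<and>
      2 * (1 + ln (real k)) / real k - 2 * ln (ln 4 - C0 / real k) < - 2 * ln (ln 4) + \<epsilon> * ln 4"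
    using eventually_gt_at_top[of 0] ev1 ev2 by eventually_elim auto
  then obtain k where k: "0 < k" "1 \<le> real k * ln 4 - C0"
    "2 * (1 + ln (real k)) / real k - 2 * ln (ln 4 - C0 / real k) < - 2 * ln (ln 4) + \<epsilon> * ln 4"
    by (auto dest: eventually_happens)
  define u where "u = ln 4 - C0 / real k"
  have ku: "real k * ln 4 - C0 = real k * u"
    using k(1) by (simp add: u_def field_simps)
  have u: "0 < u"
  proof (rule ccontr)
    assume "\<not> 0 < u"
    then have "real k * u \<le> 0"
      by (intro mult_nonneg_nonpos) auto
    then show False
      using k(2) unfolding ku by linarith
  qed
  have "fact k / (real k * u) ^ k \<le> exp 1 * real k * (real k / exp 1) ^ k / (real k * u) ^ k"
    using k(1) u by (intro divide_right_mono fact_le_stirling) auto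
  also have "\<dots> = exp 1 * real k * (1 / (exp 1 * u)) ^ k"
    using k(1) u by (simp add: power_divide power_mult_distrib)
  also have "\<dots> = exp (1 + ln (real k) - real k * (1 + ln u))"
  proof -
    have "(1 / (exp 1 * u)) ^ k = exp (- (1 + ln u)) ^ k"
      unfolding exp_minus exp_add using u by (simp add: divide_inverse)
    also have "\<dots> = exp (- (real k * (1 + ln u)))"
      by (simp only: exp_of_nat_mult[symmetric] mult_minus_right)
    finally have *: "(1 / (exp 1 * u)) ^ k = exp (- (real k * (1 + ln u)))" .
    have "exp (1 + ln (real k) - real k * (1 + ln u)) = exp 1 * exp (ln (real k)) * exp (- (real k * (1 + ln u)))"
      unfolding exp_add[symmetric] by (rule arg_cong[where f = exp]) simp
    then show ?thesis
      unfolding * using k(1) by simp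
  qed
  finally have q: "fact k / (real k * u) ^ k \<le> exp (1 + ln (real k) - real k * (1 + ln u))" .
  have "16 ^ k * (fact k / (real k * u) ^ k)\<^sup>2 \<le> 16 ^ k * (exp (1 + ln (real k) - real k * (1 + ln u)))\<^sup>2"
  proof (rule mult_left_mono[OF power_mono[OF q]])
    show "0 \<le> fact k / (real k * u) ^ k"
      using u by simp
  qed simp
  also have "\<dots> = exp (real k * (2 * ln 4) + 2 * (1 + ln (real k) - real k * (1 + ln u)))"
  proof -
    have "exp (2 * ln 4) = exp (ln 4) * exp (ln (4::real))"
      by (simp only: mult_2 exp_add)
    then have "exp (2 * ln 4) = (16::real)"
      by simp
    then have "16 ^ k = exp (real k * (2 * ln 4))"
      by (simp only: exp_of_nat_mult)
    moreover have "(exp (1 + ln (real k) - real k * (1 + ln u)))\<^sup>2 = exp (2 * (1 + ln (real k) - real k * (1 + ln u)))"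
      by (rule exp_double[symmetric])
    ultimately show ?thesis
      by (simp only: exp_add)
  qed
  also have "\<dots> \<le> exp (real k * ln 4 * (delta + \<epsilon>))"
  proof (subst exp_le_cancel_iff)
    have "real k * (2 * (1 + ln (real k)) / real k - 2 * ln u) \<le> real k * (- 2 * ln (ln 4) + \<epsilon> * ln 4)"
      by (rule mult_left_mono[OF less_imp_le[OF k(3)[folded u_def]]]) simp
    then have *: "2 * (1 + ln (real k)) - real k * (2 * ln u) \<le> real k * (- 2 * ln (ln 4) + \<epsilon> * ln 4)"
      using k(1) by (simp add: right_diff_distrib)
    have lnln: "ln (ln (4::real)) = ln 2 + ln (ln 2)"
      unfolding ln_4 by (rule ln_mult_pos) simp_all
    have alg: "2 * l * (1 - (1 + x) / l) = 2 * (2 * l) - 2 - 2 * (l + x)" if "l \<noteq> 0" for l x :: real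
      using that by (simp add: field_simps)
    \<comment> \<open>The source of \<open>delta\<close>: per unit of \<open>k\<close>, the growth
      of \<open>(ln N)\<^sup>2\<close> gives \<open>2 * ln 4\<close>, Stirling gives
      \<open>- 2\<close>, and the reciprocal sums give \<open>- 2 * ln (ln 4)\<close>.\<close>
    have "ln 4 * delta = 2 * ln 2 * (1 - (1 + ln (ln 2)) / ln 2)"
      by (simp only: delta_def ln_4)
    also have "\<dots> = 2 * (2 * ln 2) - 2 - 2 * (ln 2 + ln (ln 2))"
      by (rule alg) simp
    finally have d: "ln 4 * delta = 2 * ln 4 - 2 - 2 * ln (ln 4)"
      unfolding lnln by (simp only: ln_4)
    have "real k * (2 * ln 4) + 2 * (1 + ln (real k) - real k * (1 + ln u)) =
        real k * (2 * ln 4 - 2) + (2 * (1 + ln (real k)) - real k * (2 * ln u))"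
      by (simp add: algebra_simps)
    also have "\<dots> \<le> real k * (2 * ln 4 - 2) + real k * (- 2 * ln (ln 4) + \<epsilon> * ln 4)"
      using * by simp
    also have "\<dots> = real k * (ln 4 * delta + \<epsilon> * ln 4)"
      unfolding d by (simp add: algebra_simps)
    also have "\<dots> = real k * ln 4 * (delta + \<epsilon>)"
      by (simp add: algebra_simps)
    finally show "real k * (2 * ln 4) + 2 * (1 + ln (real k) - real k * (1 + ln u)) \<le> real k * ln 4 * (delta + \<epsilon>)" .
  qed
  finally show ?thesis
    unfolding ku[symmetric] by (intro exI[of _ k] conjI k(1,2))
qed

text \<open>Here \<eta> alone determines \<open>k\<close>, and only the number \<open>n\<close> of
  scales grows with \<open>N\<close>.\<close>

lemma min_energy_asymptotic:
  assumes "0 < \<eta>"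
  shows "\<forall>\<^sub>F N in sequentially. min_energy N \<le> ln (real N) powr (delta + \<eta>)"
proof -
  obtain K C0 :: real where K: "1 \<le> K" and C0: "1 \<le> C0"
    and bound: "\<And>k n N. 0 < n \<Longrightarrow> 0 < k \<Longrightarrow> 1 \<le> real k * ln 4 - C0 \<Longrightarrow>
      4 * (real (n * k) * 4 ^ (k * n)) \<le> ln (real N) \<Longrightarrow> K \<le> ln (real N) \<Longrightarrow>
      min_energy N \<le> K * (ln (real N))\<^sup>2 * (1 + real n * 4 ^ k * K) * ((fact k / (real k * ln 4 - C0) ^ k)\<^sup>2) ^ n"
    using min_energy_explicit by blast
  obtain k where k: "0 < k" "1 \<le> real k * ln 4 - C0"
    and q: "16 ^ k * (fact k / (real k * ln 4 - C0) ^ k)\<^sup>2 \<le> exp (real k * ln 4 * (delta + \<eta> / 2))"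
    using scale_factor_le[of "\<eta> / 2" C0] assms by auto
  define Q where "Q = (fact k / (real k * ln 4 - C0) ^ k)\<^sup>2"
  define A where "A = K * (1 + 4 ^ k * K) * (4 * real k * 4 ^ k)\<^sup>2"
  \<comment> \<open>Half of \<eta> was used in the choice of \<open>k\<close>; the other half
    absorbs the polynomial factor \<open>A * (n + 1) ^ 3\<close>.\<close>
  define c where "c = real k * ln 4 * (\<eta> / 2)"
  have c: "0 < c"
    using k assms by (simp add: c_def)
  have A: "0 < A"
    using K k by (simp add: A_def add_pos_nonneg)
  have "\<forall>\<^sub>F n in sequentially. A * (real n + 1) ^ 3 \<le> exp (c * real n)"
    using c A by real_asymp
  then obtain n0 where n0: "\<And>n. n0 \<le> n \<Longrightarrow> A * (real n + 1) ^ 3 \<le> exp (c * real n)"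
    by (auto simp: eventually_sequentially)
  define g where "g = (\<lambda>n. 4 * (real (n * k) * 4 ^ (k * n)))"
  have g_ge: "4 ^ (k * n) \<le> g n" if "0 < n" for n
  proof -
    have "1 \<le> n * k"
      using k that by (simp add: Suc_le_eq)
    then have "1 \<le> 4 * real (n * k)"
      by linarith
    then have "1 * 4 ^ (k * n) \<le> (4 * real (n * k)) * (4::real) ^ (k * n)"
      by (intro mult_right_mono) auto
    then show ?thesis
      by (simp add: g_def)
  qed
  have lnlim: "filterlim (\<lambda>N. ln (real N)) at_top sequentially"
    by real_asymp
  have "\<forall>\<^sub>F N in sequentially. max K (g (Suc n0)) \<le> ln (real N)"
    using lnlim by (simp only: filterlim_at_top)
  then show ?thesis
  proof eventually_elim
    case (elim N)
    define L where "L = ln (real N)"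
    have L: "K \<le> L" "g (Suc n0) \<le> L"
      using elim by (auto simp: L_def)
    let ?T = "{n. g n \<le> L}"
    have finT: "finite ?T"
    proof (rule finite_subset)
      show "?T \<subseteq> {..nat \<lfloor>L\<rfloor>}"
      proof
        fix n assume n: "n \<in> ?T"
        have "real n \<le> g n"
        proof (cases "n = 0")
          case False
          have "real n \<le> 4 ^ n"
          proof -
            have "real n \<le> 2 ^ n"
              using less_exp[of n] by (metis less_imp_le of_nat_le_iff of_nat_numeral of_nat_power)
            also have "(2::real) ^ n \<le> 4 ^ n"
              by (intro power_mono) auto
            finally show ?thesis .
          qed
          also have "\<dots> \<le> 4 ^ (k * n)"
            using k by (intro power_increasing) auto
          also have "\<dots> \<le> g n"
            using False g_ge by simp
          finally show ?thesis .
        qed (simp add: g_def)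
        then show "n \<in> {..nat \<lfloor>L\<rfloor>}"
          using n by (auto simp: le_nat_floor)
      qed
    qed simp
    \<comment> \<open>With as many scales as fit, \<open>L < g (Suc n)\<close> bounds
      \<open>L\<^sup>2\<close> by \<open>(16 ^ k) ^ n\<close> up to a factor quadratic in
      \<open>n\<close>. This is the \<open>16 ^ k\<close> per scale in
      \<open>scale_factor_le\<close>.\<close>
    define n where "n = Max ?T"
    have "n \<in> ?T"
      unfolding n_def using finT L by (intro Max_in) auto
    then have gn: "g n \<le> L"
      by simp
    have nn0: "Suc n0 \<le> n"
      unfolding n_def using finT L by (intro Max_ge) auto
    have gn1: "L < g (Suc n)"
    proof (rule ccontr)
      assume "\<not> L < g (Suc n)"
      then have "Suc n \<le> n"
        unfolding n_def using finT by (intro Max_ge) (auto simp: n_def)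
      then show False by simp
    qed
    have L1: "1 \<le> L"
      using K L by linarith
    have L2: "L\<^sup>2 \<le> (4 * real k * 4 ^ k)\<^sup>2 * (real n + 1)\<^sup>2 * (16 ^ k) ^ n"
    proof -
      have "g (Suc n) = (4 * real k * 4 ^ k) * (real n + 1) * 4 ^ (k * n)"
        by (simp add: g_def power_add algebra_simps)
      then have "L\<^sup>2 \<le> ((4 * real k * 4 ^ k) * (real n + 1) * 4 ^ (k * n))\<^sup>2"
        using gn1 L1 by (intro power_mono) auto
      moreover have "((4::real) ^ (k * n))\<^sup>2 = (16 ^ k) ^ n"
        by (simp add: power_mult[symmetric] mult.commute[of _ 2]) (simp add: power_mult)
      ultimately show ?thesis
        by (simp only: power_mult_distrib)
    qed
    have Q0: "0 \<le> Q"
      by (simp add: Q_def)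
    have L2': "K * L\<^sup>2 \<le> K * ((4 * real k * 4 ^ k)\<^sup>2 * (real n + 1)\<^sup>2 * (16 ^ k) ^ n)"
      using L2 K by (intro mult_left_mono) auto
    have lin: "1 + real n * 4 ^ k * K \<le> (real n + 1) * (1 + 4 ^ k * K)"
      using K by (simp add: algebra_simps)
    have "min_energy N \<le> K * L\<^sup>2 * (1 + real n * 4 ^ k * K) * Q ^ n"
      unfolding L_def Q_def using k nn0 gn L by (intro bound) (auto simp: g_def L_def)
    also have "\<dots> \<le> K * ((4 * real k * 4 ^ k)\<^sup>2 * (real n + 1)\<^sup>2 * (16 ^ k) ^ n) * ((real n + 1) * (1 + 4 ^ k * K)) * Q ^ n"
      by (rule mult_right_mono[OF mult_mono[OF L2' lin]]) (use K Q0 in auto)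
    also have "\<dots> = A * (real n + 1) ^ 3 * (16 ^ k * Q) ^ n"
      by (simp add: A_def power_mult_distrib power2_eq_square power3_eq_cube)
    also have "\<dots> \<le> exp (c * real n) * exp (real k * ln 4 * (delta + \<eta> / 2)) ^ n"
      using n0[of n] nn0 q Q0 A unfolding Q_def[symmetric] by (intro mult_mono power_mono) auto
    also have "\<dots> = exp (real (k * n) * ln 4 * (delta + \<eta>))"
      by (simp add: exp_of_nat_mult[symmetric] exp_add[symmetric] c_def algebra_simps)
    also have "\<dots> = (4 ^ (k * n)) powr (delta + \<eta>)"
      by (simp add: powr_def ln_realpow)
    also have "\<dots> \<le> L powr (delta + \<eta>)"
      using gn g_ge[of n] nn0 delta_bounds assms by (intro powr_mono2) auto
    finally show ?case
      unfolding L_def .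
  qed
qed

section \<open>Mean values of Dirichlet polynomials\<close>

lemma fejer_has_integral:
  fixes T u :: real
  assumes "0 < T" "u \<noteq> 0"
  shows "((\<lambda>t. (1 - t / T) * cos (u * t)) has_integral (1 - cos (u * T)) / (u\<^sup>2 * T)) {0..T}"
proof -
  define F where "F = (\<lambda>t. (1 - t / T) * (sin (u * t) / u) - cos (u * t) / (u\<^sup>2 * T))"
  have "((\<lambda>t. (1 - t / T) * cos (u * t)) has_integral (F T - F 0)) {0..T}"
  proof (rule fundamental_theorem_of_calculus)
    fix t :: real assume "t \<in> {0..T}"
    have "(F has_real_derivative (1 - t / T) * cos (u * t)) (at t within {0..T})"
      unfolding F_def using assms
      by (auto intro!: derivative_eq_intros simp: field_simps power2_eq_square)
    then show "(F has_vector_derivative (1 - t / T) * cos (u * t)) (at t within {0..T})"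
      by (simp add: has_real_derivative_iff_has_vector_derivative)
  qed (use assms in simp)
  moreover have "F T - F 0 = (1 - cos (u * T)) / (u\<^sup>2 * T)"
    using assms by (simp add: F_def field_simps)
  ultimately show ?thesis
    by simp
qed

text \<open>The cosine transform of a triangular weight on the half-line. Its nonnegativity allows
  off-diagonal terms to be dropped from lower bounds; its decay like \<open>1 / u\<^sup>2\<close>
  makes the rows in \<open>sum_fejer_row\<close> summable.\<close>

definition fejer :: "real \<Rightarrow> real \<Rightarrow> real" where
  "fejer T u = integral {0..T} (\<lambda>t. (1 - t / T) * cos (u * t))"

lemma fejer_integrable: "0 < (T::real) \<Longrightarrow> (\<lambda>t. (1 - t / T) * cos ((u::real) * t)) integrable_on {0..T}"
  by (rule integrable_continuous_real) (auto intro!: continuous_intros)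

lemma fejer_zero:
  assumes "0 < T"
  shows "fejer T 0 = T / 2"
proof -
  have "((\<lambda>t. 1 - t / T) has_integral (T - T\<^sup>2 / (2 * T)) - (0 - 0\<^sup>2 / (2 * T))) {0..T}"
    using assms
    by (intro fundamental_theorem_of_calculus)
      (auto intro!: derivative_eq_intros simp: has_real_derivative_iff_has_vector_derivative[symmetric] field_simps)
  then have "integral {0..T} (\<lambda>t. 1 - t / T) = T - T\<^sup>2 / (2 * T)"
    by (simp add: integral_unique)
  also have "\<dots> = T / 2"
    using assms by (simp add: power2_eq_square)
  finally show ?thesis
    by (simp add: fejer_def)
qed

lemma fejer_eq:
  assumes "0 < T" "u \<noteq> 0"
  shows "fejer T u = (1 - cos (u * T)) / (u\<^sup>2 * T)"
  unfolding fejer_def using fejer_has_integral[OF assms] by (rule integral_unique)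

lemma fejer_nonneg:
  assumes "0 < T"
  shows "0 \<le> fejer T u"
  using assms by (cases "u = 0") (auto simp: fejer_zero fejer_eq)

lemma fejer_le:
  assumes "0 < T" "u \<noteq> 0"
  shows "fejer T u \<le> 2 / (u\<^sup>2 * T)"
proof -
  have "1 - cos (u * T) \<le> 2"
    using cos_ge_minus_one[of "u * T"] by linarith
  then show ?thesis
    using assms by (simp add: fejer_eq divide_right_mono)
qed

text \<open>For \<open>k > 0\<close>, \<open>cis (t * ln k)\<close> is
  \<open>k powr (\<i> * t)\<close> in a form whose products and conjugates are immediate.\<close>

definition dpoly :: "nat set \<Rightarrow> (nat \<Rightarrow> real) \<Rightarrow> real \<Rightarrow> complex" where
  "dpoly A c t = (\<Sum>k\<in>A. of_real (c k) * cis (t * ln (real k)))"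

lemma continuous_dpoly [continuous_intros]: "continuous_on S (dpoly A c)"
  unfolding dpoly_def by (intro continuous_intros)

lemma dpoly_mult_cnj:
  "Re (dpoly A c t * cnj (dpoly B d t)) = (\<Sum>k\<in>A. \<Sum>l\<in>B. c k * d l * cos ((ln (real k) - ln (real l)) * t))"
proof -
  have "dpoly A c t * cnj (dpoly B d t) =
      (\<Sum>k\<in>A. \<Sum>l\<in>B. (of_real (c k) * cis (t * ln (real k))) * cnj (of_real (d l) * cis (t * ln (real l))))"
    unfolding dpoly_def cnj_sum sum_product ..
  also have "\<dots> = (\<Sum>k\<in>A. \<Sum>l\<in>B. of_real (c k * d l) * cis ((ln (real k) - ln (real l)) * t))"
    by (intro sum.cong refl) (simp add: cis_cnj cis_mult algebra_simps)
  finally show ?thesis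
    by simp
qed

lemma fejer_mean:
  assumes "0 < T" "finite A" "finite B"
  shows "((\<lambda>t. (1 - t / T) * Re (dpoly A c t * cnj (dpoly B d t))) has_integral
    (\<Sum>k\<in>A. \<Sum>l\<in>B. c k * d l * fejer T (ln (real k) - ln (real l)))) {0..T}"
proof -
  have "((\<lambda>t. \<Sum>k\<in>A. \<Sum>l\<in>B. (c k * d l) * ((1 - t / T) * cos ((ln (real k) - ln (real l)) * t))) has_integral
    (\<Sum>k\<in>A. \<Sum>l\<in>B. (c k * d l) * fejer T (ln (real k) - ln (real l)))) {0..T}"
    unfolding fejer_def using assms fejer_integrable[OF assms(1)]
    by (intro has_integral_sum has_integral_mult_right integrable_integral)
  then show ?thesis
    unfolding dpoly_mult_cnj sum_distrib_left by (simp only: mult_ac)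
qed

lemma abs_ln_diff_ge:
  assumes "0 < k" "0 < l" "k \<le> K" "l \<le> K"
  shows "\<bar>real k - real l\<bar> / real K \<le> \<bar>ln (real k) - ln (real l)\<bar>"
proof -
  have *: "(real b - real a) / real K \<le> ln (real b) - ln (real a)" if "0 < a" "a \<le> b" "b \<le> K" for a b
  proof -
    have "ln (real a / real b) \<le> real a / real b - 1"
      using that by (intro ln_le_minus_one) simp
    then have "(real b - real a) / real b \<le> ln (real b) - ln (real a)"
      using that by (simp add: ln_divide_pos field_simps)
    moreover have "(real b - real a) / real K \<le> (real b - real a) / real b"
      using that by (intro divide_left_mono) auto
    ultimately show ?thesis
      by linarith
  qed
  show ?thesis
  proof (cases "k \<le> l")
    case True
    then show ?thesis
      using *[of k l] assms by (simp add: abs_if)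
  next
    case False
    then show ?thesis
      using *[of l k] assms by (simp add: abs_if)
  qed
qed

lemma sum_inverse_squares_le: "(\<Sum>j = 1..n. 1 / (real j)\<^sup>2) \<le> 2"
proof -
  have "(\<Sum>j = 1..n. 1 / (real j)\<^sup>2) \<le> 2 - 1 / real n" if "0 < n" for n
    using that
  proof (induction n rule: nat_induct_non_zero)
    case (Suc n)
    have "1 / (real (Suc n))\<^sup>2 \<le> 1 / (real n * real (Suc n))"
      using Suc by (intro divide_left_mono) (auto simp: power2_eq_square)
    also have "\<dots> = 1 / real n - 1 / real (Suc n)"
      using Suc by (simp add: field_simps)
    finally show ?case
      using Suc by simp
  qed simp
  from this[of n] show ?thesis
    by (cases "n = 0") (auto intro: order.trans)
qed

text \<open>Logarithms of integers up to \<open>K\<close> at distance \<open>j\<close> differ by at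
  least \<open>j / K\<close>, so such a term is at most \<open>K\<^sup>2 / (T * j\<^sup>2)\<close>,
  hence at most \<open>T / j\<^sup>2\<close> as \<open>K \<le> T\<close>. The 5 is 1 for the
  diagonal and 2 for each side.\<close>

lemma sum_fejer_row:
  assumes "1 \<le> k" "k \<le> K" "real K \<le> T"
  shows "(\<Sum>l = 1..K. fejer (2 * T) (ln (real k) - ln (real l))) \<le> 5 * T"
proof -
  have T: "0 < T"
    using assms by linarith
  have bound: "fejer (2 * T) (ln (real k) - ln (real l)) \<le> T * (1 / (real k - real l)\<^sup>2)"
    if "l \<in> {1..K}" "l \<noteq> k" for l
  proof -
    define u where "u = ln (real k) - ln (real l)"
    have u: "\<bar>real k - real l\<bar> / real K \<le> \<bar>u\<bar>"
      unfolding u_def using that assms by (intro abs_ln_diff_ge) auto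
    have kl: "0 < \<bar>real k - real l\<bar> / real K"
      using that assms by auto
    have u2: "(real k - real l)\<^sup>2 / (real K)\<^sup>2 \<le> u\<^sup>2"
      using power_mono[OF u, of 2] by (simp add: power_divide)
    have "u \<noteq> 0"
      using u kl by auto
    then have "fejer (2 * T) u \<le> 2 / (u\<^sup>2 * (2 * T))"
      using T by (intro fejer_le) auto
    also have "\<dots> = 1 / (u\<^sup>2 * T)"
      by simp
    also have "\<dots> \<le> 1 / ((real k - real l)\<^sup>2 / (real K)\<^sup>2 * T)"
      using u2 T kl that by (intro divide_left_mono mult_right_mono mult_pos_pos) (auto simp: \<open>u \<noteq> 0\<close>)
    also have "\<dots> = (real K)\<^sup>2 / T * (1 / (real k - real l)\<^sup>2)"
      by simp
    also have "\<dots> \<le> T * (1 / (real k - real l)\<^sup>2)"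
    proof (rule mult_right_mono)
      have "(real K)\<^sup>2 \<le> T\<^sup>2"
        using assms by (intro power_mono) auto
      then show "(real K)\<^sup>2 / T \<le> T"
        using T by (simp add: divide_le_eq power2_eq_square)
    qed simp
    finally show ?thesis
      unfolding u_def .
  qed
  have "(\<Sum>l = 1..K. fejer (2 * T) (ln (real k) - ln (real l))) =
      fejer (2 * T) 0 + (\<Sum>l\<in>{1..K} - {k}. fejer (2 * T) (ln (real k) - ln (real l)))"
    using assms by (subst sum.remove[of _ k]) auto
  also have "\<dots> \<le> T + (\<Sum>l\<in>{1..K} - {k}. T * (1 / (real k - real l)\<^sup>2))"
    using T by (intro add_mono sum_mono bound) (auto simp: fejer_zero)
  also have "(\<Sum>l\<in>{1..K} - {k}. T * (1 / (real k - real l)\<^sup>2)) = T * (\<Sum>l\<in>{1..K} - {k}. 1 / (real k - real l)\<^sup>2)"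
    by (simp add: sum_distrib_left)
  also have "{1..K} - {k} = {1..<k} \<union> {k<..K}"
    using assms by auto
  also have "(\<Sum>l\<in>{1..<k} \<union> {k<..K}. 1 / (real k - real l)\<^sup>2) =
      (\<Sum>l\<in>{1..<k}. 1 / (real k - real l)\<^sup>2) + (\<Sum>l\<in>{k<..K}. 1 / (real k - real l)\<^sup>2)"
    by (rule sum.union_disjoint) auto
  also have "(\<Sum>l\<in>{1..<k}. 1 / (real k - real l)\<^sup>2) = (\<Sum>j\<in>{1..k - 1}. 1 / (real j)\<^sup>2)"
    by (rule sum.reindex_bij_witness[of _ "\<lambda>j. k - j" "\<lambda>l. k - l"]) (use assms in \<open>auto simp: of_nat_diff\<close>)
  also have "(\<Sum>l\<in>{k<..K}. 1 / (real k - real l)\<^sup>2) = (\<Sum>j\<in>{1..K - k}. 1 / (real j)\<^sup>2)"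
    by (rule sum.reindex_bij_witness[of _ "\<lambda>j. k + j" "\<lambda>l. l - k"])
      (use assms in \<open>auto simp: of_nat_diff power2_commute\<close>)
  also have "T + T * ((\<Sum>j\<in>{1..k - 1}. 1 / (real j)\<^sup>2) + (\<Sum>j\<in>{1..K - k}. 1 / (real j)\<^sup>2)) \<le> T + T * (2 + 2)"
    using T sum_inverse_squares_le by (intro add_left_mono mult_left_mono add_mono) auto
  finally show ?thesis
    by simp
qed

text \<open>By Schur's test, applied to the matrix of values of the Fejer kernel.\<close>

lemma dpoly_mean_square_le:
  assumes "1 \<le> K" "real K \<le> T"
  shows "integral {0..T} (\<lambda>t. (norm (dpoly {1..K} c t))\<^sup>2) \<le> 10 * T * (\<Sum>k = 1..K. (c k)\<^sup>2)"
proof -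
  define f where "f = (\<lambda>t. (norm (dpoly {1..K} c t))\<^sup>2)"
  have T: "0 < T"
    using assms by linarith
  have fRe: "f t = Re (dpoly {1..K} c t * cnj (dpoly {1..K} c t))" for t
    unfolding f_def by (simp add: cmod_power2) (simp add: power2_eq_square)
  have f0: "0 \<le> f t" for t
    by (simp add: f_def)
  have cont: "continuous_on S f" for S
    unfolding f_def by (intro continuous_intros)
  have int: "((\<lambda>t. (1 - t / (2 * T)) * f t) has_integral
      (\<Sum>k = 1..K. \<Sum>l = 1..K. c k * c l * fejer (2 * T) (ln (real k) - ln (real l)))) {0..2 * T}"
    unfolding fRe using T by (intro fejer_mean) auto
  \<comment> \<open>On \<open>{0..T}\<close> the triangular weight of length \<open>2 * T\<close> is
    at least 1/2; this is the reason for doubling the interval.\<close>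
  have "integral {0..T} f \<le> integral {0..T} (\<lambda>t. 2 * ((1 - t / (2 * T)) * f t))"
  proof (rule integral_le)
    fix t assume "t \<in> {0..T}"
    then have "1 \<le> 2 * (1 - t / (2 * T))"
      using T by (simp add: field_simps)
    then have "1 * f t \<le> 2 * (1 - t / (2 * T)) * f t"
      using f0 by (intro mult_right_mono)
    then show "f t \<le> 2 * ((1 - t / (2 * T)) * f t)"
      by (simp only: mult_1 mult.assoc)
  qed (use T in \<open>auto intro!: integrable_continuous_real continuous_intros cont\<close>)
  also have "\<dots> \<le> integral {0..2 * T} (\<lambda>t. 2 * ((1 - t / (2 * T)) * f t))"
  proof (rule integral_subset_le)
    show "\<forall>t\<in>{0..2 * T}. 0 \<le> 2 * ((1 - t / (2 * T)) * f t)"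
      using T f0 by (intro ballI mult_nonneg_nonneg) auto
  qed (use T in \<open>auto intro!: integrable_continuous_real continuous_intros cont\<close>)
  also have "\<dots> = 2 * (\<Sum>k = 1..K. \<Sum>l = 1..K. c k * c l * fejer (2 * T) (ln (real k) - ln (real l)))"
    using has_integral_mult_right[OF int, of 2] by (rule integral_unique)
  also have "\<dots> \<le> 2 * (\<Sum>k = 1..K. \<Sum>l = 1..K. ((c k)\<^sup>2 / 2 + (c l)\<^sup>2 / 2) * fejer (2 * T) (ln (real k) - ln (real l)))"
  proof (intro mult_left_mono sum_mono mult_right_mono)
    fix k l
    show "c k * c l \<le> (c k)\<^sup>2 / 2 + (c l)\<^sup>2 / 2"
      using sum_squares_bound[of "c k" "c l"] by simp
    show "0 \<le> fejer (2 * T) (ln (real k) - ln (real l))"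
      using T by (intro fejer_nonneg) simp
  qed simp
  also have "\<dots> = 2 * (\<Sum>k = 1..K. (c k)\<^sup>2 * (\<Sum>l = 1..K. fejer (2 * T) (ln (real k) - ln (real l))))"
  proof -
    have sym: "fejer (2 * T) (- u) = fejer (2 * T) u" for u
      by (simp add: fejer_def)
    have commute: "fejer (2 * T) (a - b) = fejer (2 * T) (b - a)" for a b
      using sym[of "b - a"] by simp
    have "(\<Sum>k = 1..K. \<Sum>l = 1..K. (c l)\<^sup>2 / 2 * fejer (2 * T) (ln (real k) - ln (real l))) =
        (\<Sum>l = 1..K. \<Sum>k = 1..K. (c l)\<^sup>2 / 2 * fejer (2 * T) (ln (real l) - ln (real k)))"
      by (subst sum.swap) (intro sum.cong refl arg_cong2[where f = "(*)"] commute)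
    then have "(\<Sum>k = 1..K. \<Sum>l = 1..K. ((c k)\<^sup>2 / 2 + (c l)\<^sup>2 / 2) * fejer (2 * T) (ln (real k) - ln (real l))) =
        (\<Sum>k = 1..K. \<Sum>l = 1..K. (c k)\<^sup>2 / 2 * fejer (2 * T) (ln (real k) - ln (real l))) +
        (\<Sum>k = 1..K. \<Sum>l = 1..K. (c k)\<^sup>2 / 2 * fejer (2 * T) (ln (real k) - ln (real l)))"
      by (simp add: distrib_right sum.distrib)
    then show ?thesis
      by (simp add: sum_distrib_left)
  qed
  also have "\<dots> \<le> 2 * (\<Sum>k = 1..K. (c k)\<^sup>2 * (5 * T))"
    using assms by (intro mult_left_mono sum_mono sum_fejer_row) auto
  also have "\<dots> = 10 * T * (\<Sum>k = 1..K. (c k)\<^sup>2)"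
    by (simp add: sum_distrib_left mult_ac)
  finally show ?thesis
    unfolding f_def .
qed

section \<open>Squares of Dirichlet polynomials and the multiplicative energy\<close>

lemma zeta_sum_dpoly: "zeta_sum N t = dpoly {1..N} (\<lambda>_. 1) t"
  unfolding zeta_sum_def dpoly_def
proof (rule sum.cong[OF refl])
  fix n assume "n \<in> {1..N}"
  then have n: "0 < n"
    by simp
  have "(of_nat n :: complex) powr (\<i> * of_real t) = exp (\<i> * of_real t * ln (of_nat n))"
    using n by (simp add: powr_def)
  also have "ln (of_nat n :: complex) = of_real (ln (real n))"
    using n by (metis Ln_of_real of_nat_0_less_iff of_real_of_nat_eq)
  also have "exp (\<i> * of_real t * of_real (ln (real n))) = cis (t * ln (real n))"
    by (simp add: cis_conv_exp mult.assoc)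
  finally show "(of_nat n :: complex) powr (\<i> * of_real t) = of_real 1 * cis (t * ln (real n))"
    by simp
qed

text \<open>The Dirichlet convolution with itself of \<open>w\<close> cut off at \<open>N\<close>:
  the coefficients of the square of \<open>dpoly {1..N} w\<close>.\<close>

definition conv2 :: "nat \<Rightarrow> (nat \<Rightarrow> real) \<Rightarrow> nat \<Rightarrow> real" where
  "conv2 N w k = (\<Sum>(m1, m2) | m1 \<in> {1..N} \<and> m2 \<in> {1..N} \<and> m1 * m2 = k. w m1 * w m2)"

lemma finite_pairs [simp]: "finite {(m1, m2). m1 \<in> {1..N::nat} \<and> m2 \<in> {1..N} \<and> P m1 m2}"
  by (rule finite_subset[of _ "{1..N} \<times> {1..N}"]) auto

text \<open>Pairs are grouped by their product. The type is general because the complex case gives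
  \<open>dpoly_square\<close> and the real case gives the energy and the weight sum.\<close>

lemma sum_conv2:
  fixes f :: "nat \<Rightarrow> 'a::real_algebra_1"
  shows "(\<Sum>k = 1..N\<^sup>2. of_real (conv2 N w k) * f k) = (\<Sum>m1 = 1..N. \<Sum>m2 = 1..N. of_real (w m1 * w m2) * f (m1 * m2))"
proof -
  let ?P = "{1..N} \<times> {1..N}"
  have "(\<Sum>m1 = 1..N. \<Sum>m2 = 1..N. of_real (w m1 * w m2) * f (m1 * m2)) =
      (\<Sum>x\<in>?P. of_real (w (fst x) * w (snd x)) * f (fst x * snd x))"
    by (simp add: sum.cartesian_product case_prod_unfold)
  also have "\<dots> = (\<Sum>k\<in>{1..N\<^sup>2}. \<Sum>x\<in>{x \<in> ?P. fst x * snd x = k}. of_real (w (fst x) * w (snd x)) * f (fst x * snd x))"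
  proof (rule sum.group[symmetric])
    show "(\<lambda>x. fst x * snd x) ` ?P \<subseteq> {1..N\<^sup>2}"
      by (auto simp: power2_eq_square intro!: mult_le_mono)
  qed auto
  also have "\<dots> = (\<Sum>k\<in>{1..N\<^sup>2}. of_real (conv2 N w k) * f k)"
  proof (rule sum.cong[OF refl])
    fix k
    have "{x \<in> ?P. fst x * snd x = k} = {(m1, m2). m1 \<in> {1..N} \<and> m2 \<in> {1..N} \<and> m1 * m2 = k}"
      by auto
    then show "(\<Sum>x\<in>{x \<in> ?P. fst x * snd x = k}. of_real (w (fst x) * w (snd x)) * f (fst x * snd x)) =
        of_real (conv2 N w k) * f k"
      unfolding conv2_def by (auto simp: sum_distrib_right case_prod_unfold intro!: sum.cong)
  qed
  finally show ?thesis
    by simp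
qed

lemma dpoly_square: "(dpoly {1..N} w t)\<^sup>2 = dpoly {1..N\<^sup>2} (conv2 N w) t"
proof -
  have "dpoly {1..N\<^sup>2} (conv2 N w) t =
      (\<Sum>m1 = 1..N. \<Sum>m2 = 1..N. of_real (w m1 * w m2) * cis (t * ln (real (m1 * m2))))"
    unfolding dpoly_def by (rule sum_conv2)
  also have "\<dots> = (\<Sum>m1 = 1..N. \<Sum>m2 = 1..N. (of_real (w m1) * cis (t * ln (real m1))) * (of_real (w m2) * cis (t * ln (real m2))))"
    by (intro sum.cong refl) (simp add: cis_mult ln_mult distrib_left)
  also have "\<dots> = (dpoly {1..N} w t)\<^sup>2"
    unfolding dpoly_def power2_eq_square sum_product ..
  finally show ?thesis
    by simp
qed

text \<open>With \<open>dpoly_square\<close>, this turns the fourth moment of a Dirichlet polynomial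
  into a mean square whose diagonal is the energy.\<close>

lemma mult_energy_conv2: "mult_energy N w = (\<Sum>k = 1..N\<^sup>2. (conv2 N w k)\<^sup>2)"
proof -
  let ?P = "\<lambda>k. {(m1, m2). m1 \<in> {1..N} \<and> m2 \<in> {1..N} \<and> m1 * m2 = k}"
  have "(\<Sum>k = 1..N\<^sup>2. (conv2 N w k)\<^sup>2) = (\<Sum>k = 1..N\<^sup>2. of_real (conv2 N w k) * conv2 N w k)"
    by (simp add: power2_eq_square)
  also have "\<dots> = (\<Sum>m1 = 1..N. \<Sum>m2 = 1..N. of_real (w m1 * w m2) * conv2 N w (m1 * m2))"
    by (rule sum_conv2)
  also have "\<dots> = (\<Sum>x\<in>{1..N} \<times> {1..N}. \<Sum>y\<in>?P (fst x * snd x). w (fst x) * w (snd x) * w (fst y) * w (snd y))"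
    unfolding sum.cartesian_product conv2_def
    by (intro sum.cong) (auto simp: sum_distrib_left case_prod_unfold mult.assoc)
  also have "\<dots> = (\<Sum>(x, y)\<in>Sigma ({1..N} \<times> {1..N}) (\<lambda>x. ?P (fst x * snd x)). w (fst x) * w (snd x) * w (fst y) * w (snd y))"
  proof (rule sum.Sigma)
    show "\<forall>x\<in>{1..N} \<times> {1..N}. finite (?P (fst x * snd x))"
      by (intro ballI finite_pairs)
  qed simp
  also have "\<dots> = mult_energy N w"
    unfolding mult_energy_def
    by (rule sum.reindex_bij_witness[of _ "\<lambda>(m1, m2, n1, n2). ((m1, m2), (n1, n2))" "\<lambda>((m1, m2), (n1, n2)). (m1, m2, n1, n2)"])
      auto
  finally show ?thesis
    by simp
qed

lemma weight_sum_conv2: "(weight_sum N w)\<^sup>2 = (\<Sum>k = 1..N\<^sup>2. conv2 N w k)"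
  using sum_conv2[of N w "\<lambda>_. 1::real"] by (simp add: weight_sum_def power2_eq_square sum_product)

lemma weight_sum_pos:
  assumes "w \<in> admissible_weights N"
  shows "0 < weight_sum N w"
proof -
  obtain m where m: "m \<in> {1..N}" "w m \<noteq> 0" and nn: "\<forall>m\<in>{1..N}. 0 \<le> w m"
    using assms by (auto simp: admissible_weights_def)
  have "0 < w m"
    using m nn by (metis order_le_less)
  then show ?thesis
    unfolding weight_sum_def using m nn by (intro sum_pos2[of _ m]) auto
qed

text \<open>Cauchy-Schwarz for \<open>conv2\<close>, over the \<open>N\<^sup>2\<close> integers that
  contain all products.\<close>

lemma energy_ratio_ge_1:
  assumes "w \<in> admissible_weights N"
  shows "1 \<le> (real N)\<^sup>2 * mult_energy N w / weight_sum N w ^ 4"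
proof -
  have "(\<Sum>k = 1..N\<^sup>2. 1 * conv2 N w k)\<^sup>2 \<le> (\<Sum>k = 1..N\<^sup>2. 1\<^sup>2) * (\<Sum>k = 1..N\<^sup>2. (conv2 N w k)\<^sup>2)"
    by (rule Cauchy_Schwarz_ineq_sum)
  then have "((weight_sum N w)\<^sup>2)\<^sup>2 \<le> (real N)\<^sup>2 * mult_energy N w"
    unfolding weight_sum_conv2 mult_energy_conv2 by simp
  then have "weight_sum N w ^ 4 \<le> (real N)\<^sup>2 * mult_energy N w"
    by (simp add: power_mult[symmetric])
  then show ?thesis
    using weight_sum_pos[OF assms] by simp
qed

lemma admissible_weights_nonempty:
  assumes "1 \<le> N"
  shows "(\<lambda>_. 1) \<in> admissible_weights N"
  using assms by (auto simp: admissible_weights_def)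

lemma min_energy_ge_1:
  assumes "1 \<le> N"
  shows "1 \<le> min_energy N"
  unfolding min_energy_def using admissible_weights_nonempty[OF assms] energy_ratio_ge_1
  by (intro cINF_greatest) auto


text \<open>By concavity each logarithm lies below the tangent of \<open>ln\<close> at the weighted
  mean \<open>m\<close>, and the linear terms cancel. If a variable is 0, so is the left-hand
  side.\<close>

lemma powr_weighted_am_gm:
  assumes "0 \<le> x" "0 \<le> y" "0 \<le> z" "0 < \<alpha>" "0 < \<beta>" "0 < \<gamma>" "\<alpha> + \<beta> + \<gamma> = (1::real)"
  shows "x powr \<alpha> * y powr \<beta> * z powr \<gamma> \<le> \<alpha> * x + \<beta> * y + \<gamma> * z"
proof (cases "x = 0 \<or> y = 0 \<or> z = 0")
  case True
  then have "x powr \<alpha> * y powr \<beta> * z powr \<gamma> = 0"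
    by auto
  moreover have "0 \<le> \<alpha> * x + \<beta> * y + \<gamma> * z"
    using assms by (intro add_nonneg_nonneg mult_nonneg_nonneg) auto
  ultimately show ?thesis
    by linarith
next
  case False
  then have pos: "0 < x" "0 < y" "0 < z"
    using assms by auto
  have lin: "ln v \<le> ln m + (v - m) / m" if "0 < v" "0 < m" for v m :: real
  proof -
    have "ln (v / m) \<le> v / m - 1"
      using that by (intro ln_le_minus_one) simp
    then show ?thesis
      using that by (simp add: ln_divide_pos diff_divide_distrib)
  qed
  define m where "m = \<alpha> * x + \<beta> * y + \<gamma> * z"
  have m: "0 < m"
    unfolding m_def using pos assms by (intro add_pos_pos mult_pos_pos)
  have "\<alpha> * ln x + \<beta> * ln y + \<gamma> * ln z \<le> \<alpha> * (ln m + (x - m) / m) + \<beta> * (ln m + (y - m) / m) + \<gamma> * (ln m + (z - m) / m)"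
    using pos m assms by (intro add_mono mult_left_mono lin) auto
  also have "\<dots> = (\<alpha> + \<beta> + \<gamma>) * ln m + ((\<alpha> * x + \<beta> * y + \<gamma> * z) - (\<alpha> + \<beta> + \<gamma>) * m) / m"
    by (simp add: algebra_simps add_divide_distrib diff_divide_distrib)
  also have "\<dots> = (\<alpha> + \<beta> + \<gamma>) * ln m + (m - (\<alpha> + \<beta> + \<gamma>) * m) / m"
    unfolding m_def[symmetric] ..
  also have "\<dots> = ln m"
    using assms by simp
  finally have "exp (\<alpha> * ln x + \<beta> * ln y + \<gamma> * ln z) \<le> m"
    using m by (simp add: ln_ge_iff)
  then show ?thesis
    using pos by (simp add: powr_def exp_add m_def)
qed

text \<open>The functions are divided by their integrals, which therefore have to be positive; then
  the weighted mean inequality is integrated pointwise.\<close>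

lemma integral_holder3:
  fixes f g h :: "real \<Rightarrow> real"
  assumes cont: "continuous_on {0..T} f" "continuous_on {0..T} g" "continuous_on {0..T} h"
    and nn: "\<And>t. 0 \<le> f t" "\<And>t. 0 \<le> g t" "\<And>t. 0 \<le> h t"
    and pos: "0 < integral {0..T} f" "0 < integral {0..T} g" "0 < integral {0..T} h"
    and e: "0 < \<alpha>" "0 < \<beta>" "0 < \<gamma>" "\<alpha> + \<beta> + \<gamma> = 1"
  shows "integral {0..T} (\<lambda>t. f t powr \<alpha> * g t powr \<beta> * h t powr \<gamma>)
    \<le> integral {0..T} f powr \<alpha> * integral {0..T} g powr \<beta> * integral {0..T} h powr \<gamma>"
proof -
  define F G H where "F = integral {0..T} f" and "G = integral {0..T} g" and "H = integral {0..T} h"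
  have FGH: "0 < F" "0 < G" "0 < H"
    using pos by (auto simp: F_def G_def H_def)
  define c where "c = F powr \<alpha> * G powr \<beta> * H powr \<gamma>"
  have c: "0 < c"
    using FGH by (simp add: c_def)
  have int: "f integrable_on {0..T}" "g integrable_on {0..T}" "h integrable_on {0..T}"
    using cont by (auto intro: integrable_continuous_real)
  have has: "((\<lambda>t. c * (\<alpha> * (f t / F) + \<beta> * (g t / G) + \<gamma> * (h t / H))) has_integral
      c * (\<alpha> * (F / F) + \<beta> * (G / G) + \<gamma> * (H / H))) {0..T}"
    unfolding F_def G_def H_def
    by (intro has_integral_mult_right has_integral_add has_integral_divide integrable_integral int)
  have "integral {0..T} (\<lambda>t. f t powr \<alpha> * g t powr \<beta> * h t powr \<gamma>) \<le>
      integral {0..T} (\<lambda>t. c * (\<alpha> * (f t / F) + \<beta> * (g t / G) + \<gamma> * (h t / H)))"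
  proof (rule integral_le)
    show "(\<lambda>t. f t powr \<alpha> * g t powr \<beta> * h t powr \<gamma>) integrable_on {0..T}"
      using nn e by (intro integrable_continuous_real continuous_on_mult continuous_on_powr' cont continuous_on_const) auto
    show "(\<lambda>t. c * (\<alpha> * (f t / F) + \<beta> * (g t / G) + \<gamma> * (h t / H))) integrable_on {0..T}"
      using has by (rule has_integral_integrable)
    fix t assume "t \<in> {0..T}"
    have "(f t / F) powr \<alpha> * (g t / G) powr \<beta> * (h t / H) powr \<gamma> \<le> \<alpha> * (f t / F) + \<beta> * (g t / G) + \<gamma> * (h t / H)"
      using nn FGH e by (intro powr_weighted_am_gm) auto
    then have "c * ((f t / F) powr \<alpha> * (g t / G) powr \<beta> * (h t / H) powr \<gamma>) \<le>
        c * (\<alpha> * (f t / F) + \<beta> * (g t / G) + \<gamma> * (h t / H))"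
      using c by (intro mult_left_mono) auto
    moreover have "c * ((f t / F) powr \<alpha> * (g t / G) powr \<beta> * (h t / H) powr \<gamma>) = f t powr \<alpha> * g t powr \<beta> * h t powr \<gamma>"
      using nn FGH by (simp add: c_def powr_divide)
    ultimately show "f t powr \<alpha> * g t powr \<beta> * h t powr \<gamma> \<le> c * (\<alpha> * (f t / F) + \<beta> * (g t / G) + \<gamma> * (h t / H))"
      by simp
  qed
  also have "\<dots> = c"
    unfolding integral_unique[OF has] using FGH e by simp
  finally show ?thesis
    by (simp add: c_def F_def G_def H_def)
qed

lemma continuous_zeta_sum [continuous_intros]: "continuous_on S (zeta_sum N)"
  unfolding zeta_sum_dpoly[abs_def] by (intro continuous_intros)

lemma norm_dpoly_zero: "dpoly {1..N} w 0 = of_real (weight_sum N w)"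
  by (simp add: dpoly_def weight_sum_def)

lemma integral_pos_of_pos_at_0:
  fixes f :: "real \<Rightarrow> real"
  assumes "0 < T" "continuous_on {0..T} f" "\<And>t. 0 \<le> f t" "0 < f 0"
  shows "0 < integral {0..T} f"
proof -
  have "f integrable_on {0..T}"
    using assms by (intro integrable_continuous_real)
  then have "0 \<le> integral {0..T} f"
    using assms by (intro integral_nonneg) auto
  moreover have "integral {0..T} f \<noteq> 0"
  proof
    assume "integral {0..T} f = 0"
    then have "f 0 = 0"
      using assms integral_eq_0_iff[of 0 T f] by auto
    then show False
      using assms by simp
  qed
  ultimately show ?thesis
    by simp
qed

lemma correlation_ge:
  assumes "0 < T" "\<And>m. m \<in> {1..N} \<Longrightarrow> 0 \<le> w m"
  shows "T / 2 * weight_sum N w \<le> integral {0..T} (\<lambda>t. norm (zeta_sum N t) * norm (dpoly {1..N} w t))"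
proof -
  have int: "((\<lambda>t. (1 - t / T) * Re (dpoly {1..N} (\<lambda>_. 1) t * cnj (dpoly {1..N} w t))) has_integral
    (\<Sum>k = 1..N. \<Sum>l = 1..N. 1 * w l * fejer T (ln (real k) - ln (real l)))) {0..T}"
    by (rule fejer_mean) (use assms in auto)
  have "T / 2 * weight_sum N w = (\<Sum>k = 1..N. w k * fejer T (ln (real k) - ln (real k)))"
    using assms(1) by (simp add: weight_sum_def fejer_zero sum_distrib_left mult.commute)
  also have "\<dots> \<le> (\<Sum>k = 1..N. \<Sum>l = 1..N. 1 * w l * fejer T (ln (real k) - ln (real l)))"
  proof (rule sum_mono)
    fix k assume k: "k \<in> {1..N}"
    then show "w k * fejer T (ln (real k) - ln (real k)) \<le> (\<Sum>l = 1..N. 1 * w l * fejer T (ln (real k) - ln (real l)))"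
      using member_le_sum[of k "{1..N}" "\<lambda>l. 1 * w l * fejer T (ln (real k) - ln (real l))"]
        assms(2) fejer_nonneg[OF assms(1)] by auto
  qed
  also have "\<dots> = integral {0..T} (\<lambda>t. (1 - t / T) * Re (dpoly {1..N} (\<lambda>_. 1) t * cnj (dpoly {1..N} w t)))"
    using int by (rule integral_unique[symmetric])
  also have "\<dots> \<le> integral {0..T} (\<lambda>t. norm (zeta_sum N t) * norm (dpoly {1..N} w t))"
  proof (rule integral_le)
    show "(\<lambda>t. (1 - t / T) * Re (dpoly {1..N} (\<lambda>_. 1) t * cnj (dpoly {1..N} w t))) integrable_on {0..T}"
      using int by (rule has_integral_integrable)
    show "(\<lambda>t. norm (zeta_sum N t) * norm (dpoly {1..N} w t)) integrable_on {0..T}"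
      by (intro integrable_continuous_real continuous_intros)
    fix t assume t: "t \<in> {0..T}"
    have "Re (dpoly {1..N} (\<lambda>_. 1) t * cnj (dpoly {1..N} w t)) \<le> norm (zeta_sum N t) * norm (dpoly {1..N} w t)"
      using complex_Re_le_cmod[of "zeta_sum N t * cnj (dpoly {1..N} w t)"] by (simp add: norm_mult zeta_sum_dpoly)
    then have "(1 - t / T) * Re (dpoly {1..N} (\<lambda>_. 1) t * cnj (dpoly {1..N} w t)) \<le>
        (1 - t / T) * (norm (zeta_sum N t) * norm (dpoly {1..N} w t))"
      using t assms(1) by (intro mult_left_mono) auto
    also have "\<dots> \<le> 1 * (norm (zeta_sum N t) * norm (dpoly {1..N} w t))"
      using t assms(1) by (intro mult_right_mono) auto
    finally show "(1 - t / T) * Re (dpoly {1..N} (\<lambda>_. 1) t * cnj (dpoly {1..N} w t)) \<le> norm (zeta_sum N t) * norm (dpoly {1..N} w t)"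
      by simp
  qed
  finally show ?thesis .
qed

text \<open>The exponents solve \<open>\<alpha> + \<beta> + 1 / 4 = 1\<close>, which lets the length
  \<open>T\<close> cancel, and \<open>r * \<alpha> + 2 * \<beta> = 1\<close>, which makes the first
  two Hoelder factors multiply to \<open>norm (zeta_sum N t)\<close>. For \<open>r < 2\<close> the
  solution has positive \<beta> exactly if \<open>r < 4 / 3\<close>.\<close>

lemma zeta_moment_holder:
  fixes r T :: real
  assumes r: "0 < r" "r < 4 / 3" and N: "1 \<le> N" "(real N)\<^sup>2 < T" and w: "w \<in> admissible_weights N"
  defines "\<alpha> \<equiv> 1 / (2 * (2 - r))" and "\<beta> \<equiv> (4 - 3 * r) / (4 * (2 - r))"
  shows "weight_sum N w / 2 \<le> ((1 / T) * integral {0..T} (\<lambda>t. norm (zeta_sum N t) powr r)) powr \<alpha>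
    * (10 * real N) powr \<beta> * (10 * mult_energy N w) powr (1 / 4)"
    and "0 < (1 / T) * integral {0..T} (\<lambda>t. norm (zeta_sum N t) powr r)"
proof -
  have NT: "real N \<le> T"
  proof -
    have "real N * 1 \<le> real N * real N"
      using N by (intro mult_left_mono) auto
    then show ?thesis
      using N(2) unfolding power2_eq_square by linarith
  qed
  have T: "0 < T"
    using NT N by linarith
  define M where "M = dpoly {1..N} w"
  define I1 where "I1 = integral {0..T} (\<lambda>t. norm (zeta_sum N t) powr r)"
  define I2 where "I2 = integral {0..T} (\<lambda>t. (norm (zeta_sum N t))\<^sup>2)"
  define I3 where "I3 = integral {0..T} (\<lambda>t. norm (M t) ^ 4)"
  have contM: "continuous_on S M" for S
    unfolding M_def by (intro continuous_intros)
  have wnn: "\<And>m. m \<in> {1..N} \<Longrightarrow> 0 \<le> w m"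
    using w by (simp add: admissible_weights_def)
  have W: "0 < weight_sum N w"
    by (rule weight_sum_pos[OF w])
  have Z0: "0 < norm (zeta_sum N 0)"
    unfolding zeta_sum_dpoly norm_dpoly_zero weight_sum_def using N by simp
  have M0: "0 < norm (M 0)"
    unfolding M_def norm_dpoly_zero using W by simp
  have cr: "continuous_on {0..T} (\<lambda>t. norm (zeta_sum N t) powr r)"
    using r by (intro continuous_on_powr' continuous_intros) auto
  have pos: "0 < I1" "0 < I2" "0 < I3"
    unfolding I1_def I2_def I3_def using Z0 M0 T
    by (intro integral_pos_of_pos_at_0 cr continuous_intros contM; simp)+
  then show "0 < (1 / T) * integral {0..T} (\<lambda>t. norm (zeta_sum N t) powr r)"
    using T by (simp add: I1_def)
  define J where "J = I1 / T"
  have J: "0 < J"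
    using pos T by (simp add: J_def)
  have exps: "0 < \<alpha>" "0 < \<beta>" "\<alpha> + \<beta> + 1 / 4 = 1" "r * \<alpha> + 2 * \<beta> = 1"
  proof -
    define d where "d = 2 - r"
    have d: "0 < d" "r = 2 - d" "0 < 3 * d - 2"
      using r by (auto simp: d_def)
    have ab: "\<alpha> = 1 / (2 * d)" "\<beta> = (3 * d - 2) / (4 * d)"
      by (simp_all add: \<alpha>_def \<beta>_def d(2))
    show "0 < \<alpha>" "0 < \<beta>"
      using d by (simp_all add: ab)
    show "\<alpha> + \<beta> + 1 / 4 = 1"
      using d(1) unfolding ab by (simp add: field_simps)
    show "r * \<alpha> + 2 * \<beta> = 1"
      using d(1) unfolding ab d(2) by (simp add: field_simps)
  qed
  have I2: "I2 \<le> T * (10 * real N)"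
    unfolding I2_def zeta_sum_dpoly using dpoly_mean_square_le[OF N(1) NT, of "\<lambda>_. 1"] by simp
  have I3: "I3 \<le> T * (10 * mult_energy N w)"
  proof -
    have "I3 = integral {0..T} (\<lambda>t. (norm (dpoly {1..N\<^sup>2} (conv2 N w) t))\<^sup>2)"
      unfolding I3_def M_def dpoly_square[symmetric] by (simp add: norm_power power_mult[symmetric])
    also have "\<dots> \<le> 10 * T * (\<Sum>k = 1..N\<^sup>2. (conv2 N w k)\<^sup>2)"
      using N by (intro dpoly_mean_square_le) auto
    finally show ?thesis
      by (simp add: mult_energy_conv2 mult_ac)
  qed
  have "T / 2 * weight_sum N w \<le> integral {0..T} (\<lambda>t. norm (zeta_sum N t) * norm (M t))"
    unfolding M_def by (rule correlation_ge[OF T wnn])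
  also have "(\<lambda>t. norm (zeta_sum N t) * norm (M t)) =
      (\<lambda>t. (norm (zeta_sum N t) powr r) powr \<alpha> * ((norm (zeta_sum N t))\<^sup>2) powr \<beta> * (norm (M t) ^ 4) powr (1 / 4))"
  proof
    fix t
    have "(norm (zeta_sum N t) powr r) powr \<alpha> * ((norm (zeta_sum N t))\<^sup>2) powr \<beta> = norm (zeta_sum N t)"
    proof (cases "zeta_sum N t = 0")
      case False
      then have "((norm (zeta_sum N t))\<^sup>2) powr \<beta> = norm (zeta_sum N t) powr (2 * \<beta>)"
        by (simp add: powr_powr[symmetric])
      then show ?thesis
        using False exps(4) by (simp add: powr_powr powr_add[symmetric])
    qed simp
    moreover have "(norm (M t) ^ 4) powr (1 / 4) = norm (M t)"
    proof (cases "M t = 0")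
      case False
      then have "norm (M t) ^ 4 = norm (M t) powr 4"
        by simp
      then show ?thesis
        using False by (simp only: powr_powr) simp
    qed simp
    ultimately show "norm (zeta_sum N t) * norm (M t) =
        (norm (zeta_sum N t) powr r) powr \<alpha> * ((norm (zeta_sum N t))\<^sup>2) powr \<beta> * (norm (M t) ^ 4) powr (1 / 4)"
      by simp
  qed
  also have "integral {0..T} \<dots> \<le> I1 powr \<alpha> * I2 powr \<beta> * I3 powr (1 / 4)"
    unfolding I1_def I2_def I3_def
    by (rule integral_holder3) (use pos exps in \<open>auto intro!: cr continuous_intros contM simp: I1_def I2_def I3_def\<close>)
  also have "\<dots> \<le> I1 powr \<alpha> * (T * (10 * real N)) powr \<beta> * (T * (10 * mult_energy N w)) powr (1 / 4)"
    using I2 I3 pos exps by (intro mult_mono powr_mono2 order_refl mult_nonneg_nonneg) auto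
  also have "I1 = T * J"
    unfolding J_def using T by simp
  also have "(T * J) powr \<alpha> * (T * (10 * real N)) powr \<beta> * (T * (10 * mult_energy N w)) powr (1 / 4) =
      T powr (\<alpha> + \<beta> + 1 / 4) * (J powr \<alpha> * (10 * real N) powr \<beta> * (10 * mult_energy N w) powr (1 / 4))"
  proof -
    have "0 \<le> mult_energy N w"
      unfolding mult_energy_conv2 by (intro sum_nonneg) simp
    then show ?thesis
      using T J by (simp add: powr_mult powr_add)
  qed
  also have "T powr (\<alpha> + \<beta> + 1 / 4) = T"
    using exps T by simp
  finally have "T * (weight_sum N w / 2) \<le> T * (J powr \<alpha> * (10 * real N) powr \<beta> * (10 * mult_energy N w) powr (1 / 4))"
    by simp
  then show "weight_sum N w / 2 \<le> ((1 / T) * integral {0..T} (\<lambda>t. norm (zeta_sum N t) powr r)) powr \<alpha>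
    * (10 * real N) powr \<beta> * (10 * mult_energy N w) powr (1 / 4)"
    using T by (simp add: I1_def J_def)
qed

section \<open>Moments of the zeta sum\<close>

text \<open>Cosines suffice, as the square of \<open>norm (zeta_sum N t)\<close> is a sum of them,
  and a product of two cosines is again such a sum. Each cosine has a mean value, so polynomials in
  that square have one too.\<close>

inductive trig_poly :: "(real \<Rightarrow> real) \<Rightarrow> bool" where
  cos: "trig_poly (\<lambda>t. c * cos (u * t))"
| add: "trig_poly f \<Longrightarrow> trig_poly g \<Longrightarrow> trig_poly (\<lambda>t. f t + g t)"

lemma trig_poly_const: "trig_poly (\<lambda>t. c)"
  using trig_poly.cos[of c 0] by simp

lemma trig_poly_sum:
  assumes "finite A" "\<And>a. a \<in> A \<Longrightarrow> trig_poly (f a)"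
  shows "trig_poly (\<lambda>t. \<Sum>a\<in>A. f a t)"
  using assms by (induction rule: finite_induct) (auto intro: trig_poly.add trig_poly_const)

lemma trig_poly_mult:
  assumes "trig_poly f" "trig_poly g"
  shows "trig_poly (\<lambda>t. f t * g t)"
  using assms(1)
proof induction
  case (cos c u)
  from assms(2) show ?case
  proof induction
    case (cos d v)
    have "(\<lambda>t. c * cos (u * t) * (d * cos (v * t))) =
        (\<lambda>t. c * d / 2 * cos ((u - v) * t) + c * d / 2 * cos ((u + v) * t))"
      by (simp add: fun_eq_iff left_diff_distrib distrib_right cos_diff cos_add field_simps)
    then show ?case
      by (simp only:) (intro trig_poly.intros)
  next
    case (add f g)
    then show ?case
      by (simp only: distrib_left) (rule trig_poly.add)
  qed
next
  case (add f g)
  then show ?case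
    by (simp only: distrib_right) (rule trig_poly.add)
qed

lemma trig_poly_continuous: "trig_poly f \<Longrightarrow> continuous_on S f"
  by (induction rule: trig_poly.induct) (auto intro!: continuous_intros)

lemma cos_mean_tendsto:
  fixes c u :: real
  assumes "u \<noteq> 0"
  shows "((\<lambda>T. (1 / T) * integral {0..T} (\<lambda>t. c * cos (u * t))) \<longlongrightarrow> 0) at_top"
proof (rule Lim_null_comparison)
  show "((\<lambda>T. \<bar>c / u\<bar> / T) \<longlongrightarrow> 0) at_top"
    by (rule real_tendsto_divide_at_top[OF tendsto_const filterlim_ident])
  show "\<forall>\<^sub>F T in at_top. norm ((1 / T) * integral {0..T} (\<lambda>t. c * cos (u * t))) \<le> \<bar>c / u\<bar> / T"
    using eventually_gt_at_top[of 0]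
  proof eventually_elim
    case (elim T)
    have "((\<lambda>t. c * cos (u * t)) has_integral c * sin (u * T) / u - c * sin (u * 0) / u) {0..T}"
      using assms elim
      by (intro fundamental_theorem_of_calculus)
        (auto intro!: derivative_eq_intros simp: has_real_derivative_iff_has_vector_derivative[symmetric])
    then have "integral {0..T} (\<lambda>t. c * cos (u * t)) = c * sin (u * T) / u - c * sin (u * 0) / u"
      by (rule integral_unique)
    also have "\<dots> = c / u * sin (u * T)"
      by simp
    finally have "integral {0..T} (\<lambda>t. c * cos (u * t)) = c / u * sin (u * T)" .
    moreover have "\<bar>c / u * sin (u * T)\<bar> \<le> \<bar>c / u\<bar>"
      using mult_left_mono[OF abs_sin_le_one[of "u * T"], of "\<bar>c / u\<bar>"] by (simp add: abs_mult)
    ultimately have "\<bar>integral {0..T} (\<lambda>t. c * cos (u * t))\<bar> / T \<le> \<bar>c / u\<bar> / T"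
      using elim by (intro divide_right_mono) (simp_all only: less_imp_le)
    moreover have "norm ((1 / T) * I) = \<bar>I\<bar> / T" for I
      using elim by (simp add: abs_mult)
    ultimately show ?case
      by (simp only:)
  qed
qed

lemma trig_poly_mean:
  assumes "trig_poly f"
  shows "\<exists>L. ((\<lambda>T. (1 / T) * integral {0..T} f) \<longlongrightarrow> L) at_top"
  using assms
proof induction
  case (cos c u)
  show ?case
  proof (cases "u = 0")
    case True
    have "((\<lambda>T. (1 / T) * integral {0..T} (\<lambda>t. c * cos (u * t))) \<longlongrightarrow> c) at_top"
      by (rule tendsto_eventually, rule eventually_mono[OF eventually_gt_at_top[of 0]]) (simp add: True)
    then show ?thesis ..
  next
    case False
    then show ?thesis
      using cos_mean_tendsto by blast
  qed
next
  case (add f g)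
  then obtain L M where L: "((\<lambda>T. (1 / T) * integral {0..T} f) \<longlongrightarrow> L) at_top"
    and M: "((\<lambda>T. (1 / T) * integral {0..T} g) \<longlongrightarrow> M) at_top"
    by blast
  have int: "f integrable_on {0..T}" "g integrable_on {0..T}" for T
    using add by (auto intro: integrable_continuous_real trig_poly_continuous)
  have "(\<lambda>T. (1 / T) * integral {0..T} (\<lambda>t. f t + g t)) =
      (\<lambda>T. (1 / T) * integral {0..T} f + (1 / T) * integral {0..T} g)"
    by (simp add: integral_add[OF int] distrib_left)
  then show ?case
    using tendsto_add[OF L M] by auto
qed

text \<open>A uniform error of \<epsilon> changes the mean over \<open>{0..T}\<close> by at most
  \<epsilon>. The means of \<open>f\<close> are thus eventually near some constant for every
  precision, and these constants form a Cauchy sequence whose limit is the mean.\<close>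

lemma mean_of_uniform_limit:
  fixes f :: "real \<Rightarrow> real"
  assumes f: "continuous_on UNIV f"
    and approx: "\<And>e. 0 < e \<Longrightarrow> \<exists>g L. continuous_on UNIV g \<and> (\<forall>t. \<bar>f t - g t\<bar> \<le> e) \<and>
      ((\<lambda>T. (1 / T) * integral {0..T} g) \<longlongrightarrow> L) at_top"
  shows "\<exists>L. ((\<lambda>T. (1 / T) * integral {0..T} f) \<longlongrightarrow> L) at_top"
proof -
  define m where "m = (\<lambda>T. (1 / T) * integral {0..T} f)"
  have near: "\<exists>L. \<forall>\<^sub>F T in at_top. \<bar>m T - L\<bar> < e" if e: "0 < e" for e
  proof -
    obtain g L where g: "continuous_on UNIV g" "\<And>t. \<bar>f t - g t\<bar> \<le> e / 2"
      and L: "((\<lambda>T. (1 / T) * integral {0..T} g) \<longlongrightarrow> L) at_top"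
      using approx[of "e / 2"] e by auto
    have "\<forall>\<^sub>F T in at_top. \<bar>(1 / T) * integral {0..T} g - L\<bar> < e / 2"
      using tendstoD[OF L, of "e / 2"] e by (simp add: dist_real_def)
    then have "\<forall>\<^sub>F T in at_top. \<bar>m T - L\<bar> < e"
      using eventually_gt_at_top[of 0]
    proof eventually_elim
      case (elim T)
      have "integral {0..T} f - integral {0..T} g = integral {0..T} (\<lambda>t. f t - g t)"
        by (intro integral_diff[symmetric] integrable_continuous_real continuous_on_subset[OF f]
            continuous_on_subset[OF g(1)]) auto
      moreover have "norm (integral {0..T} (\<lambda>t. f t - g t)) \<le> e / 2 * (T - 0)"
        using elim g by (intro integral_bound continuous_on_diff continuous_on_subset[OF f]
            continuous_on_subset[OF g(1)]) auto
      ultimately have "\<bar>integral {0..T} f - integral {0..T} g\<bar> \<le> e / 2 * T"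
        by simp
      then have "\<bar>m T - (1 / T) * integral {0..T} g\<bar> \<le> e / 2"
        unfolding m_def right_diff_distrib[symmetric] using elim by (simp add: abs_mult divide_le_eq)
      then show ?case
        using elim by linarith
    qed
    then show ?thesis ..
  qed
  have "\<forall>n. \<exists>L. \<forall>\<^sub>F T in at_top. \<bar>m T - L\<bar> < 1 / real (Suc n)"
    using near by simp
  then obtain l where l: "\<And>n. \<forall>\<^sub>F T in at_top. \<bar>m T - l n\<bar> < 1 / real (Suc n)"
    by metis
  have close: "\<bar>l a - l b\<bar> < 1 / real (Suc a) + 1 / real (Suc b)" for a b
  proof -
    have "\<forall>\<^sub>F T in at_top. \<bar>m T - l a\<bar> < 1 / real (Suc a) \<and> \<bar>m T - l b\<bar> < 1 / real (Suc b)"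
      using l[of a] l[of b] by (rule eventually_conj)
    then obtain T where "\<bar>m T - l a\<bar> < 1 / real (Suc a)" "\<bar>m T - l b\<bar> < 1 / real (Suc b)"
      by (auto dest: eventually_happens simp del: of_nat_Suc)
    then show ?thesis
      by linarith
  qed
  have "Cauchy l"
  proof (rule metric_CauchyI)
    fix e :: real assume e: "0 < e"
    then obtain n0 where n0: "1 / real (Suc n0) < e / 2"
      using nat_approx_posE[of "e / 2"] by auto
    have "dist (l a) (l b) < e" if "n0 \<le> a" "n0 \<le> b" for a b
    proof -
      have "1 / real (Suc a) \<le> 1 / real (Suc n0)" "1 / real (Suc b) \<le> 1 / real (Suc n0)"
        using that by (auto intro!: divide_left_mono)
      then show ?thesis
        using close[of a b] n0 unfolding dist_real_def by linarith
    qed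
    then show "\<exists>M. \<forall>a\<ge>M. \<forall>b\<ge>M. dist (l a) (l b) < e"
      by blast
  qed
  then obtain L where L: "l \<longlonglongrightarrow> L"
    using Cauchy_convergent_iff[of l] by (auto simp: convergent_def)
  have "(m \<longlongrightarrow> L) at_top"
  proof (rule tendstoI)
    fix e :: real assume e: "0 < e"
    obtain n0 where n0: "1 / real (Suc n0) < e / 2"
      using nat_approx_posE[of "e / 2"] e by auto
    have "\<forall>\<^sub>F n in sequentially. dist (l n) L < e / 2"
      using L e by (intro tendstoD) auto
    then obtain n1 where n1: "\<And>n. n1 \<le> n \<Longrightarrow> dist (l n) L < e / 2"
      by (auto simp: eventually_sequentially)
    define n where "n = max n0 n1"
    have "1 / real (Suc n) \<le> 1 / real (Suc n0)"
      by (auto simp: n_def intro!: divide_left_mono)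
    then have n: "1 / real (Suc n) < e / 2" "dist (l n) L < e / 2"
      using n0 n1[of n] by (auto simp: n_def)
    show "\<forall>\<^sub>F T in at_top. dist (m T) L < e"
      using l[of n]
    proof eventually_elim
      case (elim T)
      then show ?case
        using n unfolding dist_real_def by linarith
    qed
  qed
  then show ?thesis
    unfolding m_def ..
qed

lemma norm_zeta_sum_le: "norm (zeta_sum N t) \<le> real N"
proof -
  have "norm (zeta_sum N t) \<le> (\<Sum>k = 1..N. norm (of_real 1 * cis (t * ln (real k))))"
    unfolding zeta_sum_dpoly dpoly_def by (rule norm_sum)
  then show ?thesis
    by simp
qed

lemma trig_poly_zeta_sq: "trig_poly (\<lambda>t. (norm (zeta_sum N t))\<^sup>2)"
proof -
  have "(norm (zeta_sum N t))\<^sup>2 = Re (dpoly {1..N} (\<lambda>_. 1) t * cnj (dpoly {1..N} (\<lambda>_. 1) t))" for t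
    unfolding zeta_sum_dpoly by (simp only: complex_norm_square[symmetric] Re_complex_of_real)
  then have "(\<lambda>t. (norm (zeta_sum N t))\<^sup>2) =
      (\<lambda>t. \<Sum>k = 1..N. \<Sum>l = 1..N. 1 * 1 * cos ((ln (real k) - ln (real l)) * t))"
    unfolding dpoly_mult_cnj by simp
  then show ?thesis
    by (simp only:) (intro trig_poly_sum trig_poly.cos finite_atLeastAtMost)
qed

lemma trig_poly_polynomial:
  fixes p :: "real \<Rightarrow> real"
  assumes "real_polynomial_function p" "trig_poly f"
  shows "trig_poly (\<lambda>t. p (f t))"
  using assms(1)
proof (induction rule: real_polynomial_function.induct)
  case (linear h)
  \<comment> \<open>The linear base case on \<open>real\<close> is multiplication by a
    constant.\<close>
  have "h x = x * h 1" for x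
    using linear_scale[OF bounded_linear.linear[OF linear], of x 1] by simp
  then have "(\<lambda>t. h (f t)) = (\<lambda>t. f t * h 1)"
    by metis
  then show ?case
    by (simp only:) (intro trig_poly_mult assms(2) trig_poly_const)
next
  case (const c)
  show ?case
    by (rule trig_poly_const)
next
  case (add f g)
  then show ?case
    by (intro trig_poly.add)
next
  case (mult f g)
  then show ?case
    by (intro trig_poly_mult)
qed

text \<open>By Weierstrass, the square root is a uniform limit of polynomials in the trigonometric
  polynomial under it.\<close>

lemma zeta_mean_exists:
  "\<exists>L. ((\<lambda>T. (1 / T) * integral {0..T} (\<lambda>t. norm (zeta_sum N t))) \<longlongrightarrow> L) at_top"
proof (rule mean_of_uniform_limit)
  show "continuous_on UNIV (\<lambda>t. norm (zeta_sum N t))"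
    by (intro continuous_intros)
  fix e :: real assume e: "0 < e"
  have cont: "continuous_on {0..(real N)\<^sup>2} sqrt"
    by (intro continuous_intros)
  obtain p where p: "real_polynomial_function p" "\<And>x. x \<in> {0..(real N)\<^sup>2} \<Longrightarrow> \<bar>sqrt x - p x\<bar> < e"
    using Stone_Weierstrass_real_polynomial_function[OF compact_Icc cont e] by blast
  have trig: "trig_poly (\<lambda>t. p ((norm (zeta_sum N t))\<^sup>2))"
    by (rule trig_poly_polynomial[OF p(1) trig_poly_zeta_sq])
  have close: "\<bar>norm (zeta_sum N t) - p ((norm (zeta_sum N t))\<^sup>2)\<bar> \<le> e" for t
  proof -
    have "(norm (zeta_sum N t))\<^sup>2 \<in> {0..(real N)\<^sup>2}"
      using power_mono[OF norm_zeta_sum_le[of N t] norm_ge_zero, of 2] by simp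
    from p(2)[OF this] show ?thesis
      by (simp add: less_imp_le)
  qed
  have cont_p: "continuous_on UNIV (\<lambda>t. p ((norm (zeta_sum N t))\<^sup>2))"
    by (rule trig_poly_continuous[OF trig])
  obtain L where L: "((\<lambda>T. (1 / T) * integral {0..T} (\<lambda>t. p ((norm (zeta_sum N t))\<^sup>2))) \<longlongrightarrow> L) at_top"
    using trig_poly_mean[OF trig] by blast
  show "\<exists>g L. continuous_on UNIV g \<and> (\<forall>t. \<bar>norm (zeta_sum N t) - g t\<bar> \<le> e) \<and>
      ((\<lambda>T. (1 / T) * integral {0..T} g) \<longlongrightarrow> L) at_top"
    by (intro exI[of _ "\<lambda>t. p ((norm (zeta_sum N t))\<^sup>2)"] exI[of _ L] conjI allI cont_p close L)
qed

section \<open>The lower bounds for moments, mean value and energy factor\<close>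

lemma zeta_moment_lower:
  fixes r :: real
  assumes r: "0 < r" "r < 4 / 3"
  shows "\<exists>c>0. \<forall>N\<ge>1. \<forall>T::real. (real N)\<^sup>2 < T \<longrightarrow>
    (1 / T) * integral {0..T} (\<lambda>t. norm (zeta_sum N t) powr r)
      \<ge> c * (real N powr (r / 2) / min_energy N powr (1 - r / 2))"
proof -
  define d where "d = 1 - r / 2"
  have d: "0 < d" "r = 2 - 2 * d" "1 - d = r / 2"
    using r by (auto simp: d_def)
  define \<alpha> where "\<alpha> = 1 / (2 * (2 - r))"
  define \<beta> where "\<beta> = (4 - 3 * r) / (4 * (2 - r))"
  \<comment> \<open>Raising the Hoelder bound to the power \<open>4 * d\<close> makes it linear in
    the moment and gives the energy the exponent \<open>d = 1 - r / 2\<close> of the claim.\<close>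
  have ab: "\<alpha> * (4 * d) = 1" "\<beta> * (4 * d) = 3 * d - 1"
    using d(1) by (simp_all add: \<alpha>_def \<beta>_def d(2) field_simps)
  \<comment> \<open>After raising to the power \<open>4 * d\<close>, the 1/2 before the weight sum
    becomes \<open>1 / 16 powr d\<close>, and the two factors 10 give
    \<open>10 powr (3 * d - 1)\<close> and \<open>10 powr d\<close>.\<close>
  define c where "c = 1 / (16 powr d * 10 powr (4 * d - 1) :: real)"
  have c: "0 < c"
    by (simp add: c_def)
  have "c * (real N powr (r / 2) / min_energy N powr d) \<le> (1 / T) * integral {0..T} (\<lambda>t. norm (zeta_sum N t) powr r)"
    if N: "1 \<le> N" "(real N)\<^sup>2 < T" for N T
  proof -
    define J where "J = (1 / T) * integral {0..T} (\<lambda>t. norm (zeta_sum N t) powr r)"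
    \<comment> \<open>The claim amounts to \<open>y \<le> min_energy N powr d\<close>. As
      \<open>y\<close> is independent of the weight, it is enough to bound
      \<open>y powr (1 / d)\<close> by the ratio of each \<open>w\<close> and to pass to the
      infimum.\<close>
    define y where "y = c * real N powr (r / 2) / J"
    have N0: "0 < real N"
      using N by simp
    have J: "0 < J"
      unfolding J_def by (rule zeta_moment_holder(2)[OF r N admissible_weights_nonempty[OF N(1)]])
    have y: "0 < y"
      using c J N0 by (simp add: y_def)
    have "y powr (1 / d) \<le> (real N)\<^sup>2 * mult_energy N w / weight_sum N w ^ 4"
      if w: "w \<in> admissible_weights N" for w
    proof -
      define W where "W = weight_sum N w"
      define E where "E = mult_energy N w"
      define X where "X = (real N)\<^sup>2 * E / W ^ 4"
      have W: "0 < W"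
        unfolding W_def by (rule weight_sum_pos[OF w])
      have X: "1 \<le> X"
        unfolding X_def E_def W_def by (rule energy_ratio_ge_1[OF w])
      have E0: "0 \<le> E"
        unfolding E_def mult_energy_conv2 by (intro sum_nonneg) simp
      have XW: "real N powr (2 * d) * E powr d = X powr d * W powr (4 * d)"
      proof -
        have "(real N)\<^sup>2 * E = X * W ^ 4"
          using W by (simp add: X_def)
        then have "((real N)\<^sup>2 * E) powr d = (X * W ^ 4) powr d"
          by simp
        then have "((real N)\<^sup>2) powr d * E powr d = X powr d * (W ^ 4) powr d"
          using E0 X W by (simp add: powr_mult)
        moreover have "((real N)\<^sup>2) powr d = real N powr (2 * d)" "(W ^ 4) powr d = W powr (4 * d)"
          using N0 W by (simp_all add: powr_powr[symmetric])
        ultimately show ?thesis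
          by simp
      qed
      have "W / 2 \<le> J powr \<alpha> * (10 * real N) powr \<beta> * (10 * E) powr (1 / 4)"
        unfolding J_def W_def E_def \<alpha>_def \<beta>_def by (rule zeta_moment_holder(1)[OF r N w])
      then have "(W / 2) powr (4 * d) \<le> (J powr \<alpha> * (10 * real N) powr \<beta> * (10 * E) powr (1 / 4)) powr (4 * d)"
        using W d by (intro powr_mono2) auto
      also have "\<dots> = J * (10 * real N) powr (3 * d - 1) * (10 * E) powr d"
        using J N0 E0 by (simp add: powr_mult powr_powr ab)
      also have "(W / 2) powr (4 * d) = W powr (4 * d) / 16 powr d"
      proof -
        have "(2::real) powr (4 * d) = (2 powr 4) powr d"
          by (rule powr_powr[symmetric])
        then show ?thesis
          using W by (simp add: powr_divide)
      qed
      finally have "real N powr (2 * d) * (W powr (4 * d) / 16 powr d) \<le>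
          real N powr (2 * d) * (J * (10 * real N) powr (3 * d - 1) * (10 * E) powr d)"
        by (intro mult_left_mono) auto
      also have "\<dots> = J * (10 powr (3 * d - 1) * 10 powr d) * real N powr (3 * d - 1) * (real N powr (2 * d) * E powr d)"
        using N0 E0 by (simp add: powr_mult)
      also have "\<dots> = (J * 10 powr (4 * d - 1) * real N powr (3 * d - 1) * X powr d) * W powr (4 * d)"
        unfolding XW by (simp add: powr_add[symmetric])
      finally have "(real N powr (2 * d) / 16 powr d) * W powr (4 * d) \<le>
          (J * 10 powr (4 * d - 1) * real N powr (3 * d - 1) * X powr d) * W powr (4 * d)"
        by simp
      then have "real N powr (2 * d) / 16 powr d \<le> J * 10 powr (4 * d - 1) * real N powr (3 * d - 1) * X powr d"
        using W by (subst (asm) mult_le_cancel_right) auto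
      moreover have "real N powr (2 * d) = real N powr (1 - d) * real N powr (3 * d - 1)"
        by (simp add: powr_add[symmetric])
      ultimately have "real N powr (1 - d) / 16 powr d * real N powr (3 * d - 1) \<le>
          J * 10 powr (4 * d - 1) * X powr d * real N powr (3 * d - 1)"
        by (simp add: mult_ac)
      then have "real N powr (1 - d) / 16 powr d \<le> J * 10 powr (4 * d - 1) * X powr d"
        using N0 by (subst (asm) mult_le_cancel_right) auto
      then have "y \<le> X powr d"
        using J unfolding y_def c_def d(3) by (simp add: divide_le_eq mult_ac)
      then have "y powr (1 / d) \<le> (X powr d) powr (1 / d)"
        using y d by (intro powr_mono2) auto
      also have "\<dots> = X"
        using X d by (simp add: powr_powr)
      finally show ?thesis
        unfolding X_def E_def W_def .
    qed
    then have "y powr (1 / d) \<le> min_energy N"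
      unfolding min_energy_def using admissible_weights_nonempty[OF N(1)]
      by (intro cINF_greatest) auto
    then have "(y powr (1 / d)) powr d \<le> min_energy N powr d"
      using d by (intro powr_mono2) auto
    then have "y \<le> min_energy N powr d"
      using y d by (simp add: powr_powr)
    moreover have "0 < min_energy N powr d"
      using min_energy_ge_1[OF N(1)] by simp
    ultimately show ?thesis
      using J unfolding y_def J_def[symmetric] by (simp add: field_simps)
  qed
  then show ?thesis
    using c unfolding d_def by blast
qed

lemma zeta_mean_lower:
  "\<exists>c>0. \<forall>N\<ge>1. \<exists>L::real.
     ((\<lambda>T. (1 / T) * integral {0..T} (\<lambda>t. norm (zeta_sum N t))) \<longlongrightarrow> L) at_top
     \<and> L \<ge> c * (sqrt (real N) / min_energy N powr (1 / 2))"
proof -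
  obtain c where c: "0 < c" "\<And>N T. 1 \<le> N \<Longrightarrow> (real N)\<^sup>2 < T \<Longrightarrow>
    (1 / T) * integral {0..T} (\<lambda>t. norm (zeta_sum N t) powr 1)
      \<ge> c * (real N powr (1 / 2) / min_energy N powr (1 - 1 / 2))"
    using zeta_moment_lower[of 1] by auto
  have "\<exists>L::real. ((\<lambda>T. (1 / T) * integral {0..T} (\<lambda>t. norm (zeta_sum N t))) \<longlongrightarrow> L) at_top
     \<and> L \<ge> c * (sqrt (real N) / min_energy N powr (1 / 2))" if N: "1 \<le> N" for N
  proof -
    obtain L where L: "((\<lambda>T. (1 / T) * integral {0..T} (\<lambda>t. norm (zeta_sum N t))) \<longlongrightarrow> L) at_top"
      using zeta_mean_exists by blast
    have "\<forall>\<^sub>F T in at_top. c * (sqrt (real N) / min_energy N powr (1 / 2)) \<le>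
        (1 / T) * integral {0..T} (\<lambda>t. norm (zeta_sum N t))"
      using eventually_gt_at_top[of "(real N)\<^sup>2"]
    proof eventually_elim
      case (elim T)
      then show ?case
        using c(2)[OF N elim] by (simp add: powr_half_sqrt)
    qed
    then have "c * (sqrt (real N) / min_energy N powr (1 / 2)) \<le> L"
      by (intro tendsto_lowerbound[OF L]) auto
    then show ?thesis
      using L by blast
  qed
  then show ?thesis
    using c(1) by blast
qed

text \<open>Unit mass at 1. This crude bound serves \<open>N = 2\<close>, where
  \<open>ln (ln N)\<close> is negative.\<close>

lemma min_energy_le_square:
  assumes "1 \<le> N"
  shows "min_energy N \<le> (real N)\<^sup>2"
proof -
  define w :: "nat \<Rightarrow> real" where "w = (\<lambda>m. if m = 1 then 1 else 0)"
  have adm: "w \<in> admissible_weights N"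
    using assms by (auto simp: w_def admissible_weights_def)
  have W: "weight_sum N w = 1"
    using assms by (simp add: w_def weight_sum_def)
  let ?S = "{(m1, m2, n1, n2). m1 \<in> {1..N} \<and> m2 \<in> {1..N} \<and> n1 \<in> {1..N} \<and> n2 \<in> {1..N} \<and> m1 * m2 = n1 * n2}"
  have "mult_energy N w = (\<Sum>(m1, m2, n1, n2)\<in>{(1, 1, 1, 1)}. w m1 * w m2 * w n1 * w n2)"
    unfolding mult_energy_def
  proof (rule sum.mono_neutral_right)
    show "finite ?S"
      by (rule finite_subset[of _ "{1..N} \<times> {1..N} \<times> {1..N} \<times> {1..N}"]) auto
  qed (use assms in \<open>auto simp: w_def split: if_splits\<close>)
  then have "mult_energy N w = 1"
    by (simp add: w_def)
  then show ?thesis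
    using min_energy_le[OF adm] W by simp
qed

lemma sqrt_energy_lower:
  "\<exists>\<epsilon>::nat \<Rightarrow> real. \<epsilon> \<longlonglongrightarrow> 0 \<and>
    (\<exists>c>0. \<forall>N\<ge>2. sqrt (real N) / min_energy N powr (1 / 2)
       \<ge> c * (sqrt (real N) / ln (real N) powr (delta / 2 + \<epsilon> N)))"
proof -
  \<comment> \<open>Half the excess over \<open>delta\<close> of the exponent of \<open>ln N\<close>
    in the energy. It is cut off at 0 because \<open>min_energy_asymptotic\<close> bounds the
    exponent only from above; for \<open>N = 2\<close> the quotient by \<open>ln (ln N)\<close> has
    no such meaning and the constant 1/4 takes over.\<close>
  define \<epsilon> where "\<epsilon> = (\<lambda>N. if N < 3 then 0 else max 0 (ln (min_energy N) / ln (ln (real N)) - delta) / 2)"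
  have lnln: "0 < ln (ln (real N))" if "3 \<le> N" for N
  proof -
    have "exp 1 < real N"
      using that e_less_272 by linarith
    then have "ln (exp 1) < ln (real N)"
      using that by (subst ln_less_cancel_iff) auto
    then show ?thesis
      by simp
  qed
  have "\<epsilon> \<longlonglongrightarrow> 0"
  proof (rule tendstoI)
    fix e :: real assume e: "0 < e"
    show "\<forall>\<^sub>F N in sequentially. dist (\<epsilon> N) 0 < e"
      using min_energy_asymptotic[OF e] eventually_ge_at_top[of 3]
    proof eventually_elim
      case (elim N)
      have "1 \<le> min_energy N"
        using elim by (intro min_energy_ge_1) simp
      then have "ln (min_energy N) \<le> ln (ln (real N) powr (delta + e))"
        using elim by (intro ln_mono) auto
      also have "\<dots> = (delta + e) * ln (ln (real N))"
        using elim by (simp add: ln_powr)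
      finally have "ln (min_energy N) / ln (ln (real N)) \<le> delta + e"
        using lnln[OF elim(2)] by (simp add: divide_le_eq)
      then show ?case
        using e elim(2) by (auto simp: \<epsilon>_def)
    qed
  qed
  moreover have "1 / 4 * (sqrt (real N) / ln (real N) powr (delta / 2 + \<epsilon> N)) \<le> sqrt (real N) / min_energy N powr (1 / 2)"
    if N: "2 \<le> N" for N
  proof -
    have E1: "1 \<le> min_energy N"
      using N by (intro min_energy_ge_1) simp
    have L: "1 / 2 \<le> ln (real N)"
    proof -
      have "ln 2 \<le> ln (real N)"
        using N by (intro ln_mono) auto
      then show ?thesis
        using ln2_ge_two_thirds by linarith
    qed
    have "min_energy N powr (1 / 2) \<le> 4 * ln (real N) powr (delta / 2 + \<epsilon> N)"
    proof (cases "N < 3")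
      case True
      have "min_energy N powr (1 / 2) \<le> ((real N)\<^sup>2) powr (1 / 2)"
        using N E1 by (intro powr_mono2 min_energy_le_square) auto
      also have "\<dots> = real N"
        by (simp add: powr_half_sqrt)
      also have "\<dots> \<le> 2"
        using True by simp
      \<comment> \<open>The factor 4 covers \<open>N = 2\<close>: it suffices that
        \<open>ln 2 \<ge> 1 / 2\<close> and that \<open>delta / 2\<close> lies between 0 and
        1.\<close>
      also have "2 = 4 * (1 / 2) powr (1::real)"
        by simp
      also have "\<dots> \<le> 4 * (1 / 2) powr (delta / 2)"
        using delta_bounds by (intro mult_left_mono powr_mono') auto
      also have "\<dots> \<le> 4 * ln (real N) powr (delta / 2)"
        using delta_bounds L by (intro mult_left_mono powr_mono2) auto
      finally show ?thesis
        using True by (simp add: \<epsilon>_def)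
    next
      case False
      then have l: "0 < ln (ln (real N))"
        by (intro lnln) simp
      have "ln (min_energy N) / ln (ln (real N)) \<le> 2 * (delta / 2 + \<epsilon> N)"
        using False by (simp add: \<epsilon>_def)
      then have "ln (min_energy N) * (1 / 2) \<le> (delta / 2 + \<epsilon> N) * ln (ln (real N))"
        using l by (simp add: divide_le_eq algebra_simps)
      then have "min_energy N powr (1 / 2) \<le> ln (real N) powr (delta / 2 + \<epsilon> N)"
        using E1 L by (simp add: powr_def mult.commute)
      also have "\<dots> \<le> 4 * ln (real N) powr (delta / 2 + \<epsilon> N)"
        by simp
      finally show ?thesis .
    qed
    moreover have "0 < min_energy N powr (1 / 2)" "0 < ln (real N) powr (delta / 2 + \<epsilon> N)"
      using E1 L by auto
    ultimately have "1 / (4 * ln (real N) powr (delta / 2 + \<epsilon> N)) \<le> 1 / min_energy N powr (1 / 2)"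
      by (intro divide_left_mono) auto
    then have "sqrt (real N) * (1 / (4 * ln (real N) powr (delta / 2 + \<epsilon> N))) \<le> sqrt (real N) * (1 / min_energy N powr (1 / 2))"
      by (intro mult_left_mono) auto
    then show ?thesis
      by simp
  qed
  ultimately show ?thesis
    by (intro exI[of _ \<epsilon>] conjI exI[of _ "1 / 4"]) auto
qed

theorem theorem7:
  "(\<forall>r::real. 0 < r \<and> r < 4 / 3 \<longrightarrow>
      (\<exists>c>0. \<forall>N\<ge>1. \<forall>T::real. (real N)\<^sup>2 < T \<longrightarrow>
         (1 / T) * integral {0..T} (\<lambda>t. norm (zeta_sum N t) powr r)
           \<ge> c * (real N powr (r / 2) / min_energy N powr (1 - r / 2))))
   \<and> (\<exists>c>0. \<forall>N\<ge>1. \<exists>L::real.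
         ((\<lambda>T. (1 / T) * integral {0..T} (\<lambda>t. norm (zeta_sum N t))) \<longlongrightarrow> L) at_top
         \<and> L \<ge> c * (sqrt (real N) / min_energy N powr (1 / 2)))
   \<and> (\<exists>\<epsilon>::nat \<Rightarrow> real. \<epsilon> \<longlonglongrightarrow> 0 \<and>
        (\<exists>c>0. \<forall>N\<ge>2. sqrt (real N) / min_energy N powr (1 / 2)
           \<ge> c * (sqrt (real N) / ln (real N) powr (delta / 2 + \<epsilon> N))))
   \<and> \<bar>delta / 2 - 0.043\<bar> < 0.0005"
  by (intro conjI allI impI zeta_moment_lower zeta_mean_lower sqrt_energy_lower delta_numeric) auto

end
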